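(* Let $\nu\ge 1$ and $p\ge 1$ be integers, let $\omega\in\mathbb{R}^\nu$ have entries linearly independent over $\mathbb{Z}$, and let $k>\kappa>0$. Let $L$ be a Fourier multiplier operator with purely imaginary symbol $m:\mathbb{R}\to i\mathbb{R}$ satisfying the growth bound $$\sup_{\xi\in\mathbb{R}}|m(\xi)|\,e^{-\frac{k-\varepsilon}{|\omega|}|\xi|}<\infty\quad\text{for some }\varepsilon>0$$ and the symmetry condition $m(-\xi)=\overline{m(\xi)}$ for all $\xi\in\mathbb{R}$. Then, for initial data in $V^{\omega,k}_{\mathbb{R}}$, the Cauchy problem $$\partial_t u+Lu+\partial_x(u^{p+1})=0,\qquad u(0,x)=u_0(x)$$ is unconditionally locally well-posed in $V^{\omega,\kappa}_{\mathbb{R}}$ both forward and backward in time. That is: for every $u_0\in V^{\omega,k}_{\mathbb{R}}$ there exist an open ball $B\subseteq V^{\omega,k}_{\mathbb{R}}$ containing $u_0$ and a $T>0$ such that for every $\tilde u_0\in B$ there exists a unique classical solution $u\in C([-T,T],V^{\omega,\kappa}_{\mathbb{R}})$ with $u(0,\cdot)=\tilde u_0$, and the data-to-solution map $B\to C([-T,T],V^{\omega,\kappa}_{\mathbb{R}})$ is Lipschitz continuous.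
   Context: $|\cdot|$ on $\mathbb{R}^\nu$ and $\mathbb{Z}^\nu$ is the Euclidean norm, $\langle\cdot,\cdot\rangle$ the Euclidean inner product. For $s>0$, $V^{\omega,s}$ is the space of functions $u:\mathbb{R}\to\mathbb{C}$ of the form $u(x)=\sum_{n\in\mathbb{Z}^\nu}\widehat u(n)e^{i\langle\omega,n\rangle x}$ with finite norm $\|u\|_{\omega,s}=\sum_{n\in\mathbb{Z}^\nu}|\widehat u(n)|e^{s|n|}$. The coefficients are uniquely determined by $u$, via $\widehat u(n)=\lim_{N\to\infty}\frac{1}{2N}\int_{-N}^N u(x)e^{-i\langle\omega,n\rangle x}dx$. $V^{\omega,s}_{\mathbb{R}}$ is the subspace of real-valued functions (equivalently $\widehat u(-n)=\overline{\widehat u(n)}$). $C([-T,T],V^{\omega,s}_{\mathbb{R}})$ is the space of continuous functions $[-T,T]\to V^{\omega,s}_{\mathbb{R}}$ with norm $\sup_{t\in[-T,T]}\|u(t,\cdot)\|_{\omega,s}$. The multiplier operator $L$ with symbol $m$ acts by $Lu(x)=\sum_{n\in\mathbb{Z}^\nu}m(\langle\omega,n\rangle)\widehat u(n)e^{i\langle\omega,n\rangle x}$. The growth bound ensures that $L$ maps $V^{\omega,k}$ into $V^{\omega,\varepsilon}$; the symmetry condition ensures that $L$ maps real-valued functions to real-valued functions. A function $u\in C([-T,T],V^{\omega,\kappa}_{\mathbb{R}})$ is a classical solution of the equation if it is at least once continuously differentiable in the time variable and satisfies the equation pointwise. *)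

theory Defs
  imports "HOL-Analysis.Analysis"
begin

text \<open>The dimension is \<open>CARD('n)\<close>; a frequency \<open>\<omega>\<close> is a vector of type \<open>real ^ 'n\<close> and the
  integer lattice is the type \<open>int ^ 'n\<close>.\<close>

definition lattice_vec :: "int ^ 'n \<Rightarrow> real ^ 'n::finite" where
  "lattice_vec n = (\<chi> i. real_of_int (n $ i))"

definition mode :: "real ^ 'n::finite \<Rightarrow> int ^ 'n \<Rightarrow> real \<Rightarrow> complex" where
  "mode \<omega> n x = exp (\<i> * of_real ((\<omega> \<bullet> lattice_vec n) * x))"

definition fourier_coeff :: "real ^ 'n::finite \<Rightarrow> (real \<Rightarrow> complex) \<Rightarrow> int ^ 'n \<Rightarrow> complex" where
  "fourier_coeff \<omega> u n =
     Lim at_top (\<lambda>N::real. of_real (1 / (2 * N)) *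
       integral {-N..N} (\<lambda>x. u x * exp (- \<i> * of_real ((\<omega> \<bullet> lattice_vec n) * x))))"

definition V_space :: "real ^ 'n::finite \<Rightarrow> real \<Rightarrow> (real \<Rightarrow> complex) set" where
  "V_space \<omega> s = {u. \<exists>c :: int ^ 'n \<Rightarrow> complex.
     (\<lambda>n. norm (c n) * exp (s * norm (lattice_vec n))) summable_on UNIV \<and>
     (\<forall>x. ((\<lambda>n. c n * mode \<omega> n x) has_sum u x) UNIV)}"

definition V_real :: "real ^ 'n::finite \<Rightarrow> real \<Rightarrow> (real \<Rightarrow> complex) set" where
  "V_real \<omega> s = {u \<in> V_space \<omega> s. \<forall>x. u x \<in> \<real>}"

definition V_norm :: "real ^ 'n::finite \<Rightarrow> real \<Rightarrow> (real \<Rightarrow> complex) \<Rightarrow> real" where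
  "V_norm \<omega> s u =
     (\<Sum>\<^sub>\<infinity>n\<in>UNIV. norm (fourier_coeff \<omega> u n) * exp (s * norm (lattice_vec n)))"

definition V_ball ::
    "real ^ 'n::finite \<Rightarrow> real \<Rightarrow> (real \<Rightarrow> complex) \<Rightarrow> real \<Rightarrow> (real \<Rightarrow> complex) set" where
  "V_ball \<omega> s c r = {v \<in> V_real \<omega> s. V_norm \<omega> s (\<lambda>x. v x - c x) < r}"

text \<open>Functions on the closed interval from \<open>-T\<close> to \<open>T\<close> are represented extensionally (equal to
  \<open>undefined\<close> outside it), so that equality in \<open>C_space\<close> is equality on the interval.\<close>

definition C_space :: "real ^ 'n::finite \<Rightarrow> real \<Rightarrow> real \<Rightarrow> (real \<Rightarrow> real \<Rightarrow> complex) set" where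
  "C_space \<omega> s T = {u \<in> {-T..T} \<rightarrow>\<^sub>E V_real \<omega> s.
     \<forall>t\<in>{-T..T}. ((\<lambda>r. V_norm \<omega> s (\<lambda>x. u r x - u t x)) \<longlongrightarrow> 0) (at t within {-T..T})}"

definition C_norm :: "real ^ 'n::finite \<Rightarrow> real \<Rightarrow> real \<Rightarrow> (real \<Rightarrow> real \<Rightarrow> complex) \<Rightarrow> real" where
  "C_norm \<omega> s T u = (SUP t\<in>{-T..T}. V_norm \<omega> s (u t))"

definition multiplier ::
    "real ^ 'n::finite \<Rightarrow> (real \<Rightarrow> complex) \<Rightarrow> (real \<Rightarrow> complex) \<Rightarrow> real \<Rightarrow> complex" where
  "multiplier \<omega> m u x =
     (\<Sum>\<^sub>\<infinity>n\<in>UNIV. m (\<omega> \<bullet> lattice_vec n) * fourier_coeff \<omega> u n * mode \<omega> n x)"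

text \<open>The symbol may grow faster than the coefficients of an element of \<open>V_space \<omega> \<kappa>\<close> decay, in
  which case the series defining the multiplier diverges. The domain consists of the functions
  for which that series is the expansion of an element of some \<open>V_space \<omega> s\<close> with \<open>s > 0\<close>. It is
  stated through the coefficients since \<open>infsum\<close> is 0 for divergent series.\<close>

definition multiplier_dom :: "real ^ 'n::finite \<Rightarrow> (real \<Rightarrow> complex) \<Rightarrow> (real \<Rightarrow> complex) set" where
  "multiplier_dom \<omega> m = {u. \<exists>s>0.
     (\<lambda>n. norm (m (\<omega> \<bullet> lattice_vec n) * fourier_coeff \<omega> u n) * exp (s * norm (lattice_vec n)))
       summable_on UNIV}"

text \<open>At \<open>t = -T\<close> and \<open>t = T\<close> the time derivative is one-sided. The derivative in \<open>x\<close> always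
  exists, because elements of \<open>V_space \<omega> s\<close> with \<open>s > 0\<close> are smooth.\<close>

definition classical_solution ::
    "real ^ 'n::finite \<Rightarrow> (real \<Rightarrow> complex) \<Rightarrow> nat \<Rightarrow> real \<Rightarrow> real \<Rightarrow>
     (real \<Rightarrow> real \<Rightarrow> complex) \<Rightarrow> bool" where
  "classical_solution \<omega> m p \<kappa> T u \<longleftrightarrow>
     u \<in> C_space \<omega> \<kappa> T \<and>
     (\<forall>t\<in>{-T..T}. u t \<in> multiplier_dom \<omega> m) \<and>
     (\<exists>u\<^sub>t. \<forall>x.
        continuous_on {-T..T} (\<lambda>t. u\<^sub>t t x) \<and>
        (\<forall>t\<in>{-T..T}.
           ((\<lambda>r. u r x) has_vector_derivative u\<^sub>t t x) (at t within {-T..T}) \<and>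
           u\<^sub>t t x + multiplier \<omega> m (u t) x
             + vector_derivative (\<lambda>y. u t y ^ (p + 1)) (at x) = 0))"

definition data_to_solution ::
    "real ^ 'n::finite \<Rightarrow> (real \<Rightarrow> complex) \<Rightarrow> nat \<Rightarrow> real \<Rightarrow> real \<Rightarrow>
     (real \<Rightarrow> complex) \<Rightarrow> (real \<Rightarrow> real \<Rightarrow> complex)" where
  "data_to_solution \<omega> m p \<kappa> T v = (THE u. classical_solution \<omega> m p \<kappa> T u \<and> u 0 = v)"

end

theory Submission
  imports Defs
begin

text \<open>On the level of the coefficients \<open>c\<^sub>n(t)\<close> the equation is
  \<open>c\<^sub>n' = \<mu>\<^sub>n c\<^sub>n + \<rho>\<^sub>n (c \<star> \<dots> \<star> c)\<^sub>n\<close> with \<open>\<mu>\<^sub>n\<close> imaginary and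
  \<open>\<bar>\<rho>\<^sub>n\<bar> \<le> \<bar>\<omega>\<bar> \<bar>n\<bar>\<close>. In the norm \<open>\<Sum>\<^sub>n sup\<^sub>t \<bar>c\<^sub>n(t)\<bar> exp((k - \<gamma>\<bar>t\<bar>)\<bar>n\<bar>)\<close>, an algebra under
  convolution, the Duhamel integral gains a factor \<open>1/(\<gamma>\<bar>n\<bar>)\<close>, which absorbs the derivative; for large
  \<open>\<gamma>\<close> the Picard map is a contraction, and the same estimate gives Lipschitz dependence and, with \<open>k\<close>
  replaced by \<open>\<kappa>/2\<close> and small time steps, uniqueness for the coefficient equation.

  Unconditional uniqueness also needs that an arbitrary classical solution satisfies the coefficient
  equation, although its multiplier term is only known to converge at each fixed time, without any
  uniformity. Let \<open>P\<close> be the closed set of times near which the coefficient equation fails. If it is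
  nonempty, Baire's theorem bounds the multiplier term uniformly on a portion of \<open>P\<close>. On the gaps of \<open>P\<close> the
  coefficient equation holds and bounds the increments of the solution by its value at the left
  endpoint of the gap, which lies in \<open>P\<close>. These bounds together propagate the equation to the whole
  portion, a contradiction.\<close>

section \<open>Dominated infinite sums and convolution\<close>

text \<open>The time derivative of a classical solution is given for each x separately, so it need
  not pass through the mean over an interval that extracts a coefficient. It does pass through a
  finite sample mean, but that misses the coefficient by \<open>e\<close> times a weighted norm, and
  for the time derivative this norm involves the multiplier term at the same time t. Integrating the
  error needs a bound uniform in t, which Baire gives only on a portion of \<open>P\<close>. Inside
  a gap the multiplier term is therefore never estimated: the integrating factor has modulus 1 and
  \<open>|exp (\<tau> \<mu>_n) - 1| \<le> \<tau> |\<mu>_n|\<close>, so the increment over a gap of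
  length \<tau> costs \<tau> times the multiplier term at the left endpoint, plus the forcing. On
  \<open>P\<close> and across gaps alike the error is then \<open>e\<close> times a constant times
  the elapsed time, and \<open>e\<close> can be sent to 0. An imaginary \<mu> thus serves twice: the
  linear flow preserves every weighted norm, so fast growth of the symbol is harmless for existence,
  and it makes the gap estimate depend on one endpoint only.\<close>

no_notation Infinite_Set_Sum.abs_summable_on (infix "abs'_summable'_on" 50)

text \<open>Tannery's theorem for unordered sums along an arbitrary filter: the majorant makes the
  finite partial sums converge uniformly, and a uniform limit may be interchanged with the limit
  along \<open>F\<close>.\<close>

lemma tendsto_infsum_dominated:
  fixes f :: "'a \<Rightarrow> 'b \<Rightarrow> 'c::banach"
  assumes lim: "\<And>n. n \<in> A \<Longrightarrow> ((\<lambda>x. f n x) \<longlongrightarrow> l n) F"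
    and bound: "\<forall>\<^sub>F x in F. \<forall>n\<in>A. norm (f n x) \<le> M n"
    and M: "M summable_on A"
  shows "((\<lambda>x. \<Sum>\<^sub>\<infinity>n\<in>A. f n x) \<longlongrightarrow> (\<Sum>\<^sub>\<infinity>n\<in>A. l n)) F"
proof (cases "F = bot")
  case False
  define Y where "Y = {x. \<forall>n\<in>A. norm (f n x) \<le> M n}"
  have "norm (l n) \<le> M n" if "n \<in> A" for n
  proof (rule tendsto_upperbound[OF tendsto_norm[OF lim[OF that]] _ False])
    show "\<forall>\<^sub>F x in F. norm (f n x) \<le> M n"
      using bound by eventually_elim (use that in auto)
  qed
  then have "l summable_on A"
    by (rule abs_summable_summable[OF Infinite_Sum.abs_summable_on_comparison_test'[OF M]])
  then have 1: "((\<lambda>X. \<Sum>n\<in>X. l n) \<longlongrightarrow> (\<Sum>\<^sub>\<infinity>n\<in>A. l n)) (finite_subsets_at_top A)"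
    unfolding has_sum_def[symmetric] by (rule has_sum_infsum)
  have 2: "uniform_limit Y (\<lambda>X y. \<Sum>x\<in>X. f x y) (\<lambda>y. \<Sum>\<^sub>\<infinity>x\<in>A. f x y) (finite_subsets_at_top A)"
    by (rule Weierstrass_m_test_general[OF _ M]) (auto simp: Y_def)
  have 3: "\<forall>\<^sub>F X in finite_subsets_at_top A. ((\<lambda>x. \<Sum>n\<in>X. f n x) \<longlongrightarrow> (\<Sum>n\<in>X. l n)) F"
    by (rule eventually_finite_subsets_at_top_weakI) (auto intro!: tendsto_sum lim)
  have 4: "\<forall>\<^sub>F x in F. x \<in> Y"
    using bound by (simp add: Y_def)
  show ?thesis
    by (rule swap_uniform_limit'[OF 3 1 2 4]) simp
qed simp

lemma continuous_on_infsum_dominated: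
  fixes f :: "'a \<Rightarrow> 'b::topological_space \<Rightarrow> 'c::banach"
  assumes "\<And>n. n \<in> A \<Longrightarrow> continuous_on S (f n)"
    and "\<And>x n. x \<in> S \<Longrightarrow> n \<in> A \<Longrightarrow> norm (f n x) \<le> M n" and "M summable_on A"
  shows "continuous_on S (\<lambda>x. \<Sum>\<^sub>\<infinity>n\<in>A. f n x)"
  unfolding continuous_on_def
proof
  fix x assume x: "x \<in> S"
  show "((\<lambda>x. \<Sum>\<^sub>\<infinity>n\<in>A. f n x) \<longlongrightarrow> (\<Sum>\<^sub>\<infinity>n\<in>A. f n x)) (at x within S)"
  proof (rule tendsto_infsum_dominated[OF _ _ assms(3)])
    show "(f n \<longlongrightarrow> f n x) (at x within S)" if "n \<in> A" for n
      using assms(1)[OF that] x by (simp add: continuous_on_def)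
    show "\<forall>\<^sub>F y in at x within S. \<forall>n\<in>A. norm (f n y) \<le> M n"
      using assms(2) by (simp add: eventually_at_filter)
  qed
qed

lemma has_vector_derivative_iff_quotient:
  "(f has_vector_derivative D) (at t within S) \<longleftrightarrow>
    ((\<lambda>s. (f s - f t) /\<^sub>R (s - t)) \<longlongrightarrow> D) (at t within S)"
proof -
  have eq: "norm ((1 / norm (s - t)) *\<^sub>R (f s - (f t + (s - t) *\<^sub>R D))) = norm ((f s - f t) /\<^sub>R (s - t) - D)"
    if "s \<noteq> t" for s
  proof -
    have "(f s - f t) /\<^sub>R (s - t) - D = (f s - (f t + (s - t) *\<^sub>R D)) /\<^sub>R (s - t)"
      using that by (simp add: scaleR_diff_right scaleR_add_right diff_diff_eq[symmetric])
    then show ?thesis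
      by (simp add: divide_simps)
  qed
  have "(f has_vector_derivative D) (at t within S) \<longleftrightarrow>
     ((\<lambda>s. norm ((1 / norm (s - t)) *\<^sub>R (f s - (f t + (s - t) *\<^sub>R D)))) \<longlongrightarrow> 0) (at t within S)"
    unfolding has_vector_derivative_def has_derivative_within tendsto_norm_zero_iff
    by (simp add: bounded_linear_scaleR_left)
  also have "\<dots> \<longleftrightarrow> ((\<lambda>s. norm ((f s - f t) /\<^sub>R (s - t) - D)) \<longlongrightarrow> 0) (at t within S)"
    by (rule tendsto_cong) (use eq in \<open>auto simp: eventually_at_filter\<close>)
  also have "\<dots> \<longleftrightarrow> ((\<lambda>s. (f s - f t) /\<^sub>R (s - t)) \<longlongrightarrow> D) (at t within S)"
    unfolding tendsto_norm_zero_iff by (rule LIM_zero_iff)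
  finally show ?thesis .
qed

lemma infsum_diff:
  fixes f g :: "'a \<Rightarrow> 'c::banach"
  assumes "f summable_on A" "g summable_on A"
  shows "(\<Sum>\<^sub>\<infinity>n\<in>A. f n - g n) = infsum f A - infsum g A"
  using infsum_add[OF assms(1) summable_on_uminus[THEN iffD2, OF assms(2)]]
  by (simp add: infsum_uminus)

text \<open>The mean value inequality on the convex set \<open>S\<close> bounds every difference
  quotient by \<open>M n\<close>, so the limit of the quotients is an instance of dominated
  convergence. Working within \<open>S\<close> covers one-sided derivatives at endpoints.\<close>

lemma has_vector_derivative_infsum:
  fixes f :: "'a \<Rightarrow> real \<Rightarrow> 'c::banach"
  assumes S: "convex S" "t \<in> S"
    and der: "\<And>n s. n \<in> A \<Longrightarrow> s \<in> S \<Longrightarrow> (f n has_vector_derivative f' n s) (at s within S)"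
    and bound: "\<And>n s. n \<in> A \<Longrightarrow> s \<in> S \<Longrightarrow> norm (f' n s) \<le> M n" and M: "M summable_on A"
    and sum: "\<And>s. s \<in> S \<Longrightarrow> (\<lambda>n. f n s) summable_on A"
  shows "((\<lambda>s. \<Sum>\<^sub>\<infinity>n\<in>A. f n s) has_vector_derivative (\<Sum>\<^sub>\<infinity>n\<in>A. f' n t)) (at t within S)"
proof -
  have lip: "norm (f n s - f n t) \<le> M n * norm (s - t)" if "n \<in> A" "s \<in> S" for n s
  proof (rule differentiable_bound[OF \<open>convex S\<close>, where f' = "\<lambda>s h. h *\<^sub>R f' n s"])
    show "(f n has_derivative (\<lambda>h. h *\<^sub>R f' n r)) (at r within S)" if "r \<in> S" for r
      using der[OF \<open>n \<in> A\<close> that] by (simp add: has_vector_derivative_def)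
    show "onorm (\<lambda>h. h *\<^sub>R f' n r) \<le> M n" if "r \<in> S" for r
      using bound[OF \<open>n \<in> A\<close> that]
      by (intro onorm_le) (metis abs_ge_zero mult.commute mult_left_mono norm_scaleR real_norm_def)
  qed (use that S in auto)
  have "((\<lambda>s. \<Sum>\<^sub>\<infinity>n\<in>A. (f n s - f n t) /\<^sub>R (s - t)) \<longlongrightarrow> (\<Sum>\<^sub>\<infinity>n\<in>A. f' n t)) (at t within S)"
  proof (rule tendsto_infsum_dominated[OF _ _ M])
    show "((\<lambda>s. (f n s - f n t) /\<^sub>R (s - t)) \<longlongrightarrow> f' n t) (at t within S)" if "n \<in> A" for n
      using der[OF that S(2)] by (simp add: has_vector_derivative_iff_quotient)
    show "\<forall>\<^sub>F s in at t within S. \<forall>n\<in>A. norm ((f n s - f n t) /\<^sub>R (s - t)) \<le> M n"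
      unfolding eventually_at_filter
      using lip by (auto intro!: always_eventually simp: divide_simps)
  qed
  moreover have "(\<Sum>\<^sub>\<infinity>n\<in>A. (f n s - f n t) /\<^sub>R (s - t)) =
      ((\<Sum>\<^sub>\<infinity>n\<in>A. f n s) - (\<Sum>\<^sub>\<infinity>n\<in>A. f n t)) /\<^sub>R (s - t)" if "s \<in> S" for s
    using sum[OF that] sum[OF S(2)] by (simp add: infsum_scaleR_right infsum_diff)
  ultimately show ?thesis
    unfolding has_vector_derivative_iff_quotient
    by (elim Lim_transform_eventually) (auto simp: eventually_at_filter intro: always_eventually)
qed

section \<open>Convolution of absolutely summable families, complex coefficients and real majorants
  alike\<close>

definition conv :: "('g::ab_group_add \<Rightarrow> 'a) \<Rightarrow> ('g \<Rightarrow> 'a) \<Rightarrow> 'g \<Rightarrow> 'a::{banach,real_normed_field}" where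
  "conv a b n = (\<Sum>\<^sub>\<infinity>m. a m * b (n - m))"

lemma abs_summable_on_product_mult:
  fixes a b :: "'g \<Rightarrow> 'a::{banach,real_normed_field}"
  assumes "a abs_summable_on UNIV" "b abs_summable_on UNIV"
  shows "(\<lambda>(m, l). a m * b l) abs_summable_on UNIV \<times> UNIV"
proof (subst Infinite_Sum.abs_summable_on_Sigma_iff, intro conjI ballI)
  show "(\<lambda>l. case (m, l) of (m, l) \<Rightarrow> a m * b l) abs_summable_on UNIV" for m
    using summable_on_cmult_right[OF assms(2), of "norm (a m)"] by (simp add: norm_mult)
  show "(\<lambda>m. \<Sum>\<^sub>\<infinity>l. norm (case (m, l) of (m, l) \<Rightarrow> a m * b l)) abs_summable_on UNIV"
    using summable_on_cmult_left[OF assms(1), of "\<Sum>\<^sub>\<infinity>l. norm (b l)"]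
    by (simp add: norm_mult infsum_cmult_right' infsum_nonneg)
qed

text \<open>The change of variables behind Fubini for convolutions: it carries the double series of
  \<open>conv a b\<close> to the product series of \<open>a\<close> and \<open>b\<close>.\<close>

lemma bij_betw_shear: "bij_betw (\<lambda>(n, m). (m, n - m)) (UNIV \<times> UNIV) (UNIV \<times> (UNIV :: 'g::ab_group_add set))"
  by (rule bij_betwI[where g = "\<lambda>(m, l). (m + l, m)"]) auto

context
  fixes a b :: "'g::ab_group_add \<Rightarrow> 'a::{banach,real_normed_field}"
  assumes ab: "a abs_summable_on UNIV" "b abs_summable_on UNIV"
begin

lemma conv_pair_abs_summable: "(\<lambda>(n, m). a m * b (n - m)) abs_summable_on UNIV \<times> UNIV"
proof -
  have "(\<lambda>p. norm (case (\<lambda>(n, m). (m, n - m)) p of (m, l) \<Rightarrow> a m * b l)) summable_on UNIV \<times> UNIV"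
    by (rule iffD2[OF summable_on_reindex_bij_betw[OF bij_betw_shear] abs_summable_on_product_mult[OF ab]])
  then show ?thesis
    by (simp only: case_prod_unfold fst_conv snd_conv)
qed

lemma conv_term_abs_summable: "(\<lambda>m. a m * b (n - m)) abs_summable_on UNIV"
  using conv_pair_abs_summable by (subst (asm) Infinite_Sum.abs_summable_on_Sigma_iff) auto

lemma conv_term_summable: "(\<lambda>m. a m * b (n - m)) summable_on UNIV"
  by (rule abs_summable_summable[OF conv_term_abs_summable])

lemma norm_conv_le: "norm (conv a b n) \<le> conv (\<lambda>m. norm (a m)) (\<lambda>m. norm (b m)) n"
  using norm_infsum_bound[OF conv_term_abs_summable[of n]] by (simp add: conv_def norm_mult)

lemma conv_abs_summable: "conv a b abs_summable_on UNIV"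
proof -
  have "(\<lambda>n. \<Sum>\<^sub>\<infinity>m. norm (a m * b (n - m))) summable_on UNIV"
    using conv_pair_abs_summable
    by (subst (asm) Infinite_Sum.abs_summable_on_Sigma_iff) (auto simp: infsum_nonneg)
  then show ?thesis
    by (rule Infinite_Sum.abs_summable_on_comparison_test') (use norm_conv_le in \<open>simp add: conv_def norm_mult\<close>)
qed

text \<open>The exact identity serves twice: for real majorants it gives the algebra property of the
  norm, and for coefficients multiplied by characters it turns convolution into the pointwise
  product (\<open>synth_conv\<close>).\<close>

lemma infsum_conv: "infsum (conv a b) UNIV = infsum a UNIV * infsum b UNIV"
proof -
  have "infsum (conv a b) UNIV = (\<Sum>\<^sub>\<infinity>(n, m)\<in>UNIV \<times> UNIV. a m * b (n - m))"
    unfolding conv_def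
    by (rule infsum_Sigma'_banach) (use abs_summable_summable[OF conv_pair_abs_summable] in simp)
  also have "\<dots> = (\<Sum>\<^sub>\<infinity>p\<in>UNIV \<times> UNIV. (\<lambda>(m, l). a m * b l) ((\<lambda>(n, m). (m, n - m)) p))"
    by (simp only: case_prod_unfold fst_conv snd_conv)
  also have "\<dots> = (\<Sum>\<^sub>\<infinity>(m, l)\<in>UNIV \<times> UNIV. a m * b l)"
    by (rule infsum_reindex_bij_betw[OF bij_betw_shear])
  also have "\<dots> = (\<Sum>\<^sub>\<infinity>m. \<Sum>\<^sub>\<infinity>l. a m * b l)"
    by (rule infsum_Sigma'_banach[symmetric]) (use abs_summable_summable[OF abs_summable_on_product_mult[OF ab]] in simp)
  also have "\<dots> = infsum a UNIV * infsum b UNIV"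
    by (simp add: infsum_cmult_right' infsum_cmult_left')
  finally show ?thesis .
qed

end

primrec cpow :: "('g::ab_group_add \<Rightarrow> 'a) \<Rightarrow> nat \<Rightarrow> 'g \<Rightarrow> 'a::{banach,real_normed_field}" where
  "cpow a 0 = (\<lambda>n. if n = 0 then 1 else 0)"
| "cpow a (Suc q) = conv a (cpow a q)"

section \<open>The sum-of-suprema norm on coefficient families\<close>

abbreviation lnorm :: "int ^ 'n::finite \<Rightarrow> real" where
  "lnorm n \<equiv> norm (lattice_vec n)"

lemma lattice_vec_add: "lattice_vec (m + n) = lattice_vec m + lattice_vec n"
  and lattice_vec_diff: "lattice_vec (m - n) = lattice_vec m - lattice_vec n"
  and lattice_vec_uminus: "lattice_vec (- n) = - lattice_vec n"
  and lattice_vec_0 [simp]: "lattice_vec 0 = 0"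
  by (simp_all add: lattice_vec_def vec_eq_iff)

lemma lnorm_triangle: "lnorm n \<le> lnorm m + lnorm (n - m)"
  using norm_triangle_ineq[of "lattice_vec m" "lattice_vec (n - m)"] by (simp add: lattice_vec_diff)

text \<open>Each coordinate is at most \<open>lnorm n\<close> in modulus, so the exponential is
  dominated by a product over the coordinates of one-dimensional terms with rate
  \<open>b = s / CARD('n)\<close>. Sums over a finite box factor into geometric sums.\<close>

lemma lattice_exp_summable:
  assumes "0 < s"
  shows "(\<lambda>n :: int ^ 'n::finite. exp (- s * lnorm n)) summable_on UNIV"
proof -
  define b where "b = s / real CARD('n)"
  have b: "0 < b"
    using assms by (simp add: b_def)
  define g where "g = (\<lambda>j :: int. exp (- b * \<bar>real_of_int j\<bar>))"
  have geo: "(\<lambda>n. exp (- b) ^ n) summable_on (UNIV :: nat set)"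
    using b by (intro summable_nonneg_imp_summable_on summable_geometric) auto
  have "g summable_on (range int \<union> range (\<lambda>n. - int n))"
  proof (rule summable_on_union)
    show "g summable_on range int"
      using geo by (subst summable_on_reindex) (auto simp: o_def g_def exp_of_nat_mult[symmetric] mult.commute)
    show "g summable_on range (\<lambda>n. - int n)"
      using geo by (subst summable_on_reindex) (auto simp: o_def g_def exp_of_nat_mult[symmetric] mult.commute inj_def)
  qed
  moreover have "j \<in> range int \<union> range (\<lambda>n. - int n)" for j
    by (cases j rule: int_cases2) auto
  then have "range int \<union> range (\<lambda>n. - int n) = UNIV"
    by blast
  ultimately have g: "g summable_on UNIV"
    by simp
  have le: "exp (- s * lnorm n) \<le> (\<Prod>i\<in>UNIV. g (n $ i))" for n :: "int ^ 'n"
  proof -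
    have "(\<Sum>i\<in>UNIV. \<bar>real_of_int (n $ i)\<bar>) \<le> (\<Sum>i\<in>(UNIV :: 'n set). lnorm n)"
    proof (rule sum_mono)
      show "\<bar>real_of_int (n $ i)\<bar> \<le> lnorm n" for i
        using component_le_norm_cart[of "lattice_vec n" i] by (simp add: lattice_vec_def)
    qed
    then have "b * (\<Sum>i\<in>UNIV. \<bar>real_of_int (n $ i)\<bar>) \<le> s * lnorm n"
      using assms by (simp add: b_def divide_simps mult.commute)
    then show ?thesis
      by (simp add: g_def exp_sum[symmetric] sum_distrib_left sum_negf)
  qed
  show ?thesis
  proof (rule nonneg_bdd_above_summable_on, simp, rule bdd_aboveI2)
    fix F :: "(int ^ 'n) set" assume "F \<in> {F. F \<subseteq> UNIV \<and> finite F}"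
    then have F: "finite F" by simp
    define J where "J = (\<Union>n\<in>F. range (($) n))"
    have J: "finite J"
      using F by (simp add: J_def)
    have "(\<Sum>n\<in>F. exp (- s * lnorm n)) \<le> (\<Sum>n\<in>F. \<Prod>i\<in>UNIV. g (n $ i))"
      by (intro sum_mono le)
    also have "\<dots> = (\<Sum>f\<in>(($) ` F). \<Prod>i\<in>UNIV. g (f i))"
      by (subst sum.reindex) (auto simp: inj_on_def vec_nth_inject)
    also have "\<dots> \<le> (\<Sum>f\<in>PiE (UNIV :: 'n set) (\<lambda>_. J). \<Prod>i\<in>UNIV. g (f i))"
    proof (rule sum_mono2)
      show "finite (PiE (UNIV :: 'n set) (\<lambda>_. J))"
        using J by (intro finite_PiE) auto
    qed (auto simp: J_def g_def intro!: prod_nonneg)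
    also have "\<dots> = (\<Prod>i\<in>(UNIV :: 'n set). \<Sum>j\<in>J. g j)"
      using J by (intro prod_sum_PiE[symmetric]) auto
    also have "\<dots> \<le> (\<Prod>i\<in>(UNIV :: 'n set). \<Sum>\<^sub>\<infinity>j. g j)"
      using J g by (intro prod_mono conjI sum_nonneg finite_sum_le_infsum) (auto simp: g_def)
    finally show "(\<Sum>n\<in>F. exp (- s * lnorm n)) \<le> (\<Prod>i\<in>(UNIV :: 'n set). \<Sum>\<^sub>\<infinity>j. g j)" .
  qed
qed

lemma finite_lnorm_le: "finite {n :: int ^ 'n::finite. lnorm n \<le> R}"
proof (rule finite_imageD)
  show "inj_on (($) :: int ^ 'n \<Rightarrow> _) {n. lnorm n \<le> R}"
    by (simp add: inj_on_def vec_nth_inject)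
  have "($) ` {n :: int ^ 'n. lnorm n \<le> R} \<subseteq> PiE UNIV (\<lambda>_. {- \<lceil>R\<rceil>..\<lceil>R\<rceil>})"
  proof safe
    fix n :: "int ^ 'n" and i assume "lnorm n \<le> R"
    moreover have "\<bar>real_of_int (n $ i)\<bar> \<le> lnorm n"
      using component_le_norm_cart[of "lattice_vec n" i] by (simp add: lattice_vec_def)
    ultimately show "n $ i \<in> {- \<lceil>R\<rceil>..\<lceil>R\<rceil>}"
      by (simp add: abs_le_iff) linarith
  qed auto
  then show "finite (($) ` {n :: int ^ 'n. lnorm n \<le> R})"
    by (rule finite_subset) (simp add: finite_PiE)
qed

text \<open>The supremum over \<open>t \<in> I\<close> is taken inside the sum over the lattice: this is what makes the
  Duhamel integral gain the derivative lost in \<open>\<partial>\<^sub>x\<close> when the weight decreases linearly in time.\<close>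

definition majorized ::
    "real set \<Rightarrow> (real \<Rightarrow> real) \<Rightarrow> (real \<Rightarrow> int ^ 'n::finite \<Rightarrow> complex) \<Rightarrow> real \<Rightarrow> bool" where
  "majorized I W c B \<longleftrightarrow> (\<exists>a. (\<forall>n. 0 \<le> a n) \<and> a summable_on UNIV \<and> infsum a UNIV \<le> B \<and>
     (\<forall>t\<in>I. \<forall>n. norm (c t n) * exp (W t * lnorm n) \<le> a n))"

lemma majorizedI:
  assumes "a summable_on UNIV" "infsum a UNIV \<le> B" "\<And>n. 0 \<le> a n"
    and "\<And>t n. t \<in> I \<Longrightarrow> norm (c t n) * exp (W t * lnorm n) \<le> a n"
  shows "majorized I W c B"
  using assms unfolding majorized_def by blast

lemma majorizedE:
  assumes "majorized I W c B"
  obtains a where "a summable_on UNIV" "infsum a UNIV \<le> B" "\<And>n. 0 \<le> a n"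
    and "\<And>t n. t \<in> I \<Longrightarrow> norm (c t n) * exp (W t * lnorm n) \<le> a n"
  using assms unfolding majorized_def by blast

lemma majorized_nonneg: "majorized I W c B \<Longrightarrow> 0 \<le> B"
  unfolding majorized_def by (meson infsum_nonneg order_trans)

lemma majorized_mono: "majorized I W c B \<Longrightarrow> B \<le> B' \<Longrightarrow> majorized I W c B'"
  unfolding majorized_def by (meson order_trans)

lemma majorized_subset: "majorized I W c B \<Longrightarrow> J \<subseteq> I \<Longrightarrow> majorized J W c B"
  unfolding majorized_def by blast

lemma majorized_cong:
  "majorized I W c B \<Longrightarrow> (\<And>t n. t \<in> I \<Longrightarrow> c t n = d t n) \<Longrightarrow> majorized I W d B"
  unfolding majorized_def by metis

lemma majorized_weight_mono:
  assumes "majorized I W c B" and W: "\<And>t. t \<in> I \<Longrightarrow> W' t \<le> W t"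
  shows "majorized I W' c B"
proof -
  obtain a where a: "a summable_on UNIV" "infsum a UNIV \<le> B" "\<And>n. 0 \<le> a n"
      "\<And>t n. t \<in> I \<Longrightarrow> norm (c t n) * exp (W t * lnorm n) \<le> a n"
    using assms(1) by (rule majorizedE) blast
  have "norm (c t n) * exp (W' t * lnorm n) \<le> a n" if "t \<in> I" for t n
    using W[OF that] by (intro order_trans[OF _ a(4)[OF that]] mult_left_mono) (auto intro: mult_right_mono)
  with a show ?thesis
    by (intro majorizedI[of a])
qed

lemma majorized_add:
  assumes "majorized I W c B" "majorized I W d D"
  shows "majorized I W (\<lambda>t n. c t n + d t n) (B + D)"
proof -
  obtain a where a: "a summable_on UNIV" "infsum a UNIV \<le> B" "\<And>n. 0 \<le> a n"
      "\<And>t n. t \<in> I \<Longrightarrow> norm (c t n) * exp (W t * lnorm n) \<le> a n"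
    using assms(1) by (rule majorizedE) blast
  obtain b where b: "b summable_on UNIV" "infsum b UNIV \<le> D" "\<And>n. 0 \<le> b n"
      "\<And>t n. t \<in> I \<Longrightarrow> norm (d t n) * exp (W t * lnorm n) \<le> b n"
    using assms(2) by (rule majorizedE) blast
  have "norm (c t n + d t n) * exp (W t * lnorm n) \<le> a n + b n" if "t \<in> I" for t n
  proof -
    have "norm (c t n + d t n) * exp (W t * lnorm n) \<le> (norm (c t n) + norm (d t n)) * exp (W t * lnorm n)"
      by (intro mult_right_mono norm_triangle_ineq) auto
    then show ?thesis
      using a(4)[OF that, of n] b(4)[OF that, of n] by (simp add: distrib_right)
  qed
  with a b show ?thesis
    by (intro majorizedI[of "\<lambda>n. a n + b n"]) (auto simp: infsum_add intro: summable_on_add)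
qed

lemma majorized_mult:
  assumes "majorized I W c B" and "\<And>t n. t \<in> I \<Longrightarrow> norm (d t n) \<le> C * norm (c t n)" and "0 \<le> C"
  shows "majorized I W d (C * B)"
proof -
  obtain a where a: "a summable_on UNIV" "infsum a UNIV \<le> B" "\<And>n. 0 \<le> a n"
      "\<And>t n. t \<in> I \<Longrightarrow> norm (c t n) * exp (W t * lnorm n) \<le> a n"
    using assms(1) by (rule majorizedE) blast
  have "norm (d t n) * exp (W t * lnorm n) \<le> C * a n" if "t \<in> I" for t n
  proof -
    have "norm (d t n) * exp (W t * lnorm n) \<le> C * norm (c t n) * exp (W t * lnorm n)"
      by (intro mult_right_mono assms(2) that) auto
    also have "\<dots> \<le> C * a n"
      using mult_left_mono[OF a(4)[OF that] \<open>0 \<le> C\<close>] by (simp add: mult.assoc)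
    finally show ?thesis .
  qed
  with a \<open>0 \<le> C\<close> show ?thesis
    by (intro majorizedI[of "\<lambda>n. C * a n"])
      (auto simp: infsum_cmult_right' mult_left_mono intro: summable_on_cmult_right)
qed

lemma majorized_diff:
  assumes "majorized I W c B" "majorized I W d D"
  shows "majorized I W (\<lambda>t n. c t n - d t n) (B + D)"
  using majorized_add[OF assms(1) majorized_mult[OF assms(2), of "\<lambda>t n. - d t n" 1]] by simp

lemma majorized_norm_le:
  assumes "majorized I W c B" "t \<in> I"
  shows "norm (c t n) * exp (W t * lnorm n) \<le> B"
proof -
  obtain a where a: "a summable_on UNIV" "infsum a UNIV \<le> B" "\<And>n. 0 \<le> a n"
      "\<And>t n. t \<in> I \<Longrightarrow> norm (c t n) * exp (W t * lnorm n) \<le> a n"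
    using assms(1) by (rule majorizedE) blast
  have "sum a {n} \<le> infsum a UNIV"
    by (rule finite_sum_le_infsum) (use a in auto)
  then show ?thesis
    using a(2) a(4)[OF assms(2), of n] by simp
qed

lemma majorized_weighted_summable:
  assumes "majorized I W c B" "t \<in> I"
  shows "(\<lambda>n. norm (c t n) * exp (W t * lnorm n)) summable_on UNIV"
    and "(\<Sum>\<^sub>\<infinity>n. norm (c t n) * exp (W t * lnorm n)) \<le> B"
proof -
  obtain a where a: "a summable_on UNIV" "infsum a UNIV \<le> B" "\<And>n. 0 \<le> a n"
      "\<And>t n. t \<in> I \<Longrightarrow> norm (c t n) * exp (W t * lnorm n) \<le> a n"
    using assms(1) by (rule majorizedE) blast
  show *: "(\<lambda>n. norm (c t n) * exp (W t * lnorm n)) summable_on UNIV"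
    by (rule summable_on_comparison_test[OF a(1)]) (use a(4) assms(2) in auto)
  show "(\<Sum>\<^sub>\<infinity>n. norm (c t n) * exp (W t * lnorm n)) \<le> B"
    using infsum_mono[OF * a(1)] a(2) a(4)[OF assms(2)] by fastforce
qed

lemma norm_le_weighted: "0 \<le> w \<Longrightarrow> norm z \<le> norm z * exp (w * lnorm n)"
  by (simp add: mult_le_cancel_left1)

lemma majorized_norm_bound:
  assumes "majorized I W c B" and W: "\<And>t. t \<in> I \<Longrightarrow> 0 \<le> W t"
  shows "\<exists>a. a summable_on UNIV \<and> infsum a UNIV \<le> B \<and> (\<forall>n. 0 \<le> a n) \<and> (\<forall>t\<in>I. \<forall>n. norm (c t n) \<le> a n)"
proof -
  obtain a where a: "a summable_on UNIV" "infsum a UNIV \<le> B" "\<And>n. 0 \<le> a n"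
      "\<And>t n. t \<in> I \<Longrightarrow> norm (c t n) * exp (W t * lnorm n) \<le> a n"
    using assms(1) by (rule majorizedE) blast
  have "norm (c t n) \<le> a n" if "t \<in> I" for t n
    using norm_le_weighted[OF W[OF that]] a(4)[OF that] by (rule order_trans)
  with a show ?thesis by blast
qed

lemma majorized_abs_summable:
  assumes "majorized I W c B" "t \<in> I" "0 \<le> W t"
  shows "(\<lambda>n. norm (c t n)) summable_on UNIV"
  by (rule summable_on_comparison_test[OF majorized_weighted_summable(1)[OF assms(1,2)]])
    (auto intro: norm_le_weighted assms(3))

text \<open>For a nonnegative weight the triangle inequality makes
  \<open>exp (W t * lnorm n)\<close> submultiplicative along \<open>n = m + (n - m)\<close>. Hence
  the convolution of the two time-independent majorants works for all times at once.\<close>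

lemma majorized_conv:
  assumes c: "majorized I W c B" and d: "majorized I W d D" and W: "\<And>t. t \<in> I \<Longrightarrow> 0 \<le> W t"
  shows "majorized I W (\<lambda>t. conv (c t) (d t)) (B * D)"
proof -
  obtain a where a: "a summable_on UNIV" "infsum a UNIV \<le> B" "\<And>n. 0 \<le> a n"
      "\<And>t n. t \<in> I \<Longrightarrow> norm (c t n) * exp (W t * lnorm n) \<le> a n"
    using c by (rule majorizedE) blast
  obtain b where b: "b summable_on UNIV" "infsum b UNIV \<le> D" "\<And>n. 0 \<le> b n"
      "\<And>t n. t \<in> I \<Longrightarrow> norm (d t n) * exp (W t * lnorm n) \<le> b n"
    using d by (rule majorizedE) blast
  have ab: "(\<lambda>n. norm (a n)) summable_on UNIV" "(\<lambda>n. norm (b n)) summable_on UNIV"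
    using a b by simp_all
  note conv_ab = conv_abs_summable[OF ab]
  have nonneg: "0 \<le> conv a b n" for n
    unfolding conv_def by (intro infsum_nonneg mult_nonneg_nonneg a b)
  have le: "norm (conv (c t) (d t) n) * exp (W t * lnorm n) \<le> conv a b n" if t: "t \<in> I" for t n
  proof -
    have cd: "(\<lambda>n. norm (c t n)) summable_on UNIV" "(\<lambda>n. norm (d t n)) summable_on UNIV"
      using majorized_abs_summable[OF c t W[OF t]] majorized_abs_summable[OF d t W[OF t]] by auto
    have "norm (conv (c t) (d t) n) * exp (W t * lnorm n) \<le>
        (\<Sum>\<^sub>\<infinity>m. norm (c t m) * norm (d t (n - m))) * exp (W t * lnorm n)"
      using norm_conv_le[OF cd, of n] by (simp add: conv_def)
    also have "\<dots> = (\<Sum>\<^sub>\<infinity>m. norm (c t m) * norm (d t (n - m)) * exp (W t * lnorm n))"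
      by (simp add: infsum_cmult_left')
    also have "\<dots> \<le> (\<Sum>\<^sub>\<infinity>m. a m * b (n - m))"
    proof (rule infsum_mono)
      show "(\<lambda>m. norm (c t m) * norm (d t (n - m)) * exp (W t * lnorm n)) summable_on UNIV"
        using conv_term_summable[of "\<lambda>n. norm (c t n)" "\<lambda>n. norm (d t n)" n] cd
        by (intro summable_on_cmult_left) simp
      show "(\<lambda>m. a m * b (n - m)) summable_on UNIV"
        by (rule conv_term_summable[OF ab])
      fix m
      have "W t * lnorm n \<le> W t * lnorm m + W t * lnorm (n - m)"
        using mult_left_mono[OF lnorm_triangle[of n m] W[OF t]] by (simp add: distrib_left)
      then have "norm (c t m) * norm (d t (n - m)) * exp (W t * lnorm n) \<le>
          norm (c t m) * norm (d t (n - m)) * (exp (W t * lnorm m) * exp (W t * lnorm (n - m)))"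
        by (intro mult_left_mono) (auto simp: exp_add[symmetric])
      also have "\<dots> = (norm (c t m) * exp (W t * lnorm m)) * (norm (d t (n - m)) * exp (W t * lnorm (n - m)))"
        by (simp add: mult_ac)
      also have "\<dots> \<le> a m * b (n - m)"
        by (intro mult_mono a b t) (auto intro: a)
      finally show "norm (c t m) * norm (d t (n - m)) * exp (W t * lnorm n) \<le> a m * b (n - m)" .
    qed
    finally show ?thesis
      by (simp add: conv_def)
  qed
  have "infsum (conv a b) UNIV \<le> B * D"
    unfolding infsum_conv[OF ab]
    using a b majorized_nonneg[OF c] by (intro mult_mono) (auto intro: infsum_nonneg)
  then show ?thesis
    using abs_summable_summable[OF conv_ab] nonneg le by (intro majorizedI[of "conv a b"])
qed

lemma majorized_delta:
  "majorized I W (\<lambda>t n. if n = 0 then 1 else 0) 1"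
proof -
  have "((\<lambda>n. if n = 0 then 1 else 0 :: real) has_sum 1) UNIV"
    by (rule has_sum_finite_neutralI[of "{0}"]) auto
  then show ?thesis
    by (intro majorizedI[of "\<lambda>n. if n = 0 then 1 else 0"]) (auto simp: has_sum_iff)
qed

lemma majorized_cpow:
  assumes "majorized I W c B" and "\<And>t. t \<in> I \<Longrightarrow> 0 \<le> W t"
  shows "majorized I W (\<lambda>t. cpow (c t) q) (B ^ q)"
proof (induction q)
  case 0
  show ?case
    using majorized_delta by simp
next
  case (Suc q)
  show ?case
    using majorized_conv[OF assms(1) Suc assms(2)] by simp
qed

section \<open>Differences of convolution powers and continuity in time\<close>

lemma conv_diff_right:
  fixes a b b' :: "'g::ab_group_add \<Rightarrow> 'a::{banach,real_normed_field}"
  assumes "(\<lambda>n. norm (a n)) summable_on UNIV" "(\<lambda>n. norm (b n)) summable_on UNIV"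
    "(\<lambda>n. norm (b' n)) summable_on UNIV"
  shows "conv a (\<lambda>n. b n - b' n) n = conv a b n - conv a b' n"
  using conv_term_summable[OF assms(1,2), of n] conv_term_summable[OF assms(1,3), of n]
  by (simp add: conv_def infsum_diff right_diff_distrib)

lemma conv_diff_left:
  fixes a a' b :: "'g::ab_group_add \<Rightarrow> 'a::{banach,real_normed_field}"
  assumes "(\<lambda>n. norm (a n)) summable_on UNIV" "(\<lambda>n. norm (a' n)) summable_on UNIV"
    "(\<lambda>n. norm (b n)) summable_on UNIV"
  shows "conv (\<lambda>n. a n - a' n) b n = conv a b n - conv a' b n"
  using conv_term_summable[OF assms(1,3), of n] conv_term_summable[OF assms(2,3), of n]
  by (simp add: conv_def infsum_diff left_diff_distrib)

text \<open>Induction on the splitting \<open>c * C - d * D = c * (C - D) + (c - d) * D\<close> of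
  convolution products; the constant is the derivative of the power \<open>Suc q\<close> at
  \<open>B\<close>.\<close>

lemma majorized_cpow_diff:
  assumes c: "majorized I W c B" and d: "majorized I W d B"
    and cd: "majorized I W (\<lambda>t n. c t n - d t n) D"
    and W: "\<And>t. t \<in> I \<Longrightarrow> 0 \<le> W t"
  shows "majorized I W (\<lambda>t n. cpow (c t) (Suc q) n - cpow (d t) (Suc q) n) (real (Suc q) * B ^ q * D)"
proof (induction q)
  case 0
  have *: "conv a (\<lambda>n. if n = 0 then 1 else 0) n = a n" for a :: "int ^ 'n \<Rightarrow> complex" and n
  proof -
    have "((\<lambda>m. a m * (if n - m = 0 then 1 else 0)) has_sum a n) UNIV"
      by (rule has_sum_finite_neutralI[of "{n}"]) auto
    then show ?thesis
      by (simp add: conv_def has_sum_iff)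
  qed
  show ?case
    using cd by (simp add: *)
next
  case (Suc q)
  have 1: "majorized I W (\<lambda>t. conv (c t) (\<lambda>n. cpow (c t) (Suc q) n - cpow (d t) (Suc q) n)) (B * (real (Suc q) * B ^ q * D))"
    by (rule majorized_conv[OF c Suc W])
  have 2: "majorized I W (\<lambda>t. conv (\<lambda>n. c t n - d t n) (cpow (d t) (Suc q))) (D * B ^ Suc q)"
    by (rule majorized_conv[OF cd majorized_cpow[OF d W] W])
  have eq: "conv (c t) (\<lambda>n. cpow (c t) (Suc q) n - cpow (d t) (Suc q) n) n +
      conv (\<lambda>n. c t n - d t n) (cpow (d t) (Suc q)) n =
      cpow (c t) (Suc (Suc q)) n - cpow (d t) (Suc (Suc q)) n" if t: "t \<in> I" for t n
  proof -
    have s: "(\<lambda>n. norm (c t n)) summable_on UNIV" "(\<lambda>n. norm (d t n)) summable_on UNIV"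
      "(\<lambda>n. norm (cpow (c t) (Suc q) n)) summable_on UNIV" "(\<lambda>n. norm (cpow (d t) (Suc q) n)) summable_on UNIV"
      using majorized_abs_summable[OF c t W[OF t]] majorized_abs_summable[OF d t W[OF t]]
        majorized_abs_summable[OF majorized_cpow[OF c W] t W[OF t]]
        majorized_abs_summable[OF majorized_cpow[OF d W] t W[OF t]] by blast+
    show ?thesis
      unfolding conv_diff_right[OF s(1,3,4)] conv_diff_left[OF s(1,2,4)] by simp
  qed
  show ?case
  proof (rule majorized_cong[OF majorized_mono[OF majorized_add[OF 1 2]]])
    show "B * (real (Suc q) * B ^ q * D) + D * B ^ Suc q \<le> real (Suc (Suc q)) * B ^ Suc q * D"
      by (simp add: algebra_simps)
  qed (rule eq)
qed

lemma continuous_on_conv: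
  assumes c: "majorized I W c B" "\<And>n. continuous_on I (\<lambda>t. c t n)"
    and d: "majorized I W d D" "\<And>n. continuous_on I (\<lambda>t. d t n)"
    and W: "\<And>t. t \<in> I \<Longrightarrow> 0 \<le> W t"
  shows "continuous_on I (\<lambda>t. conv (c t) (d t) n)"
proof -
  obtain a where a: "a summable_on UNIV" "infsum a UNIV \<le> B" "\<And>n. 0 \<le> a n"
      "\<And>t n. t \<in> I \<Longrightarrow> norm (c t n) \<le> a n"
    using majorized_norm_bound[OF c(1) W] by metis
  have D: "norm (d t n) \<le> D" if "t \<in> I" for t n
    using norm_le_weighted[OF W[OF that]] majorized_norm_le[OF d(1) that] by (rule order_trans)
  show ?thesis
    unfolding conv_def
  proof (rule continuous_on_infsum_dominated)
    show "(\<lambda>m. a m * D) summable_on UNIV"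
      by (rule summable_on_cmult_left[OF a(1)])
    show "norm (c t m * d t (n - m)) \<le> a m * D" if "t \<in> I" for t m
      unfolding norm_mult by (intro mult_mono a D that) auto
  qed (intro continuous_intros c d)
qed

lemma continuous_on_cpow:
  assumes "majorized I W c B" "\<And>n. continuous_on I (\<lambda>t. c t n)" "\<And>t. t \<in> I \<Longrightarrow> 0 \<le> W t"
  shows "continuous_on I (\<lambda>t. cpow (c t) q n)"
proof (induction q arbitrary: n)
  case (Suc q)
  show ?case
    using continuous_on_conv[OF assms(1,2) majorized_cpow[OF assms(1,3)] Suc assms(3)] by simp
qed simp

section \<open>The coefficient equation\<close>

lemma has_vector_derivative_exp_scaleR:
  fixes A :: complex
  shows "((\<lambda>t. exp (t *\<^sub>R A)) has_vector_derivative A * exp (t *\<^sub>R A)) (at t within S)"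
  using exp_scaleR_has_vector_derivative_right[of A t S] by (simp add: mult.commute)

lemma norm_exp_scaleR_imaginary: "Re A = 0 \<Longrightarrow> norm (exp (t *\<^sub>R A)) = 1"
  by (simp add: norm_exp_eq_Re)

text \<open>This is where the derivative is regained: a primitive of
  \<open>q * exp (\<gamma> * q * s)\<close> is \<open>1 / \<gamma>\<close> times the same
  exponential, so the factor \<open>q\<close>, later \<open>lnorm n\<close>, is traded for
  \<open>1 / \<gamma>\<close>.\<close>

lemma exp_weight_growth_bound:
  fixes y :: "real \<Rightarrow> complex"
  assumes "0 < \<gamma>" and t: "t\<^sub>0 \<in> {a..b}" "t \<in> {a..b}"
    and der: "\<And>s. s \<in> {a..b} \<Longrightarrow> (y has_vector_derivative y' s) (at s within {a..b})"
    and bound: "\<And>s. s \<in> {a..b} \<Longrightarrow> norm (y' s) \<le> K * q * exp (\<gamma> * q * \<bar>s - t\<^sub>0\<bar>)"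
    and "0 \<le> K"
  shows "norm (y t - y t\<^sub>0) \<le> K / \<gamma> * exp (\<gamma> * q * \<bar>t - t\<^sub>0\<bar>)"
proof -
  have cont: "continuous_on {a..b} y"
    using der by (intro continuous_on_vector_derivative)
  have der': "(y has_vector_derivative y' s) (at s)" if "a < s" "s < b" for s
    using der[of s] that by (simp add: at_within_Icc_at)
  consider "t = t\<^sub>0" | "t\<^sub>0 < t" | "t < t\<^sub>0" by linarith
  then show ?thesis
  proof cases
    case 1
    then show ?thesis using assms by simp
  next
    case 2
    let ?\<phi> = "\<lambda>s. K / \<gamma> * exp (\<gamma> * q * (s - t\<^sub>0))"
    have "norm (y t - y t\<^sub>0) \<le> ?\<phi> t - ?\<phi> t\<^sub>0"
    proof (rule differentiable_bound_general[OF 2, where f' = y' and \<phi>' = "\<lambda>s. K * q * exp (\<gamma> * q * (s - t\<^sub>0))"])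
      show "continuous_on {t\<^sub>0..t} y"
        by (rule continuous_on_subset[OF cont]) (use t in auto)
      show "(?\<phi> has_vector_derivative K * q * exp (\<gamma> * q * (s - t\<^sub>0))) (at s)" for s
        unfolding has_real_derivative_iff_has_vector_derivative[symmetric]
        using \<open>0 < \<gamma>\<close> by (auto intro!: derivative_eq_intros)
      show "norm (y' s) \<le> K * q * exp (\<gamma> * q * (s - t\<^sub>0))" if "t\<^sub>0 < s" "s < t" for s
        using bound[of s] that t by auto
    qed (use der' t \<open>0 < \<gamma>\<close> in \<open>auto intro!: continuous_intros\<close>)
    also have "\<dots> \<le> K / \<gamma> * exp (\<gamma> * q * \<bar>t - t\<^sub>0\<bar>)"
      using 2 assms by simp
    finally show ?thesis .
  next
    case 3
    \<comment> \<open>To the left of \<open>t\<^sub>0\<close> the bound on the derivative decreases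
      in s, so its primitive carries a minus sign.\<close>
    let ?\<phi> = "\<lambda>s. - (K / \<gamma> * exp (\<gamma> * q * (t\<^sub>0 - s)))"
    have "norm (y t\<^sub>0 - y t) \<le> ?\<phi> t\<^sub>0 - ?\<phi> t"
    proof (rule differentiable_bound_general[OF 3, where f' = y' and \<phi>' = "\<lambda>s. K * q * exp (\<gamma> * q * (t\<^sub>0 - s))"])
      show "continuous_on {t..t\<^sub>0} y"
        by (rule continuous_on_subset[OF cont]) (use t in auto)
      show "(?\<phi> has_vector_derivative K * q * exp (\<gamma> * q * (t\<^sub>0 - s))) (at s)" for s
        unfolding has_real_derivative_iff_has_vector_derivative[symmetric]
        using \<open>0 < \<gamma>\<close> by (auto intro!: derivative_eq_intros)
      show "norm (y' s) \<le> K * q * exp (\<gamma> * q * (t\<^sub>0 - s))" if "t < s" "s < t\<^sub>0" for s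
        using bound[of s] that t by auto
    qed (use der' t \<open>0 < \<gamma>\<close> in \<open>auto intro!: continuous_intros\<close>)
    also have "\<dots> \<le> K / \<gamma> * exp (\<gamma> * q * \<bar>t - t\<^sub>0\<bar>)"
      using 3 assms by simp
    finally show ?thesis
      by (simp add: norm_minus_commute)
  qed
qed

text \<open>Later \<mu> is minus the symbol at the frequency of n, \<rho> is minus the symbol of the
  x-derivative, and \<Lambda> is the norm of \<omega>. The size of \<mu> is left free: with
  \<open>Re \<mu> = 0\<close> the linear flow only rotates each coefficient.\<close>

locale coefficient_ode =
  fixes \<mu> \<rho> :: "int ^ 'n::finite \<Rightarrow> complex" and \<Lambda> :: real and p :: nat
  assumes Re_\<mu>: "Re (\<mu> n) = 0"
    and norm_\<rho>: "norm (\<rho> n) \<le> \<Lambda> * lnorm n"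
    and \<Lambda>_pos: "0 < \<Lambda>"
begin

definition solves :: "real set \<Rightarrow> (real \<Rightarrow> int ^ 'n \<Rightarrow> complex) \<Rightarrow> bool" where
  "solves I c \<longleftrightarrow> (\<forall>t\<in>I. \<forall>n. ((\<lambda>s. c s n) has_vector_derivative
     \<mu> n * c t n + \<rho> n * cpow (c t) (Suc p) n) (at t within I))"

lemma solves_subset: "solves I c \<Longrightarrow> J \<subseteq> I \<Longrightarrow> solves J c"
  unfolding solves_def by (meson has_vector_derivative_within_subset subsetD)

text \<open>Duhamel's estimate in differential form. The factor \<open>lnorm n\<close> coming from
  \<rho> is absorbed by \<open>exp_weight_growth_bound\<close> with \<open>q = lnorm n\<close>,
  because the weight shrinks at speed \<gamma> on both sides of \<open>t\<^sub>0\<close>.\<close>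

lemma majorized_linear_ode:
  assumes "0 < \<gamma>" and t0: "t\<^sub>0 \<in> {a..b}"
    and ode: "\<And>t n. t \<in> {a..b} \<Longrightarrow>
      ((\<lambda>s. z s n) has_vector_derivative \<mu> n * z t n + \<rho> n * f t n) (at t within {a..b})"
    and init: "\<And>n. z t\<^sub>0 n = 0"
    and f: "majorized {a..b} (\<lambda>t. w - \<gamma> * \<bar>t - t\<^sub>0\<bar>) f F"
  shows "majorized {a..b} (\<lambda>t. w - \<gamma> * \<bar>t - t\<^sub>0\<bar>) z (\<Lambda> / \<gamma> * F)"
proof -
  obtain g where g: "g summable_on UNIV" "infsum g UNIV \<le> F" "\<And>n. 0 \<le> g n"
      "\<And>t n. t \<in> {a..b} \<Longrightarrow> norm (f t n) * exp ((w - \<gamma> * \<bar>t - t\<^sub>0\<bar>) * lnorm n) \<le> g n"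
    using f by (rule majorizedE) blast
  have "norm (z t n) * exp ((w - \<gamma> * \<bar>t - t\<^sub>0\<bar>) * lnorm n) \<le> \<Lambda> / \<gamma> * g n" if t: "t \<in> {a..b}" for t n
  proof -
    \<comment> \<open>The integrating factor has modulus 1, so it removes the linear term without
      changing any norm.\<close>
    define y where "y = (\<lambda>s. exp (s *\<^sub>R (- \<mu> n)) * z s n)"
    define y' where "y' = (\<lambda>s. exp (s *\<^sub>R (- \<mu> n)) * (\<rho> n * f s n))"
    \<comment> \<open>Dividing the bound \<open>g n\<close> by the weight at time s leaves
      \<open>exp (- w * lnorm n)\<close>, kept in \<open>K\<close>, and exactly the growing
      exponential of \<open>exp_weight_growth_bound\<close>.\<close>
    define K where "K = \<Lambda> * g n * exp (- w * lnorm n)"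
    have K: "0 \<le> K"
      using \<Lambda>_pos g by (simp add: K_def)
    have "norm (y t - y t\<^sub>0) \<le> K / \<gamma> * exp (\<gamma> * lnorm n * \<bar>t - t\<^sub>0\<bar>)"
    proof (rule exp_weight_growth_bound[OF \<open>0 < \<gamma>\<close> t0 t _ _ K])
      show "(y has_vector_derivative y' s) (at s within {a..b})" if "s \<in> {a..b}" for s
        using has_vector_derivative_mult[OF has_vector_derivative_exp_scaleR[of "- \<mu> n"] ode[OF that, of n]]
        by (simp add: y_def y'_def algebra_simps)
      show "norm (y' s) \<le> K * lnorm n * exp (\<gamma> * lnorm n * \<bar>s - t\<^sub>0\<bar>)" if s: "s \<in> {a..b}" for s
      proof -
        let ?E = "exp ((w - \<gamma> * \<bar>s - t\<^sub>0\<bar>) * lnorm n)"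
        have "norm (y' s) = norm (\<rho> n) * (norm (f s n) * ?E) / ?E"
          by (simp add: y'_def norm_mult norm_exp_scaleR_imaginary Re_\<mu>)
        also have "\<dots> \<le> (\<Lambda> * lnorm n) * g n / ?E"
          using g(4)[OF s, of n] \<Lambda>_pos by (intro divide_right_mono mult_mono norm_\<rho>) auto
        also have "\<dots> = K * lnorm n * exp (\<gamma> * lnorm n * \<bar>s - t\<^sub>0\<bar>)"
        proof -
          have "1 / ?E = exp (- w * lnorm n) * exp (\<gamma> * lnorm n * \<bar>s - t\<^sub>0\<bar>)"
            by (simp add: exp_add[symmetric] inverse_eq_divide[symmetric] exp_minus[symmetric] algebra_simps)
          then show ?thesis
            unfolding K_def by (simp add: divide_inverse mult_ac)
        qed
        finally show ?thesis .
      qed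
    qed
    then have "norm (z t n) \<le> K / \<gamma> * exp (\<gamma> * lnorm n * \<bar>t - t\<^sub>0\<bar>)"
      by (simp add: y_def init norm_mult norm_exp_scaleR_imaginary Re_\<mu>)
    then have "norm (z t n) * exp ((w - \<gamma> * \<bar>t - t\<^sub>0\<bar>) * lnorm n) \<le>
        K / \<gamma> * exp (\<gamma> * lnorm n * \<bar>t - t\<^sub>0\<bar>) * exp ((w - \<gamma> * \<bar>t - t\<^sub>0\<bar>) * lnorm n)"
      by (rule mult_right_mono) simp
    also have "\<dots> = \<Lambda> / \<gamma> * g n *
        (exp (- w * lnorm n) * exp (\<gamma> * lnorm n * \<bar>t - t\<^sub>0\<bar>) * exp ((w - \<gamma> * \<bar>t - t\<^sub>0\<bar>) * lnorm n))"
      by (simp add: K_def)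
    also have "\<dots> = \<Lambda> / \<gamma> * g n"
      by (simp add: exp_add[symmetric] algebra_simps)
    finally show ?thesis .
  qed
  moreover have "infsum (\<lambda>n. \<Lambda> / \<gamma> * g n) UNIV \<le> \<Lambda> / \<gamma> * F"
    unfolding infsum_cmult_right' using g(2) \<open>0 < \<gamma>\<close> \<Lambda>_pos by (intro mult_left_mono) auto
  moreover have "0 \<le> \<Lambda> / \<gamma> * g n" for n
    using g(3) \<open>0 < \<gamma>\<close> \<Lambda>_pos by simp
  ultimately show ?thesis
    by (intro majorizedI[OF summable_on_cmult_right[OF g(1)]])
qed

lemma majorized_free_evolution:
  fixes a :: "int ^ 'n \<Rightarrow> complex"
  assumes "(\<lambda>n. norm (a n) * exp (w * lnorm n)) summable_on UNIV"
    and "(\<Sum>\<^sub>\<infinity>n. norm (a n) * exp (w * lnorm n)) \<le> S"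
    and "0 \<le> \<gamma>"
  shows "majorized I (\<lambda>t. w - \<gamma> * \<bar>t - t\<^sub>0\<bar>) (\<lambda>t n. exp ((t - t\<^sub>0) *\<^sub>R \<mu> n) * a n) S"
proof (rule majorizedI[OF assms(1,2)])
  fix t and n :: "int ^ 'n"
  have "exp ((w - \<gamma> * \<bar>t - t\<^sub>0\<bar>) * lnorm n) \<le> exp (w * lnorm n)"
    using assms by (auto simp: left_diff_distrib)
  then show "norm (exp ((t - t\<^sub>0) *\<^sub>R \<mu> n) * a n) * exp ((w - \<gamma> * \<bar>t - t\<^sub>0\<bar>) * lnorm n)
      \<le> norm (a n) * exp (w * lnorm n)"
    unfolding norm_mult norm_exp_scaleR_imaginary[OF Re_\<mu>] by (simp add: mult_left_mono)
qed simp

lemma free_evolution_derivative: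
  "((\<lambda>t. exp ((t - t\<^sub>0) *\<^sub>R \<mu> n) * x) has_vector_derivative \<mu> n * (exp ((t - t\<^sub>0) *\<^sub>R \<mu> n) * x)) (at t within I)"
proof -
  have "((\<lambda>t. exp (t *\<^sub>R \<mu> n) * (exp (- (t\<^sub>0 *\<^sub>R \<mu> n)) * x)) has_vector_derivative
      \<mu> n * exp (t *\<^sub>R \<mu> n) * (exp (- (t\<^sub>0 *\<^sub>R \<mu> n)) * x)) (at t within I)"
    by (rule has_vector_derivative_mult_left[OF has_vector_derivative_exp_scaleR])
  then show ?thesis
    by (simp add: scaleR_diff_left exp_diff exp_minus divide_inverse mult_ac)
qed

text \<open>The difference solves a linear equation whose forcing is the difference of the powers,
  so by \<open>small\<close> a bound \<open>D\<close> on it improves to \<open>S + D / 2\<close>.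
  The case \<open>S = 0\<close> is uniqueness.\<close>

theorem stability:
  assumes "0 < \<gamma>" and t0: "t\<^sub>0 \<in> {a..b}"
    and c: "solves {a..b} c" "majorized {a..b} (\<lambda>t. w - \<gamma> * \<bar>t - t\<^sub>0\<bar>) c B"
    and d: "solves {a..b} d" "majorized {a..b} (\<lambda>t. w - \<gamma> * \<bar>t - t\<^sub>0\<bar>) d B"
    and W: "\<And>t. t \<in> {a..b} \<Longrightarrow> 0 \<le> w - \<gamma> * \<bar>t - t\<^sub>0\<bar>"
    and small: "\<Lambda> / \<gamma> * (real (Suc p) * B ^ p) \<le> 1 / 2"
    and init: "(\<lambda>n. norm (c t\<^sub>0 n - d t\<^sub>0 n) * exp (w * lnorm n)) summable_on UNIV"
      "(\<Sum>\<^sub>\<infinity>n. norm (c t\<^sub>0 n - d t\<^sub>0 n) * exp (w * lnorm n)) \<le> S"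
    and t: "t \<in> {a..b}"
  shows "(\<Sum>\<^sub>\<infinity>n. norm (c t n - d t n) * exp ((w - \<gamma> * \<bar>t - t\<^sub>0\<bar>) * lnorm n)) \<le> 2 * S"
proof -
  let ?W = "\<lambda>t. w - \<gamma> * \<bar>t - t\<^sub>0\<bar>"
  define e where "e = (\<lambda>t n. exp ((t - t\<^sub>0) *\<^sub>R \<mu> n) * (c t\<^sub>0 n - d t\<^sub>0 n))"
  have e: "majorized {a..b} ?W e S"
    unfolding e_def using init \<open>0 < \<gamma>\<close> by (intro majorized_free_evolution) auto
  have step: "majorized {a..b} ?W (\<lambda>t n. c t n - d t n) (S + D / 2)"
    if D: "majorized {a..b} ?W (\<lambda>t n. c t n - d t n) D" for D
  proof -
    have "majorized {a..b} ?W (\<lambda>t n. c t n - d t n - e t n) (\<Lambda> / \<gamma> * (real (Suc p) * B ^ p * D))"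
    proof (rule majorized_linear_ode[OF \<open>0 < \<gamma>\<close> t0])
      show "((\<lambda>s. c s n - d s n - e s n) has_vector_derivative
          \<mu> n * (c t n - d t n - e t n) + \<rho> n * (cpow (c t) (Suc p) n - cpow (d t) (Suc p) n)) (at t within {a..b})"
        if "t \<in> {a..b}" for t n
      proof -
        have "((\<lambda>s. c s n - d s n - e s n) has_vector_derivative
          (\<mu> n * c t n + \<rho> n * cpow (c t) (Suc p) n) - (\<mu> n * d t n + \<rho> n * cpow (d t) (Suc p) n)
            - \<mu> n * e t n) (at t within {a..b})"
          unfolding e_def using c(1) d(1) that unfolding solves_def
          by (intro has_vector_derivative_diff free_evolution_derivative) auto
        then show ?thesis
          by (simp add: algebra_simps del: cpow.simps)
      qed
      show "majorized {a..b} ?W (\<lambda>t n. cpow (c t) (Suc p) n - cpow (d t) (Suc p) n) (real (Suc p) * B ^ p * D)"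
        by (rule majorized_cpow_diff[OF c(2) d(2) D W])
    qed (simp add: e_def)
    from majorized_add[OF e this] have
      "majorized {a..b} ?W (\<lambda>t n. c t n - d t n) (S + \<Lambda> / \<gamma> * (real (Suc p) * B ^ p * D))"
      by simp
    moreover have "\<Lambda> / \<gamma> * (real (Suc p) * B ^ p * D) \<le> D / 2"
      using mult_right_mono[OF small majorized_nonneg[OF D]] by (simp add: mult.assoc)
    ultimately show ?thesis
      by (elim majorized_mono) simp
  qed
  have S: "0 \<le> S"
    using majorized_nonneg[OF e] .
  \<comment> \<open>\<open>majorized\<close> is a predicate rather than a number, so
    \<open>D / 2\<close> cannot be absorbed into the left-hand side. The improvement is iterated
    instead, starting from the crude bound \<open>B + B\<close>.\<close>
  have iter: "majorized {a..b} ?W (\<lambda>t n. c t n - d t n) (2 * S + 2 * B / 2 ^ j)" for j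
  proof (induction j)
    case 0
    show ?case
      by (rule majorized_mono[OF majorized_diff[OF c(2) d(2)]]) (use S in simp)
  next
    case (Suc j)
    show ?case
      using step[OF Suc] by (rule majorized_mono) (simp add: field_simps)
  qed
  have "(\<lambda>j. 2 * S + 2 * B / 2 ^ j) \<longlonglongrightarrow> 2 * S + 0"
    by (intro tendsto_intros LIMSEQ_divide_realpow_zero) auto
  then show ?thesis
    by (intro LIMSEQ_le_const[where x = "2 * S"]) (use majorized_weighted_summable(2)[OF iter t] in auto)
qed

end

text \<open>A Fatou argument. The majorants of the \<open>y i\<close> vary with i and need not
  converge, so the majorant of the limit is its true maximum over \<open>I\<close>, attained at
  \<open>\<tau> n\<close>. A finite sum of maxima involves finitely many times only, and there
  pointwise convergence suffices.\<close>

lemma majorized_limit: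
  fixes z :: "real \<Rightarrow> int ^ 'n::finite \<Rightarrow> complex"
  assumes I: "compact I" "I \<noteq> {}"
    and cont: "continuous_on I W" "\<And>n. continuous_on I (\<lambda>t. z t n)"
    and maj: "\<And>i :: nat. majorized I W (y i) B"
    and lim: "\<And>t n. t \<in> I \<Longrightarrow> (\<lambda>i. y i t n) \<longlonglongrightarrow> z t n"
  shows "majorized I W z B"
proof -
  have "\<exists>\<tau>\<in>I. \<forall>t\<in>I. norm (z t n) * exp (W t * lnorm n) \<le> norm (z \<tau> n) * exp (W \<tau> * lnorm n)" for n
    by (rule continuous_attains_sup[OF I]) (intro continuous_intros cont)
  then obtain \<tau> where \<tau>: "\<And>n. \<tau> n \<in> I"
    "\<And>n t. t \<in> I \<Longrightarrow> norm (z t n) * exp (W t * lnorm n) \<le> norm (z (\<tau> n) n) * exp (W (\<tau> n) * lnorm n)"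
    by metis
  let ?a = "\<lambda>n. norm (z (\<tau> n) n) * exp (W (\<tau> n) * lnorm n)"
  have sum: "sum ?a F \<le> B" if F: "finite F" for F
  proof (rule LIMSEQ_le_const2)
    show "(\<lambda>i. \<Sum>n\<in>F. norm (y i (\<tau> n) n) * exp (W (\<tau> n) * lnorm n)) \<longlonglongrightarrow> sum ?a F"
      by (intro tendsto_intros lim \<tau>)
    have "(\<Sum>n\<in>F. norm (y i (\<tau> n) n) * exp (W (\<tau> n) * lnorm n)) \<le> B" for i
    proof -
      obtain b where b: "b summable_on UNIV" "infsum b UNIV \<le> B" "\<And>n. 0 \<le> b n"
        "\<And>t n. t \<in> I \<Longrightarrow> norm (y i t n) * exp (W t * lnorm n) \<le> b n"
        using maj by (rule majorizedE) blast
      have "(\<Sum>n\<in>F. norm (y i (\<tau> n) n) * exp (W (\<tau> n) * lnorm n)) \<le> sum b F"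
        by (intro sum_mono b \<tau>)
      also have "\<dots> \<le> infsum b UNIV"
        using b F by (intro finite_sum_le_infsum) auto
      finally show ?thesis using b by simp
    qed
    then show "\<exists>N. \<forall>i\<ge>N. (\<Sum>n\<in>F. norm (y i (\<tau> n) n) * exp (W (\<tau> n) * lnorm n)) \<le> B"
      by blast
  qed
  have a: "?a summable_on UNIV"
    by (rule nonneg_bdd_above_summable_on) (use sum in \<open>auto intro!: bdd_aboveI2\<close>)
  show ?thesis
    by (rule majorizedI[of ?a]) (use a sum \<tau> in \<open>auto intro: infsum_le_finite_sums\<close>)
qed

section \<open>Picard iteration, preserving the symmetry of real-valued functions\<close>

lemma cnj_conv:
  assumes "\<And>n. c (- n) = cnj (c n)" "\<And>n. d (- n) = cnj (d n)"
  shows "conv c d (- n) = cnj (conv c d n)"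
proof -
  have "cnj (conv c d n) = (\<Sum>\<^sub>\<infinity>m. c (- m) * d (- n - - m))"
    by (simp add: conv_def infsum_cnj[symmetric] assms[symmetric] del: infsum_cnj)
  also have "\<dots> = conv c d (- n)"
    unfolding conv_def
    by (rule infsum_reindex_bij_betw[where g = uminus and f = "\<lambda>m. c m * d (- n - m)"])
      (rule bij_betwI[where g = uminus], auto)
  finally show ?thesis by simp
qed

lemma cnj_cpow: "(\<And>n. c (- n) = cnj (c n)) \<Longrightarrow> cpow c q (- n) = cnj (cpow c q n)"
  by (induction q arbitrary: n) (auto intro: cnj_conv)

context coefficient_ode
begin

definition duhamel_integrand :: "(real \<Rightarrow> int ^ 'n \<Rightarrow> complex) \<Rightarrow> int ^ 'n \<Rightarrow> real \<Rightarrow> complex" where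
  "duhamel_integrand c n s = exp (s *\<^sub>R (- \<mu> n)) * cpow (c s) (Suc p) n"

text \<open>Variation of constants. The difference of two integrals starting at \<open>a\<close> is
  the oriented integral from \<open>t\<^sub>0\<close> to \<open>t\<close>, which also covers
  \<open>t < t\<^sub>0\<close>, where the integral over \<open>{t\<^sub>0..t}\<close> would be
  0.\<close>

definition picard ::
    "real \<Rightarrow> real \<Rightarrow> (int ^ 'n \<Rightarrow> complex) \<Rightarrow> (real \<Rightarrow> int ^ 'n \<Rightarrow> complex) \<Rightarrow> real \<Rightarrow> int ^ 'n \<Rightarrow> complex" where
  "picard a t\<^sub>0 \<alpha> c t n = exp ((t - t\<^sub>0) *\<^sub>R \<mu> n) * \<alpha> n + exp (t *\<^sub>R \<mu> n) *
     (\<rho> n * (integral {a..t} (duhamel_integrand c n) - integral {a..t\<^sub>0} (duhamel_integrand c n)))"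

lemma picard_derivative:
  assumes c: "majorized {a..b} W c B" "\<And>n. continuous_on {a..b} (\<lambda>t. c t n)"
    and W: "\<And>t. t \<in> {a..b} \<Longrightarrow> 0 \<le> W t" and t: "t \<in> {a..b}"
  shows "((\<lambda>t. picard a t\<^sub>0 \<alpha> c t n) has_vector_derivative
     \<mu> n * picard a t\<^sub>0 \<alpha> c t n + \<rho> n * cpow (c t) (Suc p) n) (at t within {a..b})"
proof -
  let ?h = "duhamel_integrand c n"
  have h: "continuous_on {a..b} ?h"
    unfolding duhamel_integrand_def by (intro continuous_intros continuous_on_cpow[OF c W])
  have "((\<lambda>t. integral {a..t} ?h - integral {a..t\<^sub>0} ?h) has_vector_derivative ?h t - 0) (at t within {a..b})"
    by (intro has_vector_derivative_diff integral_has_vector_derivative[OF h t]) simp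
  then have "((\<lambda>t. \<rho> n * (integral {a..t} ?h - integral {a..t\<^sub>0} ?h)) has_vector_derivative \<rho> n * ?h t) (at t within {a..b})"
    by (intro has_vector_derivative_mult_right) simp
  from has_vector_derivative_mult[OF has_vector_derivative_exp_scaleR this, of "\<mu> n"]
    and free_evolution_derivative[of t\<^sub>0 n "\<alpha> n" t "{a..b}"]
  have "((\<lambda>t. picard a t\<^sub>0 \<alpha> c t n) has_vector_derivative
      \<mu> n * (exp ((t - t\<^sub>0) *\<^sub>R \<mu> n) * \<alpha> n) +
      (exp (t *\<^sub>R \<mu> n) * (\<rho> n * ?h t) + \<mu> n * exp (t *\<^sub>R \<mu> n) *
        (\<rho> n * (integral {a..t} ?h - integral {a..t\<^sub>0} ?h)))) (at t within {a..b})"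
    unfolding picard_def by (intro has_vector_derivative_add)
  moreover have e: "exp (t *\<^sub>R \<mu> n) * (\<rho> n * ?h t) = \<rho> n * cpow (c t) (Suc p) n"
    by (simp add: duhamel_integrand_def exp_minus del: cpow.simps)
  have "\<mu> n * (exp ((t - t\<^sub>0) *\<^sub>R \<mu> n) * \<alpha> n) + (exp (t *\<^sub>R \<mu> n) * (\<rho> n * ?h t) +
      \<mu> n * exp (t *\<^sub>R \<mu> n) * (\<rho> n * (integral {a..t} ?h - integral {a..t\<^sub>0} ?h))) =
      \<mu> n * picard a t\<^sub>0 \<alpha> c t n + \<rho> n * cpow (c t) (Suc p) n"
    unfolding e picard_def by (simp add: algebra_simps del: cpow.simps)
  ultimately show ?thesis
    by (simp only:)
qed

lemma picard_init: "picard a t\<^sub>0 \<alpha> c t\<^sub>0 n = \<alpha> n"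
  by (simp add: picard_def)

lemma cnj_picard:
  assumes "\<And>n. \<mu> (- n) = cnj (\<mu> n)" "\<And>n. \<rho> (- n) = cnj (\<rho> n)" "\<And>n. \<alpha> (- n) = cnj (\<alpha> n)"
    and c: "\<And>t n. c t (- n) = cnj (c t n)"
  shows "picard a t\<^sub>0 \<alpha> c t (- n) = cnj (picard a t\<^sub>0 \<alpha> c t n)"
proof -
  have cp: "cpow (c s) q (- n) = cnj (cpow (c s) q n)" for s q
    by (rule cnj_cpow) (rule c)
  have "duhamel_integrand c (- n) = (\<lambda>s. cnj (duhamel_integrand c n s))"
    by (rule ext) (simp add: duhamel_integrand_def assms exp_cnj cp del: cpow.simps)
  then show ?thesis
    by (simp add: picard_def assms exp_cnj integral_cnj)
qed

context
  fixes a b t\<^sub>0 w \<gamma> S :: real and \<alpha> :: "int ^ 'n \<Rightarrow> complex" and W :: "real \<Rightarrow> real"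
  defines "W \<equiv> (\<lambda>t. w - \<gamma> * \<bar>t - t\<^sub>0\<bar>)"
  assumes \<gamma>: "0 < \<gamma>" and t0: "t\<^sub>0 \<in> {a..b}"
    and W: "\<And>t. t \<in> {a..b} \<Longrightarrow> 0 \<le> W t"
    and small: "\<Lambda> / \<gamma> * (real (Suc p) * (2 * S) ^ p) \<le> 1 / 2"
    and data: "(\<lambda>n. norm (\<alpha> n) * exp (w * lnorm n)) summable_on UNIV"
      "(\<Sum>\<^sub>\<infinity>n. norm (\<alpha> n) * exp (w * lnorm n)) \<le> S"
begin

text \<open>The ball on which the Picard map contracts. Of its radius \<open>2 * S\<close>, one half
  is for the free evolution of the data and one half for the Duhamel term; continuity makes the
  Duhamel integral differentiable.\<close>

definition admissible :: "(real \<Rightarrow> int ^ 'n \<Rightarrow> complex) \<Rightarrow> bool" where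
  "admissible c \<longleftrightarrow> majorized {a..b} W c (2 * S) \<and> (\<forall>n. continuous_on {a..b} (\<lambda>t. c t n))"

lemma S_nonneg: "0 \<le> S"
  using data(2) by (rule order_trans[rotated]) (simp add: infsum_nonneg)

lemma admissible_picard:
  assumes c: "admissible c"
  shows "admissible (picard a t\<^sub>0 \<alpha> c)"
proof -
  let ?e = "\<lambda>t n. exp ((t - t\<^sub>0) *\<^sub>R \<mu> n) * \<alpha> n"
  have c': "majorized {a..b} W c (2 * S)" "\<And>n. continuous_on {a..b} (\<lambda>t. c t n)"
    using c by (auto simp: admissible_def)
  have der: "((\<lambda>t. picard a t\<^sub>0 \<alpha> c t n) has_vector_derivative
      \<mu> n * picard a t\<^sub>0 \<alpha> c t n + \<rho> n * cpow (c t) (Suc p) n) (at t within {a..b})" if "t \<in> {a..b}" for t n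
    by (rule picard_derivative[OF c' W that])
  have e: "majorized {a..b} W ?e S"
    unfolding W_def using data \<gamma> by (intro majorized_free_evolution) auto
  have "majorized {a..b} W (\<lambda>t n. picard a t\<^sub>0 \<alpha> c t n - ?e t n) (\<Lambda> / \<gamma> * (2 * S) ^ Suc p)"
    unfolding W_def
  proof (rule majorized_linear_ode[OF \<gamma> t0])
    show "majorized {a..b} (\<lambda>t. w - \<gamma> * \<bar>t - t\<^sub>0\<bar>) (\<lambda>t. cpow (c t) (Suc p)) ((2 * S) ^ Suc p)"
      using majorized_cpow[OF c'(1) W, of "Suc p"] by (simp add: W_def del: cpow.simps)
    show "((\<lambda>s. picard a t\<^sub>0 \<alpha> c s n - ?e s n) has_vector_derivative
      \<mu> n * (picard a t\<^sub>0 \<alpha> c t n - ?e t n) + \<rho> n * cpow (c t) (Suc p) n) (at t within {a..b})"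
      if "t \<in> {a..b}" for t n
      using has_vector_derivative_diff[OF der[OF that, of n] free_evolution_derivative[of t\<^sub>0 n "\<alpha> n"]]
      by (simp add: algebra_simps del: cpow.simps)
  qed (simp add: picard_init)
  from majorized_add[OF e this]
  have "majorized {a..b} W (picard a t\<^sub>0 \<alpha> c) (S + \<Lambda> / \<gamma> * (2 * S) ^ Suc p)"
    by simp
  \<comment> \<open>\<open>small\<close> is the contraction condition for differences; since
    \<open>Suc p\<close> is at least 1, it also keeps the Duhamel term within
    \<open>S\<close>.\<close>
  moreover have "\<Lambda> / \<gamma> * (2 * S) ^ Suc p \<le> S"
  proof -
    have "\<Lambda> / \<gamma> * (1 * (2 * S) ^ p) \<le> \<Lambda> / \<gamma> * (real (Suc p) * (2 * S) ^ p)"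
      using \<Lambda>_pos \<gamma> S_nonneg by (intro mult_left_mono mult_right_mono) auto
    from order_trans[OF this small] have "\<Lambda> / \<gamma> * (2 * S) ^ p \<le> 1 / 2"
      by (simp only: mult_1)
    from mult_right_mono[OF this, of "2 * S"] show ?thesis
      using S_nonneg by (simp add: mult_ac)
  qed
  ultimately have "majorized {a..b} W (picard a t\<^sub>0 \<alpha> c) (2 * S)"
    by (elim majorized_mono) simp
  moreover have "continuous_on {a..b} (\<lambda>t. picard a t\<^sub>0 \<alpha> c t n)" for n
    using der by (rule continuous_on_vector_derivative)
  ultimately show ?thesis
    by (simp add: admissible_def)
qed

text \<open>Both images start from the same data, so their difference vanishes at
  \<open>t\<^sub>0\<close> and the Duhamel estimate applies with the difference of the powers as
  forcing.\<close>

lemma picard_contraction: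
  assumes c: "admissible c" and d: "admissible d" and cd: "majorized {a..b} W (\<lambda>t n. c t n - d t n) D"
  shows "majorized {a..b} W (\<lambda>t n. picard a t\<^sub>0 \<alpha> c t n - picard a t\<^sub>0 \<alpha> d t n) (D / 2)"
proof -
  have c': "majorized {a..b} W c (2 * S)" "\<And>n. continuous_on {a..b} (\<lambda>t. c t n)"
    and d': "majorized {a..b} W d (2 * S)" "\<And>n. continuous_on {a..b} (\<lambda>t. d t n)"
    using c d by (auto simp: admissible_def)
  have "majorized {a..b} W (\<lambda>t n. picard a t\<^sub>0 \<alpha> c t n - picard a t\<^sub>0 \<alpha> d t n)
      (\<Lambda> / \<gamma> * (real (Suc p) * (2 * S) ^ p * D))"
    unfolding W_def
  proof (rule majorized_linear_ode[OF \<gamma> t0])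
    show "((\<lambda>s. picard a t\<^sub>0 \<alpha> c s n - picard a t\<^sub>0 \<alpha> d s n) has_vector_derivative
      \<mu> n * (picard a t\<^sub>0 \<alpha> c t n - picard a t\<^sub>0 \<alpha> d t n) +
      \<rho> n * (cpow (c t) (Suc p) n - cpow (d t) (Suc p) n)) (at t within {a..b})" if "t \<in> {a..b}" for t n
      using has_vector_derivative_diff[OF picard_derivative[OF c' W that] picard_derivative[OF d' W that], of t\<^sub>0 \<alpha> n t\<^sub>0 \<alpha> n]
      by (simp add: algebra_simps del: cpow.simps)
    show "majorized {a..b} (\<lambda>t. w - \<gamma> * \<bar>t - t\<^sub>0\<bar>) (\<lambda>t n. cpow (c t) (Suc p) n - cpow (d t) (Suc p) n)
       (real (Suc p) * (2 * S) ^ p * D)"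
      using majorized_cpow_diff[OF c'(1) d'(1) cd W] by (simp add: W_def)
  qed (simp add: picard_init)
  moreover have "\<Lambda> / \<gamma> * (real (Suc p) * (2 * S) ^ p * D) \<le> D / 2"
    using mult_right_mono[OF small majorized_nonneg[OF cd]] by (simp add: mult.assoc)
  ultimately show ?thesis
    by (rule majorized_mono)
qed

text \<open>The symmetry is claimed for the constructed solution itself: the iteration starts at 0,
  every iterate inherits the symmetry from the previous one, and it survives the pointwise
  limit.\<close>

theorem existence:
  "\<exists>c. solves {a..b} c \<and> c t\<^sub>0 = \<alpha> \<and> majorized {a..b} W c (2 * S) \<and>
    ((\<forall>n. \<mu> (- n) = cnj (\<mu> n) \<and> \<rho> (- n) = cnj (\<rho> n) \<and> \<alpha> (- n) = cnj (\<alpha> n)) \<longrightarrow>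
      (\<forall>t\<in>{a..b}. \<forall>n. c t (- n) = cnj (c t n)))"
proof -
  define u where "u = (\<lambda>j :: nat. (picard a t\<^sub>0 \<alpha> ^^ j) (\<lambda>_ _. 0))"
  have u_Suc: "u (Suc j) = picard a t\<^sub>0 \<alpha> (u j)" for j
    by (simp add: u_def)
  have adm: "admissible (u j)" for j
  proof (induction j)
    case 0
    show ?case
      using S_nonneg by (auto simp: admissible_def u_def intro!: majorizedI[of "\<lambda>_. 0"])
  qed (simp add: u_Suc admissible_picard)
  have step: "majorized {a..b} W (\<lambda>t n. u (Suc j) t n - u j t n) (2 * S / 2 ^ j)" for j
  proof (induction j)
    case 0
    show ?case
      using adm[of 1] by (simp add: admissible_def u_def)
  next
    case (Suc j)
    show ?case
      using picard_contraction[OF adm adm Suc] by (simp add: u_Suc mult.commute)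
  qed
  \<comment> \<open>The bound is the exact geometric sum of the steps \<open>2 * S / 2 ^ l\<close>
    for l from \<open>j\<close> to \<open>j + i - 1\<close>.\<close>
  have tail: "majorized {a..b} W (\<lambda>t n. u (j + i) t n - u j t n) (4 * S / 2 ^ j - 4 * S / 2 ^ (j + i))" for i j
  proof (induction i)
    case 0
    show ?case
      by (auto intro!: majorizedI[of "\<lambda>_. 0"])
  next
    case (Suc i)
    show ?case
    proof (rule majorized_cong[OF majorized_mono[OF majorized_add[OF step[of "j + i"] Suc]]])
      show "2 * S / 2 ^ (j + i) + (4 * S / 2 ^ j - 4 * S / 2 ^ (j + i)) \<le> 4 * S / 2 ^ j - 4 * S / 2 ^ (j + Suc i)"
        by (simp add: field_simps)
    qed simp
  qed
  have tail': "majorized {a..b} W (\<lambda>t n. u (j + i) t n - u j t n) (4 * S / 2 ^ j)" for i j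
    by (rule majorized_mono[OF tail]) (use S_nonneg in simp)
  have norm_maj: "norm (z t n) \<le> D" if "majorized {a..b} W z D" "t \<in> {a..b}" for z D t n
    using norm_le_weighted[OF W[OF that(2)]] majorized_norm_le[OF that] by (rule order_trans)
  have null: "(\<lambda>j. 4 * S / 2 ^ j) \<longlonglongrightarrow> 0"
    by (rule LIMSEQ_divide_realpow_zero) simp
  have "convergent (\<lambda>j. u j t n)" if t: "t \<in> {a..b}" for t n
  proof (rule Cauchy_convergent, rule metric_CauchyI)
    fix e :: real assume "0 < e"
    then have "0 < e / 2" by simp
    from order_tendstoD(2)[OF null this] obtain N where N: "\<And>j. j \<ge> N \<Longrightarrow> 4 * S / 2 ^ j < e / 2"
      by (auto simp: eventually_sequentially)
    have "dist (u i t n) (u N t n) < e / 2" if "i \<ge> N" for i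
      using norm_maj[OF tail'[of N "i - N"] t, of n] N[of N] that by (simp add: dist_norm)
    then show "\<exists>N. \<forall>i\<ge>N. \<forall>j\<ge>N. dist (u i t n) (u j t n) < e"
      by (meson dist_triangle_half_l)
  qed
  then have lim: "(\<lambda>j. u j t n) \<longlonglongrightarrow> lim (\<lambda>j. u j t n)" if "t \<in> {a..b}" for t n
    using that by (simp add: convergent_LIMSEQ_iff)
  define c where "c = (\<lambda>t n. lim (\<lambda>j. u j t n))"
  have lim_tail: "(\<lambda>i. u (j + i) t n - u j t n) \<longlonglongrightarrow> c t n - u j t n" if "t \<in> {a..b}" for t n j
    unfolding c_def by (intro tendsto_intros LIMSEQ_ignore_initial_segment[OF lim[OF that], of j, unfolded add.commute[of _ j]])
  have c_u: "norm (c t n - u j t n) \<le> 4 * S / 2 ^ j" if t: "t \<in> {a..b}" for t n j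
    using norm_maj[OF tail' t] by (intro LIMSEQ_le_const2[OF tendsto_norm[OF lim_tail[OF t]]]) auto
  have cont: "continuous_on {a..b} (\<lambda>t. c t n)" for n
  proof (rule uniform_limit_theorem)
    show "\<forall>\<^sub>F j in sequentially. continuous_on {a..b} (\<lambda>t. u j t n)"
      using adm by (simp add: admissible_def)
    show "uniform_limit {a..b} (\<lambda>j t. u j t n) (\<lambda>t. c t n) sequentially"
    proof (rule uniform_limitI)
      fix e :: real assume "0 < e"
      show "\<forall>\<^sub>F j in sequentially. \<forall>t\<in>{a..b}. dist (u j t n) (c t n) < e"
        using order_tendstoD(2)[OF null \<open>0 < e\<close>] 
      proof (rule eventually_mono, intro ballI)
        fix j t assume "4 * S / 2 ^ j < e" "t \<in> {a..b}"
        then show "dist (u j t n) (c t n) < e"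
          using c_u[of t n j] by (simp add: dist_norm norm_minus_commute[of "u j t n"])
      qed
    qed
  qed simp
  have contW: "continuous_on {a..b} W"
    unfolding W_def by (intro continuous_intros)
  have ab: "{a..b} \<noteq> {}" using t0 by auto
  have cu: "continuous_on {a..b} (\<lambda>t. u j t n)" for j n
    using adm[of j] by (simp add: admissible_def)
  have maj_c: "majorized {a..b} W c (2 * S)"
    using adm lim by (intro majorized_limit[OF compact_Icc ab contW cont, of u]) (auto simp: admissible_def c_def)
  then have adm_c: "admissible c"
    using cont by (simp add: admissible_def)
  \<comment> \<open>Both sides are limits of \<open>u (Suc j) t n\<close>: one by definition of
    \<open>c\<close>, the other because the contraction estimate also applies to the pair formed by
    \<open>c\<close> and \<open>u j\<close>.\<close>
  have fixed: "picard a t\<^sub>0 \<alpha> c t n = c t n" if t: "t \<in> {a..b}" for t n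
  proof (rule LIMSEQ_unique)
    have "majorized {a..b} W (\<lambda>t n. c t n - u j t n) (4 * S / 2 ^ j)" for j
      by (rule majorized_limit[OF compact_Icc ab contW _ tail' lim_tail]) (auto intro!: continuous_intros cont cu)
    then have "norm (picard a t\<^sub>0 \<alpha> c t n - u (Suc j) t n) \<le> 4 * S / 2 ^ j / 2" for j
      unfolding u_Suc by (intro norm_maj[OF picard_contraction[OF adm_c adm] t])
    moreover have "4 * S / 2 ^ j / 2 \<le> 4 * S / 2 ^ j" for j
      using S_nonneg by (simp add: divide_right_mono)
    ultimately have "norm (picard a t\<^sub>0 \<alpha> c t n - u (Suc j) t n) \<le> 4 * S / 2 ^ j" for j
      using order_trans by blast
    then have "(\<lambda>j. u (Suc j) t n - picard a t\<^sub>0 \<alpha> c t n) \<longlonglongrightarrow> 0"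
      by (intro Lim_null_comparison[OF _ null]) (auto simp: norm_minus_commute)
    then show "(\<lambda>j. u (Suc j) t n) \<longlonglongrightarrow> picard a t\<^sub>0 \<alpha> c t n"
      by (rule LIM_zero_cancel)
    show "(\<lambda>j. u (Suc j) t n) \<longlonglongrightarrow> c t n"
      unfolding c_def using lim[OF t] by (rule LIMSEQ_Suc)
  qed
  show ?thesis
  proof (intro exI[of _ c] conjI impI ballI)
    show "solves {a..b} c"
      unfolding solves_def
    proof (intro ballI allI)
      fix t n assume t: "t \<in> {a..b}"
      have "((\<lambda>t. picard a t\<^sub>0 \<alpha> c t n) has_vector_derivative
        \<mu> n * c t n + \<rho> n * cpow (c t) (Suc p) n) (at t within {a..b})"
        using picard_derivative[OF maj_c cont W t, of t\<^sub>0 \<alpha> n] fixed[OF t] by simp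
      then show "((\<lambda>t. c t n) has_vector_derivative \<mu> n * c t n + \<rho> n * cpow (c t) (Suc p) n) (at t within {a..b})"
        by (rule has_vector_derivative_transform[OF t fixed[symmetric], rotated])
    qed
    show "c t\<^sub>0 = \<alpha>"
      using fixed[OF t0] by (simp add: picard_init fun_eq_iff)
    show "majorized {a..b} W c (2 * S)"
      by (rule maj_c)
    assume "\<forall>n. \<mu> (- n) = cnj (\<mu> n) \<and> \<rho> (- n) = cnj (\<rho> n) \<and> \<alpha> (- n) = cnj (\<alpha> n)"
    then have sym: "\<mu> (- n) = cnj (\<mu> n)" "\<rho> (- n) = cnj (\<rho> n)" "\<alpha> (- n) = cnj (\<alpha> n)" for n
      by blast+
    have "u j t (- n) = cnj (u j t n)" for j t n
    proof (induction j arbitrary: t n)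
      case (Suc j)
      show ?case
        unfolding u_Suc by (rule cnj_picard) (rule sym Suc)+
    qed (simp add: u_def)
    then have "c t (- n) = cnj (c t n)" if "t \<in> {a..b}" for t n
      using LIMSEQ_unique[OF lim[OF that, of "- n"]] tendsto_cnj[OF lim[OF that, of n]]
      by (simp add: c_def)
    then show "\<forall>n. c t (- n) = cnj (c t n)" if "t \<in> {a..b}" for t
      using that by blast
  qed
qed

end

end

section \<open>Quasi-periodic functions and their coefficients\<close>

abbreviation freq :: "real ^ 'n::finite \<Rightarrow> int ^ 'n \<Rightarrow> real" where
  "freq \<omega> n \<equiv> \<omega> \<bullet> lattice_vec n"

definition synth :: "real ^ 'n::finite \<Rightarrow> (int ^ 'n \<Rightarrow> complex) \<Rightarrow> real \<Rightarrow> complex" where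
  "synth \<omega> c x = (\<Sum>\<^sub>\<infinity>n. c n * mode \<omega> n x)"

lemma norm_mode [simp]: "norm (mode \<omega> n x) = 1"
  by (simp add: mode_def)

lemma mode_add: "mode \<omega> (m + n) x = mode \<omega> m x * mode \<omega> n x"
  by (simp add: mode_def lattice_vec_add inner_add_right exp_add[symmetric] algebra_simps)

lemma mode_0 [simp]: "mode \<omega> 0 x = 1" "mode \<omega> n 0 = 1"
  by (simp_all add: mode_def)

lemma mode_0_fun: "mode \<omega> 0 = (\<lambda>_. 1)"
  by (rule ext) simp

lemma mode_uminus: "mode \<omega> (- n) x = cnj (mode \<omega> n x)"
  by (simp add: mode_def exp_cnj lattice_vec_uminus)

lemma mode_diff: "mode \<omega> (m - n) x = mode \<omega> m x * cnj (mode \<omega> n x)"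
  using mode_add[of \<omega> m "- n" x] by (simp add: mode_uminus)

lemma mode_of_nat_mult: "mode \<omega> n (of_nat j * h) = mode \<omega> n h ^ j"
  by (simp add: mode_def exp_of_nat_mult[symmetric] algebra_simps)

lemma mode_derivative: "((\<lambda>x. mode \<omega> n x) has_vector_derivative \<i> * freq \<omega> n * mode \<omega> n x) (at x within S)"
proof -
  have "mode \<omega> n = (\<lambda>x. exp (x *\<^sub>R (\<i> * complex_of_real (freq \<omega> n))))"
    by (rule ext) (simp add: mode_def scaleR_conv_of_real mult_ac)
  then show ?thesis
    using has_vector_derivative_exp_scaleR[of "\<i> * complex_of_real (freq \<omega> n)" x S] by simp
qed

lemma continuous_on_mode: "continuous_on S (mode \<omega> n)"
  by (rule continuous_on_vector_derivative[OF mode_derivative])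

lemma synth_has_sum:
  assumes "(\<lambda>n. norm (c n)) summable_on UNIV"
  shows "((\<lambda>n. c n * mode \<omega> n x) has_sum synth \<omega> c x) UNIV"
  unfolding synth_def
  by (rule has_sum_infsum, rule abs_summable_summable) (use assms in \<open>simp add: norm_mult\<close>)

lemma synth_summable:
  assumes "(\<lambda>n. norm (c n)) summable_on UNIV"
  shows "(\<lambda>n. c n * mode \<omega> n x) summable_on UNIV"
  using synth_has_sum[OF assms] by (rule has_sum_imp_summable)

lemma synth_diff:
  assumes "(\<lambda>n. norm (c n)) summable_on UNIV" "(\<lambda>n. norm (d n)) summable_on UNIV"
  shows "synth \<omega> (\<lambda>n. c n - d n) x = synth \<omega> c x - synth \<omega> d x"
  using synth_summable[OF assms(1)] synth_summable[OF assms(2)]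
  by (simp add: synth_def left_diff_distrib infsum_diff)

lemma synth_add:
  assumes "(\<lambda>n. norm (c n)) summable_on UNIV" "(\<lambda>n. norm (d n)) summable_on UNIV"
  shows "synth \<omega> (\<lambda>n. c n + d n) x = synth \<omega> c x + synth \<omega> d x"
  using synth_summable[OF assms(1)] synth_summable[OF assms(2)]
  by (simp add: synth_def distrib_right infsum_add)

text \<open>Modes are characters of the lattice, so multiplying coefficients by
  \<open>mode \<omega> n x\<close> commutes with convolution, and total sums of convolutions
  multiply.\<close>

lemma synth_conv:
  assumes "(\<lambda>n. norm (c n)) summable_on UNIV" "(\<lambda>n. norm (d n)) summable_on UNIV"
  shows "synth \<omega> (conv c d) x = synth \<omega> c x * synth \<omega> d x"
proof -
  have "conv c d n * mode \<omega> n x = conv (\<lambda>n. c n * mode \<omega> n x) (\<lambda>n. d n * mode \<omega> n x) n" for n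
  proof -
    have "c m * d (n - m) * mode \<omega> n x = c m * mode \<omega> m x * (d (n - m) * mode \<omega> (n - m) x)" for m
      using mode_add[of \<omega> m "n - m" x] by (simp add: mult_ac)
    then show ?thesis
      unfolding conv_def infsum_cmult_left'[symmetric] by (simp only:)
  qed
  then show ?thesis
    using infsum_conv[of "\<lambda>n. c n * mode \<omega> n x" "\<lambda>n. d n * mode \<omega> n x"] assms
    by (simp add: synth_def norm_mult)
qed

lemma cpow_abs_summable:
  fixes c :: "'g::ab_group_add \<Rightarrow> 'a::{banach,real_normed_field}"
  assumes "(\<lambda>n. norm (c n)) summable_on UNIV"
  shows "(\<lambda>n. norm (cpow c q n)) summable_on UNIV"
proof (induction q)
  case 0
  show ?case
    using has_sum_finite_neutralI[of "{0}" UNIV "\<lambda>n :: 'g. norm (if n = 0 then 1 else 0 :: 'a)"]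
    by (auto intro: has_sum_imp_summable)
next
  case (Suc q)
  show ?case
    using conv_abs_summable[OF assms Suc] by simp
qed

lemma synth_cpow:
  assumes "(\<lambda>n. norm (c n)) summable_on UNIV"
  shows "synth \<omega> (cpow c q) x = synth \<omega> c x ^ q"
proof (induction q)
  case 0
  have "((\<lambda>n. (if n = 0 then 1 else 0) * mode \<omega> n x) has_sum 1) UNIV"
    by (rule has_sum_finite_neutralI[of "{0}"]) auto
  then show ?case
    by (simp add: synth_def has_sum_iff)
next
  case (Suc q)
  then show ?case
    using synth_conv[OF assms cpow_abs_summable[OF assms]] by simp
qed

lemma synth_derivative:
  assumes "(\<lambda>n. norm (c n)) summable_on UNIV" "(\<lambda>n. norm (\<i> * freq \<omega> n * c n)) summable_on UNIV"
  shows "(synth \<omega> c has_vector_derivative synth \<omega> (\<lambda>n. \<i> * freq \<omega> n * c n) x) (at x)"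
proof -
  have "((\<lambda>x. \<Sum>\<^sub>\<infinity>n. c n * mode \<omega> n x) has_vector_derivative
      (\<Sum>\<^sub>\<infinity>n. c n * (\<i> * freq \<omega> n * mode \<omega> n x))) (at x within UNIV)"
  proof (rule has_vector_derivative_infsum[OF _ _ _ _ assms(2)])
    show "((\<lambda>x. c n * mode \<omega> n x) has_vector_derivative c n * (\<i> * freq \<omega> n * mode \<omega> n x)) (at x within UNIV)" for n x
      by (rule has_vector_derivative_mult_right[OF mode_derivative])
  qed (auto intro: synth_summable assms(1) simp: norm_mult)
  then show ?thesis
    by (simp add: synth_def[abs_def] mult_ac)
qed

section \<open>Recovery of the coefficients by Bohr means\<close>

definition mean :: "real ^ 'n::finite \<Rightarrow> int ^ 'n \<Rightarrow> real \<Rightarrow> complex" where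
  "mean \<omega> n N = of_real (1 / (2 * N)) * integral {-N..N} (mode \<omega> n)"

lemma norm_mean: "0 < N \<Longrightarrow> norm (mean \<omega> n N) = norm (integral {-N..N} (mode \<omega> n)) / (2 * N)"
  by (simp add: mean_def norm_mult norm_divide)

lemma norm_mean_le: "0 < N \<Longrightarrow> norm (mean \<omega> n N) \<le> 1"
  using integral_bound[of "- N" N "mode \<omega> n" 1]
  by (simp add: norm_mean continuous_on_mode divide_simps)

lemma mean_tendsto_0:
  assumes "freq \<omega> n \<noteq> 0"
  shows "(mean \<omega> n \<longlongrightarrow> 0) at_top"
proof (rule Lim_null_comparison)
  let ?c = "\<i> * complex_of_real (freq \<omega> n)"
  show "\<forall>\<^sub>F N in at_top. norm (mean \<omega> n N) \<le> (1 / \<bar>freq \<omega> n\<bar>) / N"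
    using eventually_gt_at_top[of "0 :: real"]
  proof eventually_elim
    case (elim N)
    have "(mode \<omega> n has_integral mode \<omega> n N / ?c - mode \<omega> n (- N) / ?c) {-N..N}"
    proof (rule fundamental_theorem_of_calculus)
      show "((\<lambda>x. mode \<omega> n x / ?c) has_vector_derivative mode \<omega> n x) (at x within {- N..N})" for x
        using has_vector_derivative_mult_left[OF mode_derivative[of \<omega> n x "{- N..N}"], of "inverse ?c"] assms
        by (simp add: divide_inverse mult_ac)
    qed (use elim in simp)
    then have "integral {-N..N} (mode \<omega> n) = mode \<omega> n N / ?c - mode \<omega> n (- N) / ?c"
      by (rule integral_unique)
    moreover have "norm (mode \<omega> n N / ?c - mode \<omega> n (- N) / ?c) \<le> 2 / \<bar>freq \<omega> n\<bar>"
      by (rule order_trans[OF norm_triangle_ineq4]) (simp add: norm_divide norm_mult)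
    ultimately have "norm (mean \<omega> n N) \<le> 2 / \<bar>freq \<omega> n\<bar> / (2 * N)"
      using elim by (simp only: norm_mean) (intro divide_right_mono, auto)
    then show ?case
      by simp
  qed
  show "((\<lambda>N. (1 / \<bar>freq \<omega> n\<bar>) / N) \<longlongrightarrow> 0) at_top"
    by (rule real_tendsto_divide_at_top[OF tendsto_const filterlim_ident])
qed

text \<open>For fixed \<open>N\<close> uniform convergence permits termwise integration; as
  \<open>N\<close> grows, the means of the modes are bounded by 1, so \<open>norm (c m)\<close>
  dominates the series. Independence of \<omega> makes every mean with m different from n tend to
  0.\<close>

lemma fourier_coeff_synth:
  fixes \<omega> :: "real ^ 'n::finite"
  assumes indep: "\<forall>n. freq \<omega> n = 0 \<longrightarrow> n = 0" and c: "(\<lambda>n. norm (c n)) summable_on UNIV"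
  shows "fourier_coeff \<omega> (synth \<omega> c) n = c n"
proof -
  have mean_synth: "of_real (1 / (2 * N)) * integral {-N..N} (\<lambda>x. synth \<omega> c x * exp (- \<i> * of_real (freq \<omega> n * x))) =
      (\<Sum>\<^sub>\<infinity>m. c m * mean \<omega> (m - n) N)" for N
  proof -
    have eq: "c m * mode \<omega> m x * exp (- \<i> * of_real (freq \<omega> n * x)) = c m * mode \<omega> (m - n) x" for m x
      by (simp add: mode_diff) (simp add: mode_def exp_cnj)
    have "uniform_limit {-N..N} (\<lambda>F x. \<Sum>m\<in>F. c m * mode \<omega> (m - n) x) (\<lambda>x. \<Sum>\<^sub>\<infinity>m. c m * mode \<omega> (m - n) x)
        (finite_subsets_at_top UNIV)"
      by (rule Weierstrass_m_test_general[OF _ c]) (simp add: norm_mult)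
    then obtain I J where IJ:
      "\<And>F. ((\<lambda>x. \<Sum>m\<in>F. c m * mode \<omega> (m - n) x) has_integral I F) {-N..N}"
      "((\<lambda>x. \<Sum>\<^sub>\<infinity>m. c m * mode \<omega> (m - n) x) has_integral J) {-N..N}"
      "(I \<longlongrightarrow> J) (finite_subsets_at_top UNIV)"
      by (rule uniform_limit_integral) (auto intro!: continuous_intros continuous_on_mode)
    have "I F = (\<Sum>m\<in>F. c m * integral {-N..N} (mode \<omega> (m - n)))" if "finite F" for F
    proof -
      have "((\<lambda>x. \<Sum>m\<in>F. c m * mode \<omega> (m - n) x) has_integral (\<Sum>m\<in>F. c m * integral {-N..N} (mode \<omega> (m - n)))) {-N..N}"
        by (intro has_integral_sum that has_integral_mult_right integrable_integral integrable_continuous_real continuous_on_mode)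
      then show ?thesis
        using IJ(1) has_integral_unique by blast
    qed
    then have "\<forall>\<^sub>F F in finite_subsets_at_top UNIV. I F = (\<Sum>m\<in>F. c m * integral {-N..N} (mode \<omega> (m - n)))"
      by (intro eventually_finite_subsets_at_top_weakI) auto
    then have "((\<lambda>m. c m * integral {-N..N} (mode \<omega> (m - n))) has_sum J) UNIV"
      unfolding has_sum_def using IJ(3) by (rule Lim_transform_eventually[rotated])
    then have "(\<Sum>\<^sub>\<infinity>m. of_real (1 / (2 * N)) * (c m * integral {-N..N} (mode \<omega> (m - n)))) = of_real (1 / (2 * N)) * J"
      by (intro infsumI has_sum_cmult_right)
    moreover have "integral {-N..N} (\<lambda>x. synth \<omega> c x * exp (- \<i> * of_real (freq \<omega> n * x))) = J"
      using IJ(2) unfolding synth_def infsum_cmult_left'[symmetric] eq by (rule integral_unique)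
    ultimately show ?thesis
      by (simp add: mean_def mult_ac)
  qed
  have "((\<lambda>N. \<Sum>\<^sub>\<infinity>m. c m * mean \<omega> (m - n) N) \<longlongrightarrow> (\<Sum>\<^sub>\<infinity>m. if m = n then c n else 0)) at_top"
  proof (rule tendsto_infsum_dominated[OF _ _ c])
    show "((\<lambda>N. c m * mean \<omega> (m - n) N) \<longlongrightarrow> (if m = n then c n else 0)) at_top" for m
    proof (cases "m = n")
      case True
      have "\<forall>\<^sub>F N in at_top. c n = c m * mean \<omega> (m - n) N"
        using eventually_gt_at_top[of "0 :: real"]
        by eventually_elim (simp add: True mean_def mode_0_fun scaleR_conv_of_real)
      then show ?thesis
        using True by (intro Lim_transform_eventually[OF tendsto_const]) auto
    next
      case False
      then have "freq \<omega> (m - n) \<noteq> 0"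
        using indep by (metis eq_iff_diff_eq_0)
      then show ?thesis
        using tendsto_mult_right_zero[OF mean_tendsto_0] False by simp
    qed
    show "\<forall>\<^sub>F N in at_top. \<forall>m\<in>UNIV. norm (c m * mean \<omega> (m - n) N) \<le> norm (c m)"
      using eventually_gt_at_top[of "0 :: real"]
      by eventually_elim (auto simp: norm_mult intro!: mult_left_le norm_mean_le)
  qed
  moreover have "(\<Sum>\<^sub>\<infinity>m. if m = n then c n else 0) = c n"
    by (intro infsumI has_sum_finite_neutralI[of "{n}"]) auto
  ultimately show ?thesis
    unfolding fourier_coeff_def mean_synth by (intro tendsto_Lim) auto
qed

section \<open>Coefficients of elements of \<open>V_space\<close> and of real-valued
  functions\<close>

lemma weighted_summable_imp_abs_summable:
  fixes c :: "int ^ 'n::finite \<Rightarrow> complex"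
  assumes "(\<lambda>n. norm (c n) * exp (s * lnorm n)) summable_on UNIV" "0 \<le> s"
  shows "(\<lambda>n. norm (c n)) summable_on UNIV"
  by (rule summable_on_comparison_test[OF assms(1)]) (auto intro: norm_le_weighted assms(2))

lemma synth_in_V_space:
  assumes "(\<lambda>n. norm (c n) * exp (s * lnorm n)) summable_on UNIV" "0 \<le> s"
  shows "synth \<omega> c \<in> V_space \<omega> s"
  unfolding V_space_def
  using assms(1) synth_has_sum[OF weighted_summable_imp_abs_summable[OF assms]] by blast

text \<open>\<open>V_space\<close> only asserts that some coefficients exist; by
  \<open>fourier_coeff_synth\<close> they must be the Fourier coefficients, so the series in
  \<open>V_norm\<close> converges.\<close>

lemma V_spaceE:
  fixes \<omega> :: "real ^ 'n::finite"
  assumes "u \<in> V_space \<omega> s" "0 \<le> s" and indep: "\<forall>n. freq \<omega> n = 0 \<longrightarrow> n = 0"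
  shows "(\<lambda>n. norm (fourier_coeff \<omega> u n) * exp (s * lnorm n)) summable_on UNIV"
    and "u = synth \<omega> (fourier_coeff \<omega> u)"
proof -
  obtain c where c: "(\<lambda>n. norm (c n) * exp (s * lnorm n)) summable_on UNIV"
    and sum: "\<And>x. ((\<lambda>n. c n * mode \<omega> n x) has_sum u x) UNIV"
    using assms(1) by (auto simp: V_space_def)
  have u: "u = synth \<omega> c"
    using infsumI[OF sum] by (auto simp: synth_def)
  have "fourier_coeff \<omega> u = c"
    unfolding u using fourier_coeff_synth[OF indep weighted_summable_imp_abs_summable[OF c assms(2)]] by blast
  with c u show "(\<lambda>n. norm (fourier_coeff \<omega> u n) * exp (s * lnorm n)) summable_on UNIV"
    "u = synth \<omega> (fourier_coeff \<omega> u)" by simp_all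
qed

lemma fourier_coeff_diff:
  fixes \<omega> :: "real ^ 'n::finite"
  assumes "u \<in> V_space \<omega> s" "v \<in> V_space \<omega> s" "0 \<le> s" and indep: "\<forall>n. freq \<omega> n = 0 \<longrightarrow> n = 0"
  shows "fourier_coeff \<omega> (\<lambda>x. u x - v x) n = fourier_coeff \<omega> u n - fourier_coeff \<omega> v n"
proof -
  note u = V_spaceE[OF assms(1,3) indep] and v = V_spaceE[OF assms(2,3) indep]
  have su: "(\<lambda>n. norm (fourier_coeff \<omega> u n)) summable_on UNIV"
    and sv: "(\<lambda>n. norm (fourier_coeff \<omega> v n)) summable_on UNIV"
    by (rule weighted_summable_imp_abs_summable[OF u(1) assms(3)])
      (rule weighted_summable_imp_abs_summable[OF v(1) assms(3)])
  have "(\<lambda>x. u x - v x) = synth \<omega> (\<lambda>n. fourier_coeff \<omega> u n - fourier_coeff \<omega> v n)"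
  proof
    fix x
    show "u x - v x = synth \<omega> (\<lambda>n. fourier_coeff \<omega> u n - fourier_coeff \<omega> v n) x"
      unfolding synth_diff[OF su sv] using fun_cong[OF u(2), of x] fun_cong[OF v(2), of x] by (simp only:)
  qed
  moreover have "(\<lambda>n. norm (fourier_coeff \<omega> u n - fourier_coeff \<omega> v n)) summable_on UNIV"
    by (rule summable_on_comparison_test[OF summable_on_add[OF su sv]]) (auto intro: norm_triangle_ineq4)
  ultimately show ?thesis
    by (simp only: fourier_coeff_synth[OF indep])
qed

text \<open>A real u equals its conjugate, whose expansion has coefficients
  \<open>cnj (c (- n))\<close>; uniqueness of coefficients compares the two.\<close>

lemma fourier_coeff_real:
  fixes \<omega> :: "real ^ 'n::finite"
  assumes "u \<in> V_real \<omega> s" "0 \<le> s" and indep: "\<forall>n. freq \<omega> n = 0 \<longrightarrow> n = 0"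
  shows "fourier_coeff \<omega> u (- n) = cnj (fourier_coeff \<omega> u n)"
proof -
  have V: "u \<in> V_space \<omega> s" and real: "\<And>x. u x \<in> \<real>"
    using assms(1) by (auto simp: V_real_def)
  note u = V_spaceE[OF V assms(2) indep]
  define c where "c = fourier_coeff \<omega> u"
  have c: "(\<lambda>n. norm (c n)) summable_on UNIV"
    unfolding c_def by (rule weighted_summable_imp_abs_summable[OF u(1) assms(2)])
  have bij: "bij_betw uminus UNIV (UNIV :: (int ^ 'n) set)"
    by (rule bij_betwI[where g = uminus]) auto
  have c': "(\<lambda>n. norm (cnj (c (- n)))) summable_on UNIV"
    using c summable_on_reindex_bij_betw[OF bij, of "\<lambda>n. norm (c n)"] by simp
  have "u x = synth \<omega> (\<lambda>n. cnj (c (- n))) x" for x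
  proof -
    have ux: "u x = (\<Sum>\<^sub>\<infinity>n. c n * mode \<omega> n x)"
      using fun_cong[OF u(2), of x] by (simp only: synth_def c_def)
    have "u x = cnj (u x)"
      using real[of x] by (simp add: Reals_cnj_iff)
    also have "\<dots> = (\<Sum>\<^sub>\<infinity>n. cnj (c n) * mode \<omega> (- n) x)"
      by (simp add: ux infsum_cnj[symmetric] mode_uminus del: infsum_cnj)
    also have "\<dots> = (\<Sum>\<^sub>\<infinity>n. cnj (c (- n)) * mode \<omega> n x)"
      using infsum_reindex_bij_betw[OF bij, of "\<lambda>n. cnj (c n) * mode \<omega> (- n) x"] by simp
    finally show ?thesis by (simp add: synth_def)
  qed
  then have "u = synth \<omega> (\<lambda>n. cnj (c (- n)))"
    by (rule ext)
  from arg_cong[OF this, of "\<lambda>u. fourier_coeff \<omega> u (- n)"] show ?thesis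
    unfolding fourier_coeff_synth[OF indep c'] by (simp add: c_def)
qed

lemma synth_real:
  assumes "(\<lambda>n. norm (c n)) summable_on UNIV" "\<And>n. c (- n) = cnj (c n)"
  shows "synth \<omega> c x \<in> \<real>"
proof -
  have bij: "bij_betw uminus UNIV (UNIV :: (int ^ 'n) set)"
    by (rule bij_betwI[where g = uminus]) auto
  have "cnj (synth \<omega> c x) = (\<Sum>\<^sub>\<infinity>n. c (- n) * mode \<omega> (- n) x)"
    by (simp add: synth_def infsum_cnj[symmetric] mode_uminus assms(2) del: infsum_cnj)
  also have "\<dots> = synth \<omega> c x"
    unfolding synth_def by (rule infsum_reindex_bij_betw[OF bij])
  finally show ?thesis
    by (simp add: Reals_cnj_iff)
qed

section \<open>Sample means and propagation across gaps\<close>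

lemma countable_lattice: "countable (UNIV :: (int ^ 'n::finite) set)"
proof -
  have UN: "(UNIV :: (int ^ 'n) set) = (\<Union>k :: nat. {n. lnorm n \<le> real k})"
    using real_arch_simple by auto
  show ?thesis
    by (subst UN) (rule countable_UN[OF countableI_type countable_finite[OF finite_lnorm_le]])
qed

text \<open>A bad h is an integer multiple of \<open>2 * pi / freq \<omega> n\<close> for some
  nonzero n, which excludes countably many values only. Along multiples of the remaining h every
  nontrivial mode averages to 0 as a geometric sum.\<close>

lemma exists_generic_step:
  fixes \<omega> :: "real ^ 'n::finite"
  assumes indep: "\<forall>n. freq \<omega> n = 0 \<longrightarrow> n = 0"
  obtains h where "\<And>n. n \<noteq> 0 \<Longrightarrow> mode \<omega> n h \<noteq> 1"
proof -
  define X where "X = (\<Union>n\<in>(UNIV :: (int ^ 'n) set). range (\<lambda>k :: int. 2 * pi * k / freq \<omega> n))"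
  have "countable X"
    unfolding X_def by (intro countable_UN countable_lattice) auto
  then obtain h where h: "h \<notin> X"
    using uncountable_UNIV_real by (metis UNIV_eq_I)
  have "mode \<omega> n h \<noteq> 1" if "n \<noteq> 0" for n
  proof
    assume "mode \<omega> n h = 1"
    then obtain k :: int where "freq \<omega> n * h = 2 * pi * k"
      unfolding mode_def exp_eq_1 by (auto simp: mult_ac)
    moreover have "freq \<omega> n \<noteq> 0"
      using indep that by blast
    ultimately have "h = 2 * pi * k / freq \<omega> n"
      by (simp add: field_simps)
    then have "h \<in> X"
      unfolding X_def by blast
    with h show False by blast
  qed
  then show thesis by (rule that)
qed

text \<open>The averages do not tend to 0 uniformly in n. But when \<open>lnorm n\<close> is large
  the weight already exceeds the trivial bound 1, so cancellation is required for finitely many n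
  only, and one \<open>N\<close> handles them all.\<close>

lemma discrete_mean_small:
  fixes \<omega> :: "real ^ 'n::finite"
  assumes h: "\<And>n. n \<noteq> 0 \<Longrightarrow> mode \<omega> n h \<noteq> 1" and "0 < e" "0 < \<sigma>"
  obtains N :: nat where "0 < N"
    "\<And>n. n \<noteq> m \<Longrightarrow> norm ((\<Sum>j<N. mode \<omega> (n - m) (of_nat j * h)) / of_nat N) \<le> e * exp (\<sigma> * lnorm n)"
proof -
  \<comment> \<open>Chosen so that \<open>e * exp (\<sigma> * R) = 1\<close>.\<close>
  define R where "R = - ln e / \<sigma>"
  define G where "G = {n :: int ^ 'n. lnorm n \<le> R} - {m}"
  have G: "finite G"
    unfolding G_def using finite_lnorm_le by blast
  let ?b = "\<lambda>n. 2 / (e * norm (mode \<omega> (n - m) h - 1))"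
  obtain N :: nat where N: "(\<Sum>n\<in>G. ?b n) < real N"
    using reals_Archimedean2 by blast
  have "0 \<le> (\<Sum>n\<in>G. ?b n)"
    using \<open>0 < e\<close> by (intro sum_nonneg) auto
  with N have N0: "0 < N" by linarith
  have "norm ((\<Sum>j<N. mode \<omega> (n - m) (of_nat j * h)) / of_nat N) \<le> e * exp (\<sigma> * lnorm n)" if "n \<noteq> m" for n
  proof (cases "n \<in> G")
    case True
    let ?z = "mode \<omega> (n - m) h"
    have z: "?z \<noteq> 1"
      using h[of "n - m"] that by simp
    have "?b n \<le> (\<Sum>n\<in>G. ?b n)"
      using True G \<open>0 < e\<close> by (intro member_le_sum) auto
    with N have bN: "?b n \<le> real N" by linarith
    have "(\<Sum>j<N. mode \<omega> (n - m) (of_nat j * h)) = (?z ^ N - 1) / (?z - 1)"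
      using geometric_sum[OF z, of N] by (simp only: mode_of_nat_mult)
    moreover have "norm (?z ^ N - 1) \<le> 2"
      using norm_triangle_ineq4[of "?z ^ N" 1] by (simp add: norm_power)
    ultimately have "norm (\<Sum>j<N. mode \<omega> (n - m) (of_nat j * h)) \<le> 2 / norm (?z - 1)"
      by (simp only: norm_divide) (rule divide_right_mono, auto)
    then have "norm ((\<Sum>j<N. mode \<omega> (n - m) (of_nat j * h)) / of_nat N) \<le> 2 / norm (?z - 1) / real N"
      unfolding norm_divide norm_of_nat by (rule divide_right_mono) simp
    also have "\<dots> \<le> e"
      using bN z N0 \<open>0 < e\<close> by (simp add: field_simps)
    also have "\<dots> \<le> e * exp (\<sigma> * lnorm n)"
      using \<open>0 < e\<close> \<open>0 < \<sigma>\<close> by simp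
    finally show ?thesis .
  next
    case False
    then have "R < lnorm n"
      using that by (auto simp: G_def)
    then have "- ln e < \<sigma> * lnorm n"
      using \<open>0 < \<sigma>\<close> by (simp add: R_def field_simps)
    then have "exp (- ln e) \<le> exp (\<sigma> * lnorm n)"
      by simp
    then have "1 \<le> e * exp (\<sigma> * lnorm n)"
      using \<open>0 < e\<close> by (simp add: exp_minus field_simps)
    moreover have "norm (\<Sum>j<N. mode \<omega> (n - m) (of_nat j * h)) \<le> real N"
      using norm_sum[of "\<lambda>j. mode \<omega> (n - m) (of_nat j * h)" "{..<N}"] by simp
    then have "norm ((\<Sum>j<N. mode \<omega> (n - m) (of_nat j * h)) / of_nat N) \<le> 1"
      using N0 by (simp add: norm_divide)
    ultimately show ?thesis by linarith
  qed
  with N0 show thesis by (rule that)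
qed

text \<open>A finite average over sample points, rather than the mean over an interval, since only
  finitely many of the pointwise time derivatives can be combined without a domination hypothesis.\<close>

definition sample_mean :: "real ^ 'n::finite \<Rightarrow> real \<Rightarrow> nat \<Rightarrow> int ^ 'n \<Rightarrow> (real \<Rightarrow> complex) \<Rightarrow> complex" where
  "sample_mean \<omega> h N m u = (\<Sum>j<N. u (of_nat j * h) * cnj (mode \<omega> m (of_nat j * h))) / of_nat N"

lemma sample_mean_diff: "sample_mean \<omega> h N m (\<lambda>x. u x - v x) = sample_mean \<omega> h N m u - sample_mean \<omega> h N m v"
  by (simp add: sample_mean_def left_diff_distrib sum_subtractf diff_divide_distrib)

text \<open>The sample points depend on \<open>e\<close>, \<sigma> and m but not on z, so one choice
  of \<open>N\<close> serves all times of a time-dependent family.\<close>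

lemma sample_mean_synth:
  fixes \<omega> :: "real ^ 'n::finite"
  assumes N: "0 < N"
    and small: "\<And>n. n \<noteq> m \<Longrightarrow> norm ((\<Sum>j<N. mode \<omega> (n - m) (of_nat j * h)) / of_nat N) \<le> e * exp (\<sigma> * lnorm n)"
    and z: "(\<lambda>n. norm (z n) * exp (\<sigma> * lnorm n)) summable_on UNIV"
      "(\<Sum>\<^sub>\<infinity>n. norm (z n) * exp (\<sigma> * lnorm n)) \<le> Z"
    and pos: "0 \<le> e" "0 \<le> \<sigma>"
  shows "norm (sample_mean \<omega> h N m (synth \<omega> z) - z m) \<le> e * Z"
proof -
  let ?d = "\<lambda>n. (\<Sum>j<N. mode \<omega> (n - m) (of_nat j * h)) / of_nat N"
  have za: "(\<lambda>n. norm (z n)) summable_on UNIV"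
    by (rule weighted_summable_imp_abs_summable[OF z(1) pos(2)])
  have "((\<lambda>n. \<Sum>j<N. z n * mode \<omega> n (of_nat j * h) * cnj (mode \<omega> m (of_nat j * h))) has_sum
      (\<Sum>j<N. synth \<omega> z (of_nat j * h) * cnj (mode \<omega> m (of_nat j * h)))) UNIV"
  proof (induction N)
    case (Suc N)
    then show ?case
      using has_sum_add[OF Suc has_sum_cmult_left[OF synth_has_sum[OF za, of \<omega> "of_nat N * h"],
            of "cnj (mode \<omega> m (of_nat N * h))"]] by simp
  qed simp
  from has_sum_cmult_left[OF this, of "1 / of_nat N"]
  have "((\<lambda>n. (\<Sum>j<N. z n * mode \<omega> n (of_nat j * h) * cnj (mode \<omega> m (of_nat j * h))) * (1 / of_nat N)) has_sum
      sample_mean \<omega> h N m (synth \<omega> z)) UNIV"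
    by (simp only: sample_mean_def divide_inverse mult_1)
  moreover have "(\<Sum>j<N. z n * mode \<omega> n (of_nat j * h) * cnj (mode \<omega> m (of_nat j * h))) * (1 / of_nat N) = z n * ?d n" for n
    by (simp add: mode_diff sum_distrib_left mult.assoc)
  ultimately have zd: "((\<lambda>n. z n * ?d n) has_sum sample_mean \<omega> h N m (synth \<omega> z)) UNIV"
    by (simp only:)
  have zm: "((\<lambda>n. if n = m then z m else 0) has_sum z m) UNIV"
    by (rule has_sum_finite_neutralI[of "{m}"]) auto
  have diff: "((\<lambda>n. z n * ?d n - (if n = m then z m else 0)) has_sum
      (sample_mean \<omega> h N m (synth \<omega> z) - z m)) UNIV"
    using has_sum_add[OF zd has_sum_uminusI[OF zm]] by (simp only: diff_conv_add_uminus)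
  have "norm (sample_mean \<omega> h N m (synth \<omega> z) - z m) \<le> e * (\<Sum>\<^sub>\<infinity>n. norm (z n) * exp (\<sigma> * lnorm n))"
  proof (rule norm_infsum_le[OF diff has_sum_cmult_right[OF has_sum_infsum[OF z(1)]]])
    fix n
    show "norm (z n * ?d n - (if n = m then z m else 0)) \<le> e * (norm (z n) * exp (\<sigma> * lnorm n))"
    proof (cases "n = m")
      case True
      then show ?thesis using N pos by simp
    next
      case False
      have "norm (z n) * norm (?d n) \<le> norm (z n) * (e * exp (\<sigma> * lnorm n))"
        by (intro mult_left_mono small False) auto
      with False show ?thesis
        by (simp only: if_False diff_0_right norm_mult mult.left_commute)
    qed
  qed
  also have "\<dots> \<le> e * Z"
    by (intro mult_left_mono z pos)
  finally show ?thesis .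
qed

text \<open>A mean value inequality that sees derivatives only on the closed set \<open>P\<close>.
  One advances along \<open>P\<close>: over an adjacent gap by the assumed increment bound, and
  where \<open>P\<close> accumulates from the right by the derivative.\<close>

lemma lipschitz_across_gaps:
  fixes H :: "real \<Rightarrow> 'a::real_normed_vector"
  assumes P: "closed P" "t \<in> P" "t' \<in> P" and le: "t \<le> t'"
    and cont: "continuous_on {t..t'} H"
    and der: "\<And>s. s \<in> P \<Longrightarrow> s \<in> {t..t'} \<Longrightarrow>
      \<exists>D. (H has_vector_derivative D) (at s within {t..t'}) \<and> norm D \<le> K"
    and gap: "\<And>a b. a \<in> P \<Longrightarrow> b \<in> P \<Longrightarrow> t \<le> a \<Longrightarrow> a < b \<Longrightarrow> b \<le> t' \<Longrightarrow> {a<..<b} \<inter> P = {} \<Longrightarrow>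
      norm (H b - H a) \<le> K * (b - a)"
  shows "norm (H t' - H t) \<le> K * (t' - t)"
proof -
  have eps: "norm (H t' - H t) \<le> (K + e) * (t' - t)" if "0 < e" for e
  proof -
    \<comment> \<open>Differentiability at a point controls nearby increments only up to an error
      \<open>e * norm (x - s)\<close>; this is the reason for the slack in \<open>K + e\<close>. The
      supremum of \<open>S\<close> is shown to be \<open>t'\<close>.\<close>
    define S where "S = {s \<in> P \<inter> {t..t'}. norm (H s - H t) \<le> (K + e) * (s - t)}"
    have S: "closed S"
      unfolding S_def using P cont
      by (intro continuous_on_closed_Collect_le continuous_intros closed_Int) (auto intro: continuous_on_subset)
    have ne: "S \<noteq> {}" and bdd: "bdd_above S"
      using P le by (auto simp: S_def bdd_above_def)
    define s where "s = Sup S"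
    have sS: "s \<in> S"
      unfolding s_def by (rule closed_contains_Sup[OF ne bdd S])
    have max: "x \<le> s" if "x \<in> S" for x
      unfolding s_def by (rule cSup_upper[OF that bdd])
    have extend: "x \<in> S" if "x \<in> P" "s \<le> x" "x \<le> t'" "norm (H x - H s) \<le> (K + e) * (x - s)" for x
    proof -
      have "norm (H x - H t) \<le> norm (H x - H s) + norm (H s - H t)"
        using norm_triangle_ineq[of "H x - H s" "H s - H t"] by simp
      also have "\<dots> \<le> (K + e) * (x - s) + (K + e) * (s - t)"
        using that(4) sS by (intro add_mono) (auto simp: S_def)
      finally show ?thesis
        using that sS by (auto simp: S_def algebra_simps)
    qed
    have "s = t'"
    proof (rule ccontr)
      assume "s \<noteq> t'"
      then have st: "s < t'" "t \<le> s" "s \<in> P"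
        using sS by (auto simp: S_def)
      define Q where "Q = P \<inter> {s<..t'}"
      have Q: "Q \<noteq> {}" "bdd_below Q"
        using st P by (auto simp: Q_def intro!: bdd_belowI[of _ s])
      show False
      \<comment> \<open>If \<open>s < Inf Q\<close>, the interval between them is a gap ending in
        \<open>P\<close>, to be crossed in one jump. Otherwise there are points of \<open>P\<close>
        arbitrarily close to the right of \<open>s\<close>.\<close>
      proof (cases "s < Inf Q")
        case True
        have "Q = P \<inter> {Inf Q..t'}"
          using True cInf_lower[OF _ Q(2)] by (auto simp: Q_def)
        then have "closed Q"
          using P(1) by (metis closed_Int closed_atLeastAtMost)
        then have bQ: "Inf Q \<in> Q"
          using closed_contains_Inf[OF Q] by blast
        have "x \<notin> P" if "x \<in> {s<..<Inf Q}" for x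
          using cInf_lower[OF _ Q(2), of x] that bQ by (auto simp: Q_def)
        then have "norm (H (Inf Q) - H s) \<le> K * (Inf Q - s)"
          using bQ st True by (intro gap) (auto simp: Q_def)
        also have "\<dots> \<le> (K + e) * (Inf Q - s)"
          using True \<open>0 < e\<close> by (simp add: mult_right_mono)
        finally have "Inf Q \<in> S"
          using bQ True by (intro extend) (auto simp: Q_def)
        then show False
          using max True by force
      next
        case False
        obtain D where D: "(H has_vector_derivative D) (at s within {t..t'})" "norm D \<le> K"
          using der[of s] st by auto
        obtain \<delta> where \<delta>: "0 < \<delta>"
          "\<And>x. x \<in> {t..t'} \<Longrightarrow> norm (x - s) < \<delta> \<Longrightarrow> norm (H x - H s - (x - s) *\<^sub>R D) \<le> e * norm (x - s)"
          using D(1) \<open>0 < e\<close> unfolding has_vector_derivative_def has_derivative_within_alt by meson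
        have "Inf Q < s + \<delta>"
          using False \<delta>(1) by linarith
        then obtain x where x: "x \<in> Q" "x < s + \<delta>"
          using cInf_lessD[OF Q(1)] by blast
        then have x': "x \<in> P" "s < x" "x \<le> t'"
          by (auto simp: Q_def)
        have "norm (H x - H s) \<le> norm (H x - H s - (x - s) *\<^sub>R D) + norm ((x - s) *\<^sub>R D)"
          using norm_triangle_ineq[of "H x - H s - (x - s) *\<^sub>R D" "(x - s) *\<^sub>R D"] by simp
        also have "\<dots> \<le> e * (x - s) + (x - s) * K"
          using \<delta>(2)[of x] x x' st D(2) by (intro add_mono) (auto intro: mult_left_mono)
        finally have "x \<in> S"
          using x' by (intro extend) (auto simp: algebra_simps)
        with max x' show False by force
      qed
    qed
    then show ?thesis
      using sS by (simp add: S_def)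
  qed
  show ?thesis
  proof (rule field_le_epsilon)
    fix e :: real assume "0 < e"
    have "(K + e / (t' - t + 1)) * (t' - t) \<le> K * (t' - t) + e"
    proof -
      have "e * (t' - t) \<le> e * (t' - t + 1)"
        using \<open>0 < e\<close> by (intro mult_left_mono) auto
      then have "e / (t' - t + 1) * (t' - t) \<le> e"
        using le by (simp add: divide_simps)
      then show ?thesis
        by (simp add: distrib_right)
    qed
    then show "norm (H t' - H t) \<le> K * (t' - t) + e"
      using eps[of "e / (t' - t + 1)"] \<open>0 < e\<close> le by (simp del: times_divide_eq_left)
  qed
qed

text \<open>A chord is no longer than its arc. This charges the motion of the free flow to
  \<open>norm A\<close>, hence to the multiplier term at the starting time.\<close>

lemma norm_exp_scaleR_minus_1_le:
  fixes A :: complex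
  assumes "Re A = 0" "0 \<le> t"
  shows "norm (exp (t *\<^sub>R A) - 1) \<le> t * norm A"
proof (cases "t = 0")
  case False
  have "norm (exp (t *\<^sub>R A) - exp (0 *\<^sub>R A)) \<le> t * norm A - 0 * norm A"
  proof (rule differentiable_bound_general[where f' = "\<lambda>s. A * exp (s *\<^sub>R A)" and \<phi>' = "\<lambda>_. norm A"])
    show "((\<lambda>s. s * norm A) has_vector_derivative norm A) (at s)" for s
      using has_vector_derivative_mult_left[OF has_vector_derivative_id] by fastforce
    show "norm (A * exp (s *\<^sub>R A)) \<le> norm A" for s
      unfolding norm_mult norm_exp_scaleR_imaginary[OF assms(1)] by simp
  qed (use False assms in \<open>auto intro!: continuous_intros has_vector_derivative_exp_scaleR\<close>)
  then show ?thesis by simp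
qed simp

text \<open>Baire's theorem inside \<open>P\<close>: if no \<open>A M\<close> contained a portion of
  \<open>P\<close>, all the sets \<open>P - A M\<close> would be open and dense in \<open>P\<close>,
  although their intersection is empty.\<close>

lemma closed_union_contains_interior:
  fixes P :: "real set" and A :: "nat \<Rightarrow> real set"
  assumes P: "closed P" "P \<noteq> {}" and A: "\<And>M. closed (A M)" and cover: "P \<subseteq> (\<Union>M. A M)"
  obtains M t \<delta> where "t \<in> P" "0 < \<delta>" "P \<inter> ball t \<delta> \<subseteq> A M"
proof (rule ccontr)
  note witness = that
  assume not: "\<not> thesis"
  have no: "\<not> P \<inter> ball t \<delta> \<subseteq> A M" if t: "t \<in> P" "0 < \<delta>" for t \<delta> M
  proof
    assume "P \<inter> ball t \<delta> \<subseteq> A M"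
    with t have thesis by (rule witness)
    with not show False ..
  qed
  have "P \<subseteq> closure (\<Inter>(range (\<lambda>M. P - A M)))"
  proof (rule Baire[OF P(1)])
    fix T assume "T \<in> range (\<lambda>M. P - A M)"
    then obtain M where T: "T = P - A M" by blast
    have "T = P \<inter> - A M"
      using T by blast
    then have "openin (top_of_set P) T"
      using A[of M] by (metis openin_open open_Compl)
    moreover have "P \<subseteq> closure T"
    proof
      fix t assume t: "t \<in> P"
      show "t \<in> closure T"
        unfolding closure_approachable
      proof (intro allI impI)
        fix e :: real assume "0 < e"
        then obtain y where "y \<in> P" "y \<in> ball t e" "y \<notin> A M"
          using no[OF t, of e M] by blast
        then show "\<exists>y\<in>T. dist y t < e"
          using T by (auto simp: dist_commute)
      qed
    qed
    ultimately show "openin (top_of_set P) T \<and> P \<subseteq> closure T" by blast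
  qed simp
  moreover have "(\<Inter>(range (\<lambda>M. P - A M))) = {}"
    using cover by blast
  ultimately have "P \<subseteq> closure {}"
    by (simp only:)
  then show False
    using P(2) by simp
qed

section \<open>Classical solutions solve the coefficient equation\<close>

text \<open>The nonlinear term enters only as a forcing \<open>r\<close> with a weighted bound
  uniform in time. The term \<mu> c has no such bound: \<open>dom\<close> provides a decay rate that
  may vary with t arbitrarily.\<close>

theorem pointwise_imp_coefficient_ode:
  fixes \<omega> :: "real ^ 'n::finite" and c r :: "real \<Rightarrow> int ^ 'n \<Rightarrow> complex"
  assumes indep: "\<forall>n. freq \<omega> n = 0 \<longrightarrow> n = 0"
    and cont: "\<And>n. continuous_on {a..b} (\<lambda>t. c t n)" "\<And>n. continuous_on {a..b} (\<lambda>t. r t n)"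
    and \<sigma>0: "0 < \<sigma>\<^sub>0" and majc: "majorized {a..b} (\<lambda>_. \<sigma>\<^sub>0) c B" and majr: "majorized {a..b} (\<lambda>_. \<sigma>\<^sub>0) r R"
    and \<mu>: "\<And>n. Re (\<mu> n) = 0"
    and dom: "\<And>t. t \<in> {a..b} \<Longrightarrow> \<exists>s>0. (\<lambda>n. norm (\<mu> n * c t n) * exp (s * lnorm n)) summable_on UNIV"
    and ptw: "\<And>t x. t \<in> {a..b} \<Longrightarrow> ((\<lambda>s. synth \<omega> (c s) x) has_vector_derivative
      synth \<omega> (\<lambda>n. \<mu> n * c t n + r t n) x) (at t within {a..b})"
    and t: "t \<in> {a..b}"
  shows "((\<lambda>s. c s n) has_vector_derivative \<mu> n * c t n + r t n) (at t within {a..b})"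
proof -
  define v where "v = (\<lambda>t n. \<mu> n * c t n + r t n)"
  define V where "V = (\<lambda>t n. integral {a..t} (\<lambda>s. v s n))"
  \<comment> \<open>For each single n the right-hand side is continuous in t, so its primitive
    \<open>V\<close> exists, and the coefficient equation says that \<open>y\<close> is constant in
    time.\<close>
  define y where "y = (\<lambda>t n. c t n - V t n)"
  have contv: "continuous_on {a..b} (\<lambda>t. v t n)" for n
    unfolding v_def by (intro continuous_intros cont)
  have derV: "((\<lambda>t. V t n) has_vector_derivative v t n) (at t within {a..b})" if "t \<in> {a..b}" for t n
    unfolding V_def by (rule integral_has_vector_derivative[OF contv that])
  have contV: "continuous_on {a..b} (\<lambda>t. V t n)" for n
    by (rule continuous_on_vector_derivative[OF derV])
  have conty: "continuous_on {a..b} (\<lambda>t. y t n)" for n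
    unfolding y_def by (intro continuous_intros cont contV)
  have abs_c: "(\<lambda>n. norm (c t n)) summable_on UNIV" if "t \<in> {a..b}" for t
    by (rule majorized_abs_summable[OF majc that]) (use \<sigma>0 in simp)
  obtain g where g: "g summable_on UNIV" "infsum g UNIV \<le> R" "\<And>n. 0 \<le> g n"
      "\<And>t n. t \<in> {a..b} \<Longrightarrow> norm (r t n) * exp (\<sigma>\<^sub>0 * lnorm n) \<le> g n"
    using majr by (rule majorizedE) blast

  \<comment> \<open>One \<delta> has to serve all n; this is the form in which the contradiction is
    obtained at the end.\<close>
  define Good where "Good = {t. \<exists>\<delta>>0. \<forall>n. \<forall>s\<in>{a..b} \<inter> ball t \<delta>. \<forall>s'\<in>{a..b} \<inter> ball t \<delta>. y s n = y s' n}"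
  have "open Good"
    unfolding open_contains_ball
  proof
    fix t assume "t \<in> Good"
    then obtain \<delta> where \<delta>: "0 < \<delta>" "\<And>n s s'. s \<in> {a..b} \<inter> ball t \<delta> \<Longrightarrow> s' \<in> {a..b} \<inter> ball t \<delta> \<Longrightarrow> y s n = y s' n"
      unfolding Good_def by blast
    have "t' \<in> Good" if t': "t' \<in> ball t (\<delta> / 2)" for t'
    proof -
      have "ball t' (\<delta> / 2) \<subseteq> ball t \<delta>"
        using t' by (auto simp: dist_real_def abs_if split: if_splits)
      then have "\<forall>n. \<forall>s\<in>{a..b} \<inter> ball t' (\<delta> / 2). \<forall>s'\<in>{a..b} \<inter> ball t' (\<delta> / 2). y s n = y s' n"
        using \<delta>(2) by blast
      then show ?thesis
        unfolding Good_def using \<delta>(1) half_gt_zero by blast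
    qed
    then show "\<exists>e>0. ball t e \<subseteq> Good"
      using \<delta>(1) by (intro exI[of _ "\<delta> / 2"]) auto
  qed
  define P where "P = {a..b} - Good"
  have closedP: "closed P"
    unfolding P_def using \<open>open Good\<close> by (intro closed_Diff) auto
  \<comment> \<open>Only the open interval must avoid \<open>P\<close>; continuity of
    \<open>y\<close> extends constancy to the endpoints, which usually do lie in
    \<open>P\<close>.\<close>
  have gap_const: "y s n = y s' n" if ss: "s \<le> s'" "{s..s'} \<subseteq> {a..b}" "{s<..<s'} \<inter> P = {}" for s s' n
  proof (cases "s = s'")
    case False
    have "norm (y s' n - y s n) \<le> 0 - 0"
    proof (rule differentiable_bound_general[where f' = "\<lambda>_. 0" and \<phi> = "\<lambda>_. 0" and \<phi>' = "\<lambda>_. 0"])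
      fix x assume x: "s < x" "x < s'"
      then have xI: "x \<in> {a..b}" "{s<..<s'} \<subseteq> {a..b}"
        using ss by auto
      then have "x \<in> Good"
        using ss(3) x by (auto simp: P_def)
      then obtain \<delta> where \<delta>: "0 < \<delta>"
          "\<forall>n. \<forall>s\<in>{a..b} \<inter> ball x \<delta>. \<forall>s'\<in>{a..b} \<inter> ball x \<delta>. y s n = y s' n"
        unfolding Good_def by blast
      show "((\<lambda>t. y t n) has_vector_derivative 0) (at x)"
      proof (rule has_vector_derivative_transform_within_open[of "\<lambda>_. y x n" _ _ "{s<..<s'} \<inter> ball x \<delta>"])
        show "y x n = y z n" if "z \<in> {s<..<s'} \<inter> ball x \<delta>" for z
          using \<delta>(2)[rule_format, of x z n] \<delta>(1) that xI by auto
      qed (use x \<delta>(1) in auto)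
    qed (use False ss in \<open>auto intro: continuous_on_subset[OF conty]\<close>)
    then show ?thesis by simp
  qed simp
  have "P = {}"
  proof (rule ccontr)
    assume ne: "P \<noteq> {}"
    \<comment> \<open>The single index \<open>M\<close> bounds the size and, through the rate
      \<open>1 / (M + 1)\<close>, the unknown decay, so countably many sets cover \<open>P\<close>.
      Bounding finite sums only makes each set closed.\<close>
    define A where "A = (\<lambda>M :: nat. {t \<in> {a..b}. \<forall>F. finite F \<longrightarrow>
      (\<Sum>n\<in>F. norm (\<mu> n * c t n) * exp (lnorm n / (real M + 1))) \<le> real M})"
    have "closed (A M)" for M
    proof -
      have "A M = {a..b} \<inter> (\<Inter>F\<in>Collect finite. {t \<in> {a..b}.
          (\<Sum>n\<in>F. norm (\<mu> n * c t n) * exp (lnorm n / (real M + 1))) \<le> real M})"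
        by (auto simp: A_def)
      moreover have "closed {t \<in> {a..b}. (\<Sum>n\<in>F. norm (\<mu> n * c t n) * exp (lnorm n / (real M + 1))) \<le> real M}" for F
        by (intro continuous_on_closed_Collect_le continuous_intros cont closed_atLeastAtMost)
      ultimately show ?thesis by (simp add: closed_INT closed_Int)
    qed
    moreover have "P \<subseteq> (\<Union>M. A M)"
    proof
      fix t assume "t \<in> P"
      then have t: "t \<in> {a..b}" by (simp add: P_def)
      obtain s where s: "0 < s" "(\<lambda>n. norm (\<mu> n * c t n) * exp (s * lnorm n)) summable_on UNIV"
        using dom[OF t] by blast
      let ?S = "\<Sum>\<^sub>\<infinity>n. norm (\<mu> n * c t n) * exp (s * lnorm n)"
      obtain M :: nat where M: "max (1 / s) ?S < real M"
        using reals_Archimedean2 by blast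
      have sM: "1 / (real M + 1) \<le> s"
      proof -
        have "1 / s \<le> real M + 1" using M by simp
        then show ?thesis using s(1) by (simp add: field_simps)
      qed
      have "(\<Sum>n\<in>F. norm (\<mu> n * c t n) * exp (lnorm n / (real M + 1))) \<le> real M" if F: "finite F" for F
      proof -
        have "lnorm n / (real M + 1) \<le> s * lnorm n" for n :: "int ^ 'n"
          using mult_right_mono[OF sM, of "lnorm n"] by simp
        then have "(\<Sum>n\<in>F. norm (\<mu> n * c t n) * exp (lnorm n / (real M + 1))) \<le>
            (\<Sum>n\<in>F. norm (\<mu> n * c t n) * exp (s * lnorm n))"
          by (intro sum_mono mult_left_mono) auto
        also have "\<dots> \<le> ?S"
          by (rule finite_sum_le_infsum[OF s(2) F]) auto
        finally show ?thesis using M by simp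
      qed
      then show "t \<in> (\<Union>M. A M)"
        using t by (auto simp: A_def)
    qed
    ultimately obtain M t\<^sub>0 \<delta> where M: "t\<^sub>0 \<in> P" "0 < \<delta>" "P \<inter> ball t\<^sub>0 \<delta> \<subseteq> A M"
      using closed_union_contains_interior[OF closedP ne, of A] by metis
    \<comment> \<open>A common weight: weak enough for the Baire bound on the multiplier term and
      for the bound on \<open>r\<close>.\<close>
    define \<sigma> where "\<sigma> = min \<sigma>\<^sub>0 (1 / (real M + 1))"
    have \<sigma>: "0 < \<sigma>" "\<sigma> \<le> \<sigma>\<^sub>0" "\<sigma> \<le> 1 / (real M + 1)"
      using \<sigma>0 by (auto simp: \<sigma>_def)
    have R0: "0 \<le> R"
      by (rule majorized_nonneg[OF majr])
    have rg: "norm (r t n) * exp (\<sigma> * lnorm n) \<le> g n" if "t \<in> {a..b}" for t n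
    proof -
      have "norm (r t n) * exp (\<sigma> * lnorm n) \<le> norm (r t n) * exp (\<sigma>\<^sub>0 * lnorm n)"
        using \<sigma> by (intro mult_left_mono) (auto intro: mult_right_mono)
      then show ?thesis using g(4)[OF that, of n] by linarith
    qed
    define C where "C = real M + R"
    have C0: "0 \<le> C"
      using R0 by (simp add: C_def)
    \<comment> \<open>Used for \<open>v\<close> with \<open>K = 1\<close> and for increments over a
      gap with \<open>K\<close> the length of the gap; \<open>C\<close> adds the Baire bound
      \<open>M\<close> to the bound \<open>R\<close> on the forcing.\<close>
    have dominated: "(\<lambda>n. norm (z n) * exp (\<sigma> * lnorm n)) summable_on UNIV \<and>
        (\<Sum>\<^sub>\<infinity>n. norm (z n) * exp (\<sigma> * lnorm n)) \<le> K * C"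
      if s: "s \<in> P \<inter> ball t\<^sub>0 \<delta>" and K: "0 \<le> K"
        and z: "\<And>n. norm (z n) * exp (\<sigma> * lnorm n) \<le> K * (norm (\<mu> n * c s n) * exp (\<sigma> * lnorm n) + g n)"
      for s K and z :: "int ^ 'n \<Rightarrow> complex"
    proof -
      have fin: "(\<Sum>n\<in>F. norm (z n) * exp (\<sigma> * lnorm n)) \<le> K * C" if F: "finite F" for F
      proof -
        have "norm (\<mu> n * c s n) * exp (\<sigma> * lnorm n) \<le> norm (\<mu> n * c s n) * exp (lnorm n / (real M + 1))" for n
          using mult_right_mono[OF \<sigma>(3), of "lnorm n"] by (intro mult_left_mono) auto
        then have "(\<Sum>n\<in>F. norm (\<mu> n * c s n) * exp (\<sigma> * lnorm n)) \<le>
            (\<Sum>n\<in>F. norm (\<mu> n * c s n) * exp (lnorm n / (real M + 1)))"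
          by (rule sum_mono)
        also have "\<dots> \<le> real M"
          using s M(3) F by (auto simp: A_def)
        finally have 1: "(\<Sum>n\<in>F. norm (\<mu> n * c s n) * exp (\<sigma> * lnorm n)) \<le> real M" .
        have 2: "sum g F \<le> R"
          using finite_sum_le_infsum[OF g(1) F] g by force
        have "(\<Sum>n\<in>F. norm (z n) * exp (\<sigma> * lnorm n)) \<le>
            (\<Sum>n\<in>F. K * (norm (\<mu> n * c s n) * exp (\<sigma> * lnorm n) + g n))"
          by (intro sum_mono z)
        also have "\<dots> = K * ((\<Sum>n\<in>F. norm (\<mu> n * c s n) * exp (\<sigma> * lnorm n)) + sum g F)"
          by (simp only: sum_distrib_left[symmetric] sum.distrib)
        also have "\<dots> \<le> K * C"
          using 1 2 K by (intro mult_left_mono) (auto simp: C_def)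
        finally show ?thesis .
      qed
      have "(\<lambda>n. norm (z n) * exp (\<sigma> * lnorm n)) summable_on UNIV"
        by (rule nonneg_bdd_above_summable_on) (use fin in \<open>auto intro!: bdd_aboveI2\<close>)
      then show ?thesis
        using fin by (auto intro: infsum_le_finite_sums)
    qed
    have dom_v: "(\<lambda>n. norm (v s n) * exp (\<sigma> * lnorm n)) summable_on UNIV \<and>
        (\<Sum>\<^sub>\<infinity>n. norm (v s n) * exp (\<sigma> * lnorm n)) \<le> 1 * C" if s: "s \<in> P \<inter> ball t\<^sub>0 \<delta>" for s
    proof (rule dominated[OF s])
      fix n
      have "norm (v s n) * exp (\<sigma> * lnorm n) \<le> (norm (\<mu> n * c s n) + norm (r s n)) * exp (\<sigma> * lnorm n)"
        unfolding v_def by (intro mult_right_mono norm_triangle_ineq) auto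
      also have "\<dots> \<le> norm (\<mu> n * c s n) * exp (\<sigma> * lnorm n) + g n"
        using rg[of s n] s by (simp add: distrib_right P_def)
      finally show "norm (v s n) * exp (\<sigma> * lnorm n) \<le> 1 * (norm (\<mu> n * c s n) * exp (\<sigma> * lnorm n) + g n)"
        by simp
    qed simp
    have dom_gap: "(\<lambda>n. norm (c s' n - c s n) * exp (\<sigma> * lnorm n)) summable_on UNIV \<and>
        (\<Sum>\<^sub>\<infinity>n. norm (c s' n - c s n) * exp (\<sigma> * lnorm n)) \<le> (s' - s) * C"
      if s: "s \<in> P \<inter> ball t\<^sub>0 \<delta>" and ss: "s < s'" "{s..s'} \<subseteq> {a..b}" "{s<..<s'} \<inter> P = {}" for s s'
    proof (rule dominated[OF s])
      fix n
      define q where "q = (\<lambda>t. exp (t *\<^sub>R (- \<mu> n)) * c t n)"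
      have cV: "c t n = y s n + V t n" if "t \<in> {s..s'}" for t
      proof -
        have "{s<..<t} \<subseteq> {s<..<s'}"
          using that by auto
        then have "{s<..<t} \<inter> P = {}"
          using ss(3) by blast
        then have "y s n = y t n"
          using that ss(2) by (intro gap_const) auto
        then show ?thesis by (simp add: y_def)
      qed
      have derc: "((\<lambda>t. c t n) has_vector_derivative v t n) (at t within {s..s'})" if "t \<in> {s..s'}" for t
      proof (rule has_vector_derivative_transform[OF that cV])
        have "((\<lambda>t. V t n) has_vector_derivative v t n) (at t within {s..s'})"
          by (rule has_vector_derivative_within_subset[OF derV ss(2)]) (use that ss(2) in auto)
        from has_vector_derivative_add[OF has_vector_derivative_const this, of "y s n"]
        show "((\<lambda>t. y s n + V t n) has_vector_derivative v t n) (at t within {s..s'})"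
          by simp
      qed
      have derq: "(q has_vector_derivative exp (t *\<^sub>R (- \<mu> n)) * r t n) (at t within {s..s'})" if "t \<in> {s..s'}" for t
        using has_vector_derivative_mult[OF has_vector_derivative_exp_scaleR[of "- \<mu> n"] derc[OF that]]
        by (simp add: q_def v_def algebra_simps)
      let ?G = "g n / exp (\<sigma> * lnorm n)"
      have "norm (q s' - q s) \<le> s' * ?G - s * ?G"
      proof (rule differentiable_bound_general[OF ss(1)])
        show "continuous_on {s..s'} q"
          by (rule continuous_on_vector_derivative[OF derq])
        show "(q has_vector_derivative exp (t *\<^sub>R (- \<mu> n)) * r t n) (at t)" if "s < t" "t < s'" for t
          using derq[of t] that by (simp add: at_within_Icc_at)
        show "((\<lambda>t. t * ?G) has_vector_derivative ?G) (at t)" for t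
          using has_vector_derivative_mult_left[OF has_vector_derivative_id, of ?G "at t"] by simp
        show "norm (exp (t *\<^sub>R (- \<mu> n)) * r t n) \<le> ?G" if "s < t" "t < s'" for t
        proof -
          have "t \<in> {a..b}" using that ss by auto
          then have "norm (r t n) * exp (\<sigma> * lnorm n) \<le> g n" by (rule rg)
          moreover have "norm (exp (t *\<^sub>R (- \<mu> n)) * r t n) = norm (r t n)"
            unfolding norm_mult by (subst norm_exp_scaleR_imaginary) (simp_all add: \<mu>)
          ultimately show ?thesis
            by (simp only: pos_le_divide_eq[OF exp_gt_zero])
        qed
      qed (intro continuous_intros)
      then have q: "norm (q s' - q s) \<le> (s' - s) * ?G"
        by (simp only: left_diff_distrib)
      have e1: "norm (exp (t *\<^sub>R \<mu> n)) = 1" for t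
        by (rule norm_exp_scaleR_imaginary[OF \<mu>])
      \<comment> \<open>The increment splits into the free flow of the value at \<open>s\<close> and
        the accumulated forcing \<open>q s' - q s\<close>, so \<mu> multiplies only
        \<open>c s n\<close>.\<close>
      have "c s' n - c s n = (exp ((s' - s) *\<^sub>R \<mu> n) - 1) * c s n + exp (s' *\<^sub>R \<mu> n) * (q s' - q s)"
        by (simp add: q_def scaleR_diff_left exp_diff exp_minus field_simps)
      then have "norm (c s' n - c s n) \<le> norm (exp ((s' - s) *\<^sub>R \<mu> n) - 1) * norm (c s n) + norm (q s' - q s)"
        using norm_triangle_ineq[of "(exp ((s' - s) *\<^sub>R \<mu> n) - 1) * c s n" "exp (s' *\<^sub>R \<mu> n) * (q s' - q s)"]
        unfolding norm_mult e1 by simp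
      also have "\<dots> \<le> (s' - s) * norm (\<mu> n) * norm (c s n) + (s' - s) * ?G"
        using ss(1) by (intro add_mono mult_right_mono norm_exp_scaleR_minus_1_le \<mu> q) auto
      finally have "norm (c s' n - c s n) * exp (\<sigma> * lnorm n) \<le>
          ((s' - s) * norm (\<mu> n) * norm (c s n) + (s' - s) * ?G) * exp (\<sigma> * lnorm n)"
        by (rule mult_right_mono) simp
      also have "\<dots> = (s' - s) * (norm (\<mu> n * c s n) * exp (\<sigma> * lnorm n) + g n)"
        by (simp add: norm_mult field_simps)
      finally show "norm (c s' n - c s n) * exp (\<sigma> * lnorm n) \<le>
          (s' - s) * (norm (\<mu> n * c s n) * exp (\<sigma> * lnorm n) + g n)" .
    qed (use ss in simp)
    obtain h where h: "\<And>n. n \<noteq> 0 \<Longrightarrow> mode \<omega> n h \<noteq> 1"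
      using exists_generic_step[OF indep] by blast
    have B0: "0 \<le> B"
      by (rule majorized_nonneg[OF majc])
    have majcc: "majorized {a..b} (\<lambda>_. \<sigma>) c B"
      by (rule majorized_weight_mono[OF majc \<sigma>(2)])
    have key: "y s n = y s' n" if s: "s \<in> P \<inter> ball t\<^sub>0 \<delta>" and s': "s' \<in> P \<inter> ball t\<^sub>0 \<delta>" and le: "s \<le> s'" for s s' n
    proof -
      have seg: "{s..s'} \<subseteq> ball t\<^sub>0 \<delta>" "{s..s'} \<subseteq> {a..b}"
        using s s' by (auto simp: P_def dist_real_def abs_if split: if_splits)
      have bound: "norm (y s' n - y s n) \<le> e * (C * (s' - s) + (B + B))" if e: "0 < e" for e
      proof -
        obtain N :: nat where N: "0 < N" "\<And>k. k \<noteq> n \<Longrightarrow>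
            norm ((\<Sum>j<N. mode \<omega> (k - n) (of_nat j * h)) / of_nat N) \<le> e * exp (\<sigma> * lnorm k)"
          using discrete_mean_small[OF h e \<sigma>(1), of n] by metis
        have approx: "norm (sample_mean \<omega> h N n (synth \<omega> z) - z n) \<le> e * Z"
          if "(\<lambda>n. norm (z n) * exp (\<sigma> * lnorm n)) summable_on UNIV \<and>
            (\<Sum>\<^sub>\<infinity>n. norm (z n) * exp (\<sigma> * lnorm n)) \<le> Z" for z Z
          using that e \<sigma> by (intro sample_mean_synth[OF N]) auto
        have synth_incr: "sample_mean \<omega> h N n (synth \<omega> (\<lambda>n. c t' n - c t n)) =
            sample_mean \<omega> h N n (synth \<omega> (c t')) - sample_mean \<omega> h N n (synth \<omega> (c t))"
          if "t \<in> {a..b}" "t' \<in> {a..b}" for t t'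
          unfolding sample_mean_diff[symmetric] synth_diff[OF abs_c[OF that(2)] abs_c[OF that(1)], symmetric] ..
        \<comment> \<open>The derivative of \<open>H\<close> on \<open>P\<close> is the sampling
          error of \<open>v\<close>. Across a gap \<open>V\<close> has the same increment as the
          coefficient, so the increment of \<open>H\<close> is the sampling error of that of
          \<open>c\<close>. Both errors are at most \<open>e * C\<close> per unit time.\<close>
        define H where "H = (\<lambda>t. sample_mean \<omega> h N n (synth \<omega> (c t)) - V t n)"
        have derH: "(H has_vector_derivative sample_mean \<omega> h N n (synth \<omega> (v t)) - v t n) (at t within {s..s'})"
          if "t \<in> {s..s'}" for t
        proof -
          have tI: "t \<in> {a..b}" using that seg by auto
          have "((\<lambda>s. \<Sum>j<N. synth \<omega> (c s) (of_nat j * h) * cnj (mode \<omega> n (of_nat j * h))) has_vector_derivative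
              (\<Sum>j<N. synth \<omega> (v t) (of_nat j * h) * cnj (mode \<omega> n (of_nat j * h)))) (at t within {a..b})"
            unfolding v_def by (intro has_vector_derivative_sum has_vector_derivative_mult_left ptw[OF tI])
          from has_vector_derivative_mult_left[OF this, of "inverse (of_nat N)"]
          have "(H has_vector_derivative sample_mean \<omega> h N n (synth \<omega> (v t)) - v t n) (at t within {a..b})"
            unfolding H_def sample_mean_def divide_inverse
            by (intro has_vector_derivative_diff derV[OF tI])
          then show ?thesis
            using seg(2) by (rule has_vector_derivative_within_subset)
        qed
        have "norm (H s' - H s) \<le> (e * C) * (s' - s)"
        proof (rule lipschitz_across_gaps[OF closedP _ _ le])
          show "continuous_on {s..s'} H"
            by (rule continuous_on_vector_derivative[OF derH])
          show "\<exists>D. (H has_vector_derivative D) (at t within {s..s'}) \<and> norm D \<le> e * C" if "t \<in> P" "t \<in> {s..s'}" for t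
          proof -
            have "t \<in> P \<inter> ball t\<^sub>0 \<delta>"
              using that seg(1) by blast
            from derH[OF that(2)] approx[OF dom_v[OF this]] show ?thesis
              by (simp only: mult_1) blast
          qed
          fix t t' assume tt: "t \<in> P" "t' \<in> P" "s \<le> t" "t < t'" "t' \<le> s'" "{t<..<t'} \<inter> P = {}"
          then have "t \<in> {s..s'}" "{t..t'} \<subseteq> {s..s'}"
            by auto
          with tt(1) seg have I: "{t..t'} \<subseteq> {a..b}" "t \<in> P \<inter> ball t\<^sub>0 \<delta>"
            by blast+
          have tI: "t \<in> {a..b}" "t' \<in> {a..b}"
            using tt(4) I(1) by auto
          have "y t n = y t' n"
            using tt I by (intro gap_const) auto
          then have "V t' n - V t n = c t' n - c t n"
            by (simp add: y_def algebra_simps)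
          then have "H t' - H t = sample_mean \<omega> h N n (synth \<omega> (\<lambda>n. c t' n - c t n)) - (c t' n - c t n)"
            unfolding H_def synth_incr[OF tI] by (simp add: algebra_simps)
          then show "norm (H t' - H t) \<le> e * C * (t' - t)"
            using approx[OF dom_gap[OF I(2) tt(4) I(1) tt(6)]] by (simp add: mult_ac)
        qed (use s s' in auto)
        moreover have sI: "s \<in> {a..b}" "s' \<in> {a..b}"
          using s s' by (auto simp: P_def)
        have "majorized {a..b} (\<lambda>_. \<sigma>) (\<lambda>_ n. c s' n - c s n) (B + B)"
        proof -
          have "majorized {a..b} (\<lambda>_. \<sigma>) (\<lambda>_. c t) B" if "t \<in> {a..b}" for t
            using majcc that unfolding majorized_def by blast
          then show ?thesis
            using majorized_diff sI by blast
        qed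
        from approx[of "\<lambda>n. c s' n - c s n" "B + B"] majorized_weighted_summable[OF this sI(1)]
        have "norm (sample_mean \<omega> h N n (synth \<omega> (\<lambda>n. c s' n - c s n)) - (c s' n - c s n)) \<le> e * (B + B)"
          by blast
        \<comment> \<open>Returning from the sample mean to the coefficient is done once, for the
          total increment from \<open>s\<close> to \<open>s'\<close>, and costs
          \<open>e * (B + B)\<close>.\<close>
        moreover have "y s' n - y s n = (H s' - H s) -
            (sample_mean \<omega> h N n (synth \<omega> (\<lambda>n. c s' n - c s n)) - (c s' n - c s n))"
          unfolding synth_incr[OF sI] by (simp add: H_def y_def)
        ultimately have "norm (y s' n - y s n) \<le> e * C * (s' - s) + e * (B + B)"
          by (simp only:) (rule order_trans[OF norm_triangle_ineq4 add_mono])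
        then show ?thesis
          by (simp add: algebra_simps)
      qed
      have "norm (y s' n - y s n) \<le> 0"
      proof (rule field_le_epsilon)
        fix e :: real assume e: "0 < e"
        let ?K = "C * (s' - s) + (B + B)"
        have K: "0 \<le> ?K"
          using C0 B0 le by simp
        have "norm (y s' n - y s n) \<le> e / (?K + 1) * ?K"
          using e K by (intro bound) simp
        also have "\<dots> \<le> e"
          using e K by (simp add: field_simps)
        finally show "norm (y s' n - y s n) \<le> 0 + e" by simp
      qed
      then show ?thesis by simp
    qed
    \<comment> \<open>A time outside \<open>P\<close> is joined by a gap to the nearest point of
      \<open>P\<close> between it and \<open>t\<^sub>0\<close>, and \<open>key\<close> covers the
      rest. Hence \<open>y\<close> is constant near \<open>t\<^sub>0\<close> for all n, against
      \<open>t\<^sub>0\<close> lying in \<open>P\<close>.\<close>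
    have "y s n = y t\<^sub>0 n" if s: "s \<in> {a..b} \<inter> ball t\<^sub>0 \<delta>" for s n
    proof (cases "t\<^sub>0 \<le> s")
      case True
      define Q where "Q = P \<inter> {t\<^sub>0..s}"
      have Q: "Q \<noteq> {}" "bdd_above Q" "closed Q"
        using True M(1) closedP by (auto simp: Q_def)
      have SQ: "Sup Q \<in> Q"
        by (rule closed_contains_Sup[OF Q])
      have "{Sup Q<..<s} \<inter> P = {}"
        using cSup_upper[OF _ Q(2)] SQ by (fastforce simp: Q_def)
      then have "y (Sup Q) n = y s n"
        using SQ s by (intro gap_const) (auto simp: Q_def P_def)
      moreover have "y t\<^sub>0 n = y (Sup Q) n"
        using SQ M(1,2) s by (intro key) (auto simp: Q_def dist_real_def)
      ultimately show ?thesis by simp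
    next
      case False
      define Q where "Q = P \<inter> {s..t\<^sub>0}"
      have Q: "Q \<noteq> {}" "bdd_below Q" "closed Q"
        using False M(1) closedP by (auto simp: Q_def)
      have SQ: "Inf Q \<in> Q"
        by (rule closed_contains_Inf[OF Q])
      have "{s<..<Inf Q} \<inter> P = {}"
        using cInf_lower[OF _ Q(2)] SQ by (fastforce simp: Q_def)
      then have "y s n = y (Inf Q) n"
        using SQ s by (intro gap_const) (auto simp: Q_def P_def)
      moreover have "y (Inf Q) n = y t\<^sub>0 n"
        using SQ M(1,2) s by (intro key) (auto simp: Q_def dist_real_def)
      ultimately show ?thesis by simp
    qed
    then have "t\<^sub>0 \<in> Good"
      unfolding Good_def using M(2) by auto
    with M(1) show False
      by (simp add: P_def)
  qed
  have cV: "c s n = y a n + V s n" if "s \<in> {a..b}" for s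
    using gap_const[of a s n] that \<open>P = {}\<close> by (simp add: y_def)
  have "((\<lambda>s. y a n + V s n) has_vector_derivative 0 + v t n) (at t within {a..b})"
    by (intro has_vector_derivative_add has_vector_derivative_const derV t)
  then have "((\<lambda>s. c s n) has_vector_derivative v t n) (at t within {a..b})"
    unfolding add_0_left by (rule has_vector_derivative_transform[OF t cV, rotated])
  then show ?thesis
    by (simp add: v_def)
qed

section \<open>Local well-posedness\<close>

lemma V_norm_diff:
  fixes \<omega> :: "real ^ 'n::finite"
  assumes "u \<in> V_space \<omega> s" "v \<in> V_space \<omega> s" "0 \<le> s" and indep: "\<forall>n. freq \<omega> n = 0 \<longrightarrow> n = 0"
  shows "V_norm \<omega> s (\<lambda>x. u x - v x) =
      (\<Sum>\<^sub>\<infinity>n. norm (fourier_coeff \<omega> u n - fourier_coeff \<omega> v n) * exp (s * lnorm n))"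
  unfolding V_norm_def fourier_coeff_diff[OF assms] ..

lemma weighted_diff_summable:
  fixes c d :: "int ^ 'n::finite \<Rightarrow> complex"
  assumes "(\<lambda>n. norm (c n) * exp (s * lnorm n)) summable_on UNIV"
    "(\<lambda>n. norm (d n) * exp (s * lnorm n)) summable_on UNIV"
  shows "(\<lambda>n. norm (c n - d n) * exp (s * lnorm n)) summable_on UNIV"
proof (rule summable_on_comparison_test[OF summable_on_add[OF assms]])
  fix n
  show "norm (c n - d n) * exp (s * lnorm n) \<le> norm (c n) * exp (s * lnorm n) + norm (d n) * exp (s * lnorm n)"
    using mult_right_mono[OF norm_triangle_ineq4[of "c n" "d n"], of "exp (s * lnorm n)"]
    by (simp add: distrib_right)
qed simp

lemma V_norm_triangle:
  fixes \<omega> :: "real ^ 'n::finite"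
  assumes u: "u \<in> V_space \<omega> s" and v: "v \<in> V_space \<omega> s" and "0 \<le> s" and indep: "\<forall>n. freq \<omega> n = 0 \<longrightarrow> n = 0"
  shows "V_norm \<omega> s u \<le> V_norm \<omega> s (\<lambda>x. u x - v x) + V_norm \<omega> s v"
proof -
  note su = V_spaceE(1)[OF u \<open>0 \<le> s\<close> indep] and sv = V_spaceE(1)[OF v \<open>0 \<le> s\<close> indep]
  note sd = weighted_diff_summable[OF su sv]
  show ?thesis
    unfolding V_norm_diff[OF assms] unfolding V_norm_def infsum_add[OF sd sv, symmetric]
  proof (rule infsum_mono[OF su summable_on_add[OF sd sv]])
    fix n
    have "norm (fourier_coeff \<omega> u n) \<le> norm (fourier_coeff \<omega> u n - fourier_coeff \<omega> v n) + norm (fourier_coeff \<omega> v n)"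
      using norm_triangle_ineq[of "fourier_coeff \<omega> u n - fourier_coeff \<omega> v n" "fourier_coeff \<omega> v n"] by simp
    from mult_right_mono[OF this, of "exp (s * lnorm n)"]
    show "norm (fourier_coeff \<omega> u n) * exp (s * lnorm n) \<le>
        norm (fourier_coeff \<omega> u n - fourier_coeff \<omega> v n) * exp (s * lnorm n) +
        norm (fourier_coeff \<omega> v n) * exp (s * lnorm n)"
      by (simp add: distrib_right)
  qed
qed

lemma V_norm_diff_commute:
  fixes \<omega> :: "real ^ 'n::finite"
  assumes "u \<in> V_space \<omega> s" "v \<in> V_space \<omega> s" "0 \<le> s" and indep: "\<forall>n. freq \<omega> n = 0 \<longrightarrow> n = 0"
  shows "V_norm \<omega> s (\<lambda>x. u x - v x) = V_norm \<omega> s (\<lambda>x. v x - u x)"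
  unfolding V_norm_diff[OF assms] V_norm_diff[OF assms(2,1,3,4)] by (simp add: norm_minus_commute)

lemma linear_le_exp:
  assumes "0 < (s :: real)"
  shows "x \<le> 1 / s * exp (s * x)"
proof -
  have "s * x \<le> exp (s * x)"
    using exp_ge_add_one_self[of "s * x"] by linarith
  then show ?thesis
    using assms by (simp add: field_simps)
qed

text \<open>This fixes \<gamma> for existence and for uniqueness; the summand 1 keeps it positive
  when \<open>X = 0\<close>.\<close>

lemma contraction_rate:
  assumes "0 < (\<Lambda> :: real)" "0 \<le> X"
  shows "\<Lambda> / (2 * \<Lambda> * X + 1) * X \<le> 1 / 2"
proof -
  have "0 \<le> \<Lambda> * X" using assms by simp
  then show ?thesis by (simp add: field_simps)
qed

section \<open>Translation between the Cauchy problem and the coefficient equation\<close>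

locale quasiperiodic_cauchy =
  fixes \<omega> :: "real ^ 'n::finite" and m :: "real \<Rightarrow> complex" and p :: nat and k \<kappa> \<epsilon> C :: real
  assumes indep: "\<forall>n. freq \<omega> n = 0 \<longrightarrow> n = 0"
    and \<kappa>: "0 < \<kappa>" "\<kappa> < k"
    and imaginary: "\<And>\<xi>. Re (m \<xi>) = 0"
    and \<epsilon>: "0 < \<epsilon>" "\<epsilon> \<le> k"
    and growth: "\<And>n. norm (m (freq \<omega> n)) \<le> C * exp ((k - \<epsilon>) * lnorm n)"
    and symmetry: "\<And>\<xi>. m (- \<xi>) = cnj (m \<xi>)"
begin

definition \<mu> :: "int ^ 'n \<Rightarrow> complex" where "\<mu> n = - m (freq \<omega> n)"
definition \<rho> :: "int ^ 'n \<Rightarrow> complex" where "\<rho> n = - (\<i> * freq \<omega> n)"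

lemma \<omega>_nonzero: "\<omega> \<noteq> 0"
proof
  assume "\<omega> = 0"
  then have "(vec 1 :: int ^ 'n) = 0"
    using indep by simp
  then show False
    by (simp add: vec_eq_iff)
qed

sublocale coefficient_ode \<mu> \<rho> "norm \<omega>" p
proof
  show "Re (\<mu> n) = 0" for n by (simp add: \<mu>_def imaginary)
  show "norm (\<rho> n) \<le> norm \<omega> * lnorm n" for n
    using Cauchy_Schwarz_ineq2[of \<omega> "lattice_vec n"] by (simp add: \<rho>_def norm_mult)
  show "0 < norm \<omega>" by (simp add: \<omega>_nonzero)
qed

lemma \<mu>_uminus: "\<mu> (- n) = cnj (\<mu> n)"
  by (simp add: \<mu>_def lattice_vec_uminus symmetry)

lemma \<rho>_uminus: "\<rho> (- n) = cnj (\<rho> n)"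
  by (simp add: \<rho>_def lattice_vec_uminus)

lemma C_nonneg: "0 \<le> C"
  using order_trans[OF norm_ge_zero growth[of 0]] by simp

text \<open>A polynomial factor is cheaper than any exponential: \<open>linear_le_exp\<close> pays
  for the derivative with half of the weight. This suffices where a fixed loss is allowed, unlike in
  the Picard iteration.\<close>

lemma majorized_\<rho>_mult:
  assumes "majorized I (\<lambda>_. 2 * s) g B" "0 < s"
  shows "majorized I (\<lambda>_. s) (\<lambda>t n. \<rho> n * g t n) (norm \<omega> / s * B)"
proof -
  obtain b where b: "b summable_on UNIV" "infsum b UNIV \<le> B" "\<And>n. 0 \<le> b n"
      "\<And>t n. t \<in> I \<Longrightarrow> norm (g t n) * exp (2 * s * lnorm n) \<le> b n"
    using assms(1) by (rule majorizedE) blast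
  have "norm (\<rho> n * g t n) * exp (s * lnorm n) \<le> norm \<omega> / s * b n" if "t \<in> I" for t n
  proof -
    have "norm (\<rho> n) \<le> norm \<omega> * (1 / s * exp (s * lnorm n))"
      by (rule order_trans[OF norm_\<rho>]) (intro mult_left_mono linear_le_exp assms(2), auto)
    then have "norm (\<rho> n * g t n) * exp (s * lnorm n) \<le>
        (norm \<omega> * (1 / s * exp (s * lnorm n)) * norm (g t n)) * exp (s * lnorm n)"
      unfolding norm_mult by (intro mult_right_mono) auto
    also have "\<dots> = norm \<omega> / s * (norm (g t n) * exp (2 * s * lnorm n))"
      by (simp add: exp_add[symmetric] mult_ac flip: mult_2)
    also have "\<dots> \<le> norm \<omega> / s * b n"
      using b(4)[OF that] assms(2) by (intro mult_left_mono) auto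
    finally show ?thesis .
  qed
  moreover have "(\<Sum>\<^sub>\<infinity>n. norm \<omega> / s * b n) \<le> norm \<omega> / s * B"
    unfolding infsum_cmult_right' using b(2) assms(2) by (intro mult_left_mono) auto
  ultimately show ?thesis
    using b(3) assms(2) by (intro majorizedI[OF summable_on_cmult_right[OF b(1), of "norm \<omega> / s"]]) auto
qed

text \<open>Used in both directions: to verify the equation for a function built from coefficients,
  and to identify the time derivative of a given solution.\<close>

lemma synth_rhs:
  assumes c: "(\<lambda>n. norm (c n)) summable_on UNIV"
    and mc: "(\<lambda>n. norm (\<mu> n * c n)) summable_on UNIV"
    and rg: "(\<lambda>n. norm (\<rho> n * cpow c (Suc p) n)) summable_on UNIV"
  shows "synth \<omega> (\<lambda>n. \<mu> n * c n + \<rho> n * cpow c (Suc p) n) x + multiplier \<omega> m (synth \<omega> c) x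
     + vector_derivative (\<lambda>y. synth \<omega> c y ^ (p + 1)) (at x) = 0"
proof -
  let ?g = "cpow c (Suc p)"
  have g: "(\<lambda>n. norm (?g n)) summable_on UNIV"
    by (rule cpow_abs_summable[OF c])
  have ig: "(\<lambda>n. norm (\<i> * freq \<omega> n * ?g n)) summable_on UNIV"
    using rg by (simp add: \<rho>_def norm_mult del: cpow.simps)
  have "(\<lambda>y. synth \<omega> c y ^ (p + 1)) = synth \<omega> ?g"
    unfolding Suc_eq_plus1[symmetric] synth_cpow[OF c, symmetric] ..
  then have vd: "vector_derivative (\<lambda>y. synth \<omega> c y ^ (p + 1)) (at x) = synth \<omega> (\<lambda>n. \<i> * freq \<omega> n * ?g n) x"
    using vector_derivative_at[OF synth_derivative[OF g ig]] by (simp del: cpow.simps)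
  have "multiplier \<omega> m (synth \<omega> c) x = (\<Sum>\<^sub>\<infinity>n. m (freq \<omega> n) * c n * mode \<omega> n x)"
    by (simp add: multiplier_def fourier_coeff_synth[OF indep c])
  also have "\<dots> = - synth \<omega> (\<lambda>n. \<mu> n * c n) x"
    by (simp add: synth_def \<mu>_def infsum_uminus)
  finally have "multiplier \<omega> m (synth \<omega> c) x = - synth \<omega> (\<lambda>n. \<mu> n * c n) x" .
  moreover have "synth \<omega> (\<lambda>n. \<i> * freq \<omega> n * ?g n) x = - synth \<omega> (\<lambda>n. \<rho> n * ?g n) x"
    by (simp add: synth_def \<rho>_def infsum_uminus del: cpow.simps)
  ultimately show ?thesis
    unfolding synth_add[OF mc rg] vd by simp
qed

text \<open>The two lower bounds on \<open>W\<close> have different purposes: \<kappa> places u in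
  \<open>C_space\<close>, while \<open>k - \<epsilon> / 2\<close> stays above the growth exponent
  \<open>k - \<epsilon>\<close> of the symbol, so the multiplier series is dominated uniformly in
  time and can be differentiated and summed termwise.\<close>

lemma solution_of_coefficients:
  assumes T: "0 < T" and W: "\<And>t. t \<in> {-T..T} \<Longrightarrow> \<kappa> \<le> W t" "\<And>t. t \<in> {-T..T} \<Longrightarrow> k - \<epsilon> / 2 \<le> W t"
    and sol: "solves {-T..T} c" and maj: "majorized {-T..T} W c B"
    and sym: "\<And>t n. t \<in> {-T..T} \<Longrightarrow> c t (- n) = cnj (c t n)"
    and u: "u = (\<lambda>t. if t \<in> {-T..T} then synth \<omega> (c t) else undefined)"
  shows "classical_solution \<omega> m p \<kappa> T u"
    and "\<And>t. t \<in> {-T..T} \<Longrightarrow> fourier_coeff \<omega> (u t) = c t"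
proof -
  let ?I = "{-T..T}" and ?g = "\<lambda>t. cpow (c t) (Suc p)"
  have maj\<kappa>: "majorized ?I (\<lambda>_. \<kappa>) c B"
    by (rule majorized_weight_mono[OF maj W(1)])
  have abs_c: "(\<lambda>n. norm (c t n)) summable_on UNIV" if "t \<in> ?I" for t
    using majorized_abs_summable[OF maj\<kappa> that] \<kappa> by simp
  have weighted: "(\<lambda>n. norm (c t n) * exp (\<kappa> * lnorm n)) summable_on UNIV" if "t \<in> ?I" for t
    using majorized_weighted_summable(1)[OF maj\<kappa> that] .
  show fc: "fourier_coeff \<omega> (u t) = c t" if "t \<in> ?I" for t
    using fourier_coeff_synth[OF indep abs_c[OF that]] that by (auto simp: u)
  have V: "u t \<in> V_real \<omega> \<kappa>" if "t \<in> ?I" for t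
    unfolding V_real_def
    using synth_in_V_space[OF weighted[OF that]] synth_real[OF abs_c[OF that] sym[OF that]] \<kappa> that by (auto simp: u)
  have contc: "continuous_on ?I (\<lambda>t. c t n)" for n
    by (rule continuous_on_vector_derivative) (use sol in \<open>unfold solves_def, blast\<close>)
  obtain a where a: "a summable_on UNIV" "infsum a UNIV \<le> B" "\<And>n. 0 \<le> a n"
      "\<And>t n. t \<in> ?I \<Longrightarrow> norm (c t n) * exp (\<kappa> * lnorm n) \<le> a n"
    using maj\<kappa> by (rule majorizedE) blast
  have C_space: "u \<in> C_space \<omega> \<kappa> T"
    unfolding C_space_def
  proof (intro CollectI conjI ballI)
    show "u \<in> ?I \<rightarrow>\<^sub>E V_real \<omega> \<kappa>"
      using V by (auto simp: u)
    fix t assume t: "t \<in> ?I"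
    have lim: "((\<lambda>r. \<Sum>\<^sub>\<infinity>n. norm (c r n - c t n) * exp (\<kappa> * lnorm n)) \<longlongrightarrow> (\<Sum>\<^sub>\<infinity>n :: int ^ 'n. 0)) (at t within ?I)"
    proof (rule tendsto_infsum_dominated)
      show "(\<lambda>n. a n + a n) summable_on UNIV"
        by (intro summable_on_add a)
      show "((\<lambda>r. norm (c r n - c t n) * exp (\<kappa> * lnorm n)) \<longlongrightarrow> 0) (at t within ?I)" for n
      proof (intro tendsto_mult_left_zero tendsto_norm_zero LIM_zero)
        show "((\<lambda>r. c r n) \<longlongrightarrow> c t n) (at t within ?I)"
          using contc[of n] t by (simp add: continuous_on_def)
      qed
      have "norm (norm (c r n - c t n) * exp (\<kappa> * lnorm n)) \<le> a n + a n" if "r \<in> ?I" for r n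
      proof -
        have "norm (c r n - c t n) * exp (\<kappa> * lnorm n) \<le> (norm (c r n) + norm (c t n)) * exp (\<kappa> * lnorm n)"
          by (intro mult_right_mono norm_triangle_ineq4) auto
        then show ?thesis
          using a(4)[OF that, of n] a(4)[OF t, of n] by (simp add: distrib_right)
      qed
      then show "\<forall>\<^sub>F r in at t within ?I. \<forall>n\<in>UNIV. norm (norm (c r n - c t n) * exp (\<kappa> * lnorm n)) \<le> a n + a n"
        by (auto simp: eventually_at_filter)
    qed
    have ev: "\<forall>\<^sub>F r in at t within ?I. (\<Sum>\<^sub>\<infinity>n. norm (c r n - c t n) * exp (\<kappa> * lnorm n)) =
        V_norm \<omega> \<kappa> (\<lambda>x. u r x - u t x)"
      unfolding eventually_at_filter
    proof (intro always_eventually allI impI)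
      fix r assume r: "r \<in> ?I"
      show "(\<Sum>\<^sub>\<infinity>n. norm (c r n - c t n) * exp (\<kappa> * lnorm n)) = V_norm \<omega> \<kappa> (\<lambda>x. u r x - u t x)"
        using V_norm_diff[of "u r" \<omega> \<kappa> "u t"] V[OF r] V[OF t] \<kappa> indep fc[OF r] fc[OF t] by (simp add: V_real_def)
    qed
    show "((\<lambda>r. V_norm \<omega> \<kappa> (\<lambda>x. u r x - u t x)) \<longlongrightarrow> 0) (at t within ?I)"
      using Lim_transform_eventually[OF lim ev] by (simp only: infsum_0_simp)
  qed
  have "majorized ?I (\<lambda>_. k - \<epsilon> / 2) c B"
    by (rule majorized_weight_mono[OF maj W(2)])
  then obtain b where b: "b summable_on UNIV" "infsum b UNIV \<le> B" "\<And>n. 0 \<le> b n"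
      "\<And>t n. t \<in> ?I \<Longrightarrow> norm (c t n) * exp ((k - \<epsilon> / 2) * lnorm n) \<le> b n"
    by (rule majorizedE) blast
  have m_bound: "norm (m (freq \<omega> n) * c t n) * exp (\<epsilon> / 2 * lnorm n) \<le> C * b n" if "t \<in> ?I" for t n
  proof -
    have "norm (m (freq \<omega> n) * c t n) * exp (\<epsilon> / 2 * lnorm n) \<le>
        (C * exp ((k - \<epsilon>) * lnorm n) * norm (c t n)) * exp (\<epsilon> / 2 * lnorm n)"
      unfolding norm_mult by (intro mult_right_mono growth) auto
    also have "\<dots> = C * (norm (c t n) * (exp ((k - \<epsilon>) * lnorm n) * exp (\<epsilon> / 2 * lnorm n)))"
      by (simp add: mult_ac)
    also have "\<dots> = C * (norm (c t n) * exp ((k - \<epsilon> / 2) * lnorm n))"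
      by (simp add: exp_add[symmetric] algebra_simps)
    also have "\<dots> \<le> C * b n"
      by (intro mult_left_mono b that C_nonneg)
    finally show ?thesis .
  qed
  have dom: "u t \<in> multiplier_dom \<omega> m" if "t \<in> ?I" for t
    unfolding multiplier_dom_def
  proof (intro CollectI exI[of _ "\<epsilon> / 2"] conjI)
    show "(\<lambda>n. norm (m (freq \<omega> n) * fourier_coeff \<omega> (u t) n) * exp (\<epsilon> / 2 * lnorm n)) summable_on UNIV"
      unfolding fc[OF that]
      by (rule summable_on_comparison_test[OF summable_on_cmult_right[OF b(1)] m_bound[OF that]]) simp
  qed (use \<epsilon> in simp)
  have \<mu>_bound: "norm (\<mu> n * c t n) \<le> C * b n" if "t \<in> ?I" for t n
    using order_trans[OF norm_le_weighted[of "\<epsilon> / 2"] m_bound[OF that]] \<epsilon> by (simp add: \<mu>_def norm_mult)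
  have majg: "majorized ?I (\<lambda>_. 2 * (\<kappa> / 2)) ?g (B ^ Suc p)"
    using majorized_cpow[OF maj\<kappa>, of "Suc p"] \<kappa> by (simp del: cpow.simps)
  obtain d where d: "d summable_on UNIV" "\<And>n. 0 \<le> d n" "\<And>t n. t \<in> ?I \<Longrightarrow> norm (\<rho> n * ?g t n) \<le> d n"
    using majorized_norm_bound[OF majorized_\<rho>_mult[OF majg]] \<kappa> by (auto simp del: cpow.simps)
  let ?v = "\<lambda>t n. \<mu> n * c t n + \<rho> n * ?g t n"
  have v_bound: "norm (?v t n) \<le> C * b n + d n" if "t \<in> ?I" for t n
    using norm_triangle_mono[OF \<mu>_bound[OF that] d(3)[OF that]] .
  have bd: "(\<lambda>n. C * b n + d n) summable_on UNIV"
    by (intro summable_on_add summable_on_cmult_right b d)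
  define u\<^sub>t where "u\<^sub>t = (\<lambda>t. synth \<omega> (?v t))"
  have "continuous_on ?I (\<lambda>t. u\<^sub>t t x)" for x
    unfolding u\<^sub>t_def synth_def
  proof (rule continuous_on_infsum_dominated[OF _ _ bd])
    show "continuous_on ?I (\<lambda>t. ?v t n * mode \<omega> n x)" for n
      using \<kappa> by (intro continuous_intros contc continuous_on_cpow[OF maj\<kappa>]) auto
    show "norm (?v t n * mode \<omega> n x) \<le> C * b n + d n" if "t \<in> ?I" for t n
      using v_bound[OF that] by (simp add: norm_mult del: cpow.simps)
  qed
  moreover have "((\<lambda>r. u r x) has_vector_derivative u\<^sub>t t x) (at t within ?I)" if t: "t \<in> ?I" for t x
  proof (rule has_vector_derivative_transform[OF t])
    show "u r x = (\<Sum>\<^sub>\<infinity>n. c r n * mode \<omega> n x)" if "r \<in> ?I" for r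
      using that by (simp add: u synth_def)
    show "((\<lambda>r. \<Sum>\<^sub>\<infinity>n. c r n * mode \<omega> n x) has_vector_derivative u\<^sub>t t x) (at t within ?I)"
      unfolding u\<^sub>t_def synth_def
    proof (rule has_vector_derivative_infsum[OF _ t _ _ bd])
      show "((\<lambda>r. c r n * mode \<omega> n x) has_vector_derivative ?v s n * mode \<omega> n x) (at s within ?I)"
        if "s \<in> ?I" for s n
        using sol that unfolding solves_def by (intro has_vector_derivative_mult_left) blast
      show "norm (?v s n * mode \<omega> n x) \<le> C * b n + d n" if "s \<in> ?I" for s n
        using v_bound[OF that] by (simp add: norm_mult del: cpow.simps)
      show "(\<lambda>n. c r n * mode \<omega> n x) summable_on UNIV" if "r \<in> ?I" for r
        by (rule synth_summable[OF abs_c[OF that]])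
    qed simp
  qed
  moreover have "u\<^sub>t t x + multiplier \<omega> m (u t) x + vector_derivative (\<lambda>y. u t y ^ (p + 1)) (at x) = 0"
    if t: "t \<in> ?I" for t x
  proof -
    have 1: "(\<lambda>n. norm (\<mu> n * c t n)) summable_on UNIV"
      by (rule summable_on_comparison_test[OF summable_on_cmult_right[OF b(1)] \<mu>_bound[OF t]]) simp
    have 2: "(\<lambda>n. norm (\<rho> n * ?g t n)) summable_on UNIV"
      by (rule summable_on_comparison_test[OF d(1) d(3)[OF t]]) simp
    have "u t = synth \<omega> (c t)"
      using t by (simp add: u)
    then show ?thesis
      using synth_rhs[OF abs_c[OF t] 1 2, of x] by (simp only: u\<^sub>t_def)
  qed
  ultimately show "classical_solution \<omega> m p \<kappa> T u"
    unfolding classical_solution_def using C_space dom by blast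
qed

text \<open>The bridge to unconditional uniqueness: an arbitrary classical solution, with no bound
  beyond its space, gets the sum-of-suprema control and the coefficient equation that
  \<open>stability\<close> requires.\<close>

lemma coefficients_of_solution:
  assumes u: "classical_solution \<omega> m p \<kappa> T u"
  obtains B where "majorized {-T..T} (\<lambda>_. \<kappa> / 2) (\<lambda>t. fourier_coeff \<omega> (u t)) B"
    and "solves {-T..T} (\<lambda>t. fourier_coeff \<omega> (u t))"
proof -
  let ?I = "{-T..T}"
  define c where "c = (\<lambda>t. fourier_coeff \<omega> (u t))"
  let ?g = "\<lambda>t. cpow (c t) (Suc p)"
  have V: "u t \<in> V_space \<omega> \<kappa>" if "t \<in> ?I" for t
    using u that by (auto simp: classical_solution_def C_space_def V_real_def)
  have lim: "((\<lambda>r. V_norm \<omega> \<kappa> (\<lambda>x. u r x - u t x)) \<longlongrightarrow> 0) (at t within ?I)" if "t \<in> ?I" for t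
    using u that by (auto simp: classical_solution_def C_space_def)
  have \<kappa>0: "0 \<le> \<kappa>" using \<kappa> by simp
  have weighted: "(\<lambda>n. norm (c t n) * exp (\<kappa> * lnorm n)) summable_on UNIV" if "t \<in> ?I" for t
    unfolding c_def by (rule V_spaceE(1)[OF V[OF that] \<kappa>0 indep])
  have synth: "u t = synth \<omega> (c t)" if "t \<in> ?I" for t
    unfolding c_def by (rule V_spaceE(2)[OF V[OF that] \<kappa>0 indep])
  have abs_c: "(\<lambda>n. norm (c t n)) summable_on UNIV" if "t \<in> ?I" for t
    by (rule weighted_summable_imp_abs_summable[OF weighted[OF that] \<kappa>0])
  have coeff_le: "norm (c r n - c t n) \<le> V_norm \<omega> \<kappa> (\<lambda>x. u r x - u t x)" if "r \<in> ?I" "t \<in> ?I" for r t n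
  proof -
    have "norm (c r n - c t n) \<le> (\<Sum>n\<in>{n}. norm (c r n - c t n) * exp (\<kappa> * lnorm n))"
      using norm_le_weighted[OF \<kappa>0] by simp
    also have "\<dots> \<le> V_norm \<omega> \<kappa> (\<lambda>x. u r x - u t x)"
      unfolding V_norm_diff[OF V[OF that(1)] V[OF that(2)] \<kappa>0 indep] c_def[symmetric] fun_cong[OF c_def, symmetric]
      by (rule finite_sum_le_infsum[OF weighted_diff_summable[OF weighted[OF that(1)] weighted[OF that(2)]]]) auto
    finally show ?thesis .
  qed
  have contc: "continuous_on ?I (\<lambda>t. c t n)" for n
    unfolding continuous_on_def
  proof
    fix t assume t: "t \<in> ?I"
    have "((\<lambda>r. c r n - c t n) \<longlongrightarrow> 0) (at t within ?I)"
      by (rule Lim_null_comparison[OF _ lim[OF t]]) (use coeff_le t in \<open>auto simp: eventually_at_filter\<close>)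
    then show "((\<lambda>r. c r n) \<longlongrightarrow> c t n) (at t within ?I)"
      by (rule LIM_zero_cancel)
  qed
  have "continuous_on ?I (\<lambda>t. V_norm \<omega> \<kappa> (u t))"
    unfolding continuous_on_def
  proof
    fix t assume t: "t \<in> ?I"
    have "norm (V_norm \<omega> \<kappa> (u r) - V_norm \<omega> \<kappa> (u t)) \<le> V_norm \<omega> \<kappa> (\<lambda>x. u r x - u t x)" if r: "r \<in> ?I" for r
      using V_norm_triangle[OF V[OF r] V[OF t] \<kappa>0 indep] V_norm_triangle[OF V[OF t] V[OF r] \<kappa>0 indep]
        V_norm_diff_commute[OF V[OF r] V[OF t] \<kappa>0 indep] by simp
    then have "((\<lambda>r. V_norm \<omega> \<kappa> (u r) - V_norm \<omega> \<kappa> (u t)) \<longlongrightarrow> 0) (at t within ?I)"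
      by (intro Lim_null_comparison[OF _ lim[OF t]]) (auto simp: eventually_at_filter)
    then show "((\<lambda>r. V_norm \<omega> \<kappa> (u r)) \<longlongrightarrow> V_norm \<omega> \<kappa> (u t)) (at t within ?I)"
      by (rule LIM_zero_cancel)
  qed
  from compact_continuous_image[OF this compact_Icc]
  obtain R where R: "\<And>t. t \<in> ?I \<Longrightarrow> V_norm \<omega> \<kappa> (u t) \<le> R"
    using compact_imp_bounded bounded_imp_bdd_above unfolding bdd_above_def by (metis imageI)
  \<comment> \<open>Continuity into the space bounds the supremum over time of a sum. To put the
    supremum inside, each weighted coefficient is bounded by \<open>R\<close>; giving up half of the
    weight leaves the summable factor \<open>exp (- (\<kappa> / 2) * lnorm n)\<close>.\<close>
  define B where "B = (\<Sum>\<^sub>\<infinity>n :: int ^ 'n. \<bar>R\<bar> * exp (- (\<kappa> / 2) * lnorm n))"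
  have maj: "majorized ?I (\<lambda>_. \<kappa> / 2) c B"
  proof (rule majorizedI)
    show "(\<lambda>n :: int ^ 'n. \<bar>R\<bar> * exp (- (\<kappa> / 2) * lnorm n)) summable_on UNIV"
      using \<kappa> by (intro summable_on_cmult_right lattice_exp_summable) simp
    show "(\<Sum>\<^sub>\<infinity>n :: int ^ 'n. \<bar>R\<bar> * exp (- (\<kappa> / 2) * lnorm n)) \<le> B"
      by (simp add: B_def)
    fix t and n :: "int ^ 'n" assume t: "t \<in> ?I"
    have "(\<Sum>n\<in>{n}. norm (c t n) * exp (\<kappa> * lnorm n)) \<le> V_norm \<omega> \<kappa> (u t)"
      unfolding V_norm_def fun_cong[OF c_def, symmetric] by (rule finite_sum_le_infsum[OF weighted[OF t]]) auto
    with R[OF t] have "norm (c t n) * exp (\<kappa> * lnorm n) \<le> \<bar>R\<bar>"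
      by simp
    from mult_right_mono[OF this, of "exp (- (\<kappa> / 2) * lnorm n)"]
    have "norm (c t n) * (exp (\<kappa> * lnorm n) * exp (- (\<kappa> / 2) * lnorm n)) \<le> \<bar>R\<bar> * exp (- (\<kappa> / 2) * lnorm n)"
      by (simp add: mult.assoc)
    moreover have "exp (\<kappa> * lnorm n) * exp (- (\<kappa> / 2) * lnorm n) = exp (\<kappa> / 2 * lnorm n)"
      by (simp add: exp_add[symmetric])
    ultimately show "norm (c t n) * exp (\<kappa> / 2 * lnorm n) \<le> \<bar>R\<bar> * exp (- (\<kappa> / 2) * lnorm n)"
      by (simp only:)
  qed simp
  \<comment> \<open>The derivative in the nonlinear term halves the weight once more, and
    \<open>c\<close> is stated in the same weight as this forcing.\<close>
  have maj4: "majorized ?I (\<lambda>_. \<kappa> / 4) c B"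
    by (rule majorized_weight_mono[OF maj]) (use \<kappa> in simp)
  have majg: "majorized ?I (\<lambda>_. 2 * (\<kappa> / 4)) ?g (B ^ Suc p)"
    using majorized_cpow[OF maj, of "Suc p"] \<kappa> by (simp del: cpow.simps)
  have majr: "majorized ?I (\<lambda>_. \<kappa> / 4) (\<lambda>t n. \<rho> n * ?g t n) (norm \<omega> / (\<kappa> / 4) * B ^ Suc p)"
    by (rule majorized_\<rho>_mult[OF majg]) (use \<kappa> in simp)
  have dom: "\<exists>s>0. (\<lambda>n. norm (\<mu> n * c t n) * exp (s * lnorm n)) summable_on UNIV" if "t \<in> ?I" for t
    using u that by (auto simp: classical_solution_def multiplier_dom_def \<mu>_def c_def norm_mult)
  have ptw: "((\<lambda>s. synth \<omega> (c s) x) has_vector_derivative synth \<omega> (\<lambda>n. \<mu> n * c t n + \<rho> n * ?g t n) x) (at t within ?I)"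
    if t: "t \<in> ?I" for t x
  proof (rule has_vector_derivative_transform[OF t])
    show "synth \<omega> (c s) x = u s x" if "s \<in> ?I" for s
      by (simp add: synth[OF that])
    obtain s where "0 < s" "(\<lambda>n. norm (\<mu> n * c t n) * exp (s * lnorm n)) summable_on UNIV"
      using dom[OF t] by blast
    then have 1: "(\<lambda>n. norm (\<mu> n * c t n)) summable_on UNIV"
      by (intro weighted_summable_imp_abs_summable) auto
    have 2: "(\<lambda>n. norm (\<rho> n * ?g t n)) summable_on UNIV"
      by (rule majorized_abs_summable[OF majr t]) (use \<kappa> in simp)
    obtain u\<^sub>t where u\<^sub>t: "((\<lambda>r. u r x) has_vector_derivative u\<^sub>t) (at t within ?I)"
      "u\<^sub>t + multiplier \<omega> m (u t) x + vector_derivative (\<lambda>y. u t y ^ (p + 1)) (at x) = 0"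
      using u t unfolding classical_solution_def by blast
    \<comment> \<open>At fixed t and x the given time derivative and the synthesized right-hand side
      satisfy the same scalar equation, so they agree without differentiating under the sum.\<close>
    have "synth \<omega> (\<lambda>n. \<mu> n * c t n + \<rho> n * ?g t n) x + multiplier \<omega> m (u t) x
        + vector_derivative (\<lambda>y. u t y ^ (p + 1)) (at x) = 0"
      using synth_rhs[OF abs_c[OF t] 1 2, of x] by (simp only: synth[OF t])
    from trans[OF u\<^sub>t(2) this[symmetric]]
    have "u\<^sub>t = synth \<omega> (\<lambda>n. \<mu> n * c t n + \<rho> n * ?g t n) x"
      by (simp only: add_right_cancel)
    with u\<^sub>t(1) show "((\<lambda>s. u s x) has_vector_derivative synth \<omega> (\<lambda>n. \<mu> n * c t n + \<rho> n * ?g t n) x) (at t within ?I)"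
      by simp
  qed
  have "solves ?I c"
    unfolding solves_def
  proof (intro ballI allI)
    fix t n assume t: "t \<in> ?I"
    show "((\<lambda>s. c s n) has_vector_derivative \<mu> n * c t n + \<rho> n * ?g t n) (at t within ?I)"
    proof (rule pointwise_imp_coefficient_ode[OF indep contc _ _ maj4 majr Re_\<mu> dom ptw t])
      show "continuous_on ?I (\<lambda>t. \<rho> n * ?g t n)" for n
        by (intro continuous_intros continuous_on_cpow[OF maj contc]) (use \<kappa> in simp)
    qed (use \<kappa> in auto)
  qed
  with maj show thesis
    unfolding c_def by (rule that)
qed

lemma solution_unique:
  assumes u: "classical_solution \<omega> m p \<kappa> T u" and v: "classical_solution \<omega> m p \<kappa> T v" and init: "u 0 = v 0"
    and T: "0 < T"
  shows "u = v"
proof -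
  let ?I = "{-T..T}"
  let ?c = "\<lambda>t. fourier_coeff \<omega> (u t)" and ?d = "\<lambda>t. fourier_coeff \<omega> (v t)"
  obtain B\<^sub>1 where c: "majorized ?I (\<lambda>_. \<kappa> / 2) ?c B\<^sub>1" "solves ?I ?c"
    using u by (rule coefficients_of_solution)
  obtain B\<^sub>2 where d: "majorized ?I (\<lambda>_. \<kappa> / 2) ?d B\<^sub>2" "solves ?I ?d"
    using v by (rule coefficients_of_solution)
  define B where "B = max B\<^sub>1 B\<^sub>2"
  have cB: "majorized ?I (\<lambda>_. \<kappa> / 2) ?c B" and dB: "majorized ?I (\<lambda>_. \<kappa> / 2) ?d B"
    by (rule majorized_mono[OF c(1)], simp add: B_def) (rule majorized_mono[OF d(1)], simp add: B_def)
  have B0: "0 \<le> B"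
    by (rule majorized_nonneg[OF cB])
  define X where "X = real (Suc p) * B ^ p"
  have X: "0 \<le> X"
    using B0 by (simp add: X_def)
  define \<gamma> where "\<gamma> = 2 * norm \<omega> * X + 1"
  have \<gamma>: "0 < \<gamma>"
    using X by (simp add: \<gamma>_def add_nonneg_pos)
  have small: "norm \<omega> / \<gamma> * (real (Suc p) * B ^ p) \<le> 1 / 2"
    using contraction_rate[OF \<Lambda>_pos X] by (simp add: \<gamma>_def X_def)
  \<comment> \<open>The time in which a weight starting at \<open>\<kappa> / 2\<close> falls to 0 at
    speed \<gamma>.\<close>
  define \<delta> where "\<delta> = \<kappa> / 2 / \<gamma>"
  have \<delta>: "0 < \<delta>"
    using \<gamma> \<kappa> by (simp add: \<delta>_def)
  have local: "?c t = ?d t" if t0: "t\<^sub>0 \<in> ?I" "?c t\<^sub>0 = ?d t\<^sub>0" and t: "t \<in> ?I" "\<bar>t - t\<^sub>0\<bar> \<le> \<delta>" for t t\<^sub>0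
  proof -
    define a where "a = max (- T) (t\<^sub>0 - \<delta>)"
    define b where "b = min T (t\<^sub>0 + \<delta>)"
    have ab: "{a..b} \<subseteq> ?I" "t\<^sub>0 \<in> {a..b}" "t \<in> {a..b}" "\<And>s. s \<in> {a..b} \<Longrightarrow> \<bar>s - t\<^sub>0\<bar> \<le> \<delta>"
      using t0 t \<delta> by (auto simp: a_def b_def)
    have maj: "majorized {a..b} (\<lambda>t. \<kappa> / 2 - \<gamma> * \<bar>t - t\<^sub>0\<bar>) z B" if "majorized ?I (\<lambda>_. \<kappa> / 2) z B" for z
      by (rule majorized_weight_mono[OF majorized_subset[OF that ab(1)]]) (use \<gamma> in simp)
    have W: "0 \<le> \<kappa> / 2 - \<gamma> * \<bar>s - t\<^sub>0\<bar>" if "s \<in> {a..b}" for s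
    proof -
      have "\<gamma> * \<bar>s - t\<^sub>0\<bar> \<le> \<gamma> * \<delta>"
        using ab(4)[OF that] \<gamma> by simp
      then show ?thesis
        using \<gamma> by (simp add: \<delta>_def)
    qed
    have le0: "(\<Sum>\<^sub>\<infinity>n. norm (?c t n - ?d t n) * exp ((\<kappa> / 2 - \<gamma> * \<bar>t - t\<^sub>0\<bar>) * lnorm n)) \<le> 2 * 0"
      by (rule stability[OF \<gamma> ab(2) solves_subset[OF c(2) ab(1)] maj[OF cB] solves_subset[OF d(2) ab(1)] maj[OF dB] W small
            _ _ ab(3)]) (simp_all add: t0(2))
    have sum: "(\<lambda>n. norm (?c t n - ?d t n) * exp ((\<kappa> / 2 - \<gamma> * \<bar>t - t\<^sub>0\<bar>) * lnorm n)) summable_on UNIV"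
      by (rule majorized_weighted_summable(1)[OF majorized_diff[OF maj[OF cB] maj[OF dB]] ab(3)])
    have "norm (?c t n - ?d t n) * exp ((\<kappa> / 2 - \<gamma> * \<bar>t - t\<^sub>0\<bar>) * lnorm n) = 0" for n
      by (rule nonneg_infsum_le_0D[OF _ sum]) (use le0 in auto)
    then show ?thesis
      by (intro ext) simp
  qed
  \<comment> \<open>The bound \<open>B\<close> with full weight \<open>\<kappa> / 2\<close> holds on
    the whole interval, so every restart has the same \<delta> and finitely many steps reach
    \<open>T\<close>.\<close>
  have global: "?c t = ?d t" if "t \<in> ?I" "\<bar>t\<bar> \<le> real j * \<delta>" for t j
    using that
  proof (induction j arbitrary: t)
    case 0
    then show ?case using init by simp
  next
    case (Suc j)
    define D where "D = real j * \<delta>"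
    have D: "0 \<le> D" "\<bar>t\<bar> \<le> D + \<delta>"
      using \<delta> Suc.prems(2) by (simp_all add: D_def algebra_simps)
    \<comment> \<open>The point of \<open>{- D..D}\<close> closest to \<open>t\<close>; as 0 lies in
      the interval, moving towards 0 does not leave it.\<close>
    define s where "s = max (- D) (min D t)"
    have "\<bar>s\<bar> \<le> D" "s \<in> ?I" "\<bar>t - s\<bar> \<le> \<delta>"
      using Suc.prems(1) D T \<delta> by (auto simp: s_def abs_le_iff max_def min_def)
    then show ?case
      using Suc.IH[of s] Suc.prems(1) local[of s t] by (simp add: D_def)
  qed
  have eq: "u t = v t" if "t \<in> ?I" for t
  proof -
    obtain j :: nat where "T / \<delta> < real j"
      using reals_Archimedean2 by blast
    then have "T \<le> real j * \<delta>"
      using \<delta> by (simp add: field_simps)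
    then have "?c t = ?d t"
      using that by (intro global[of t j]) auto
    moreover have "u t \<in> V_space \<omega> \<kappa>" "v t \<in> V_space \<omega> \<kappa>"
      using u v that by (auto simp: classical_solution_def C_space_def V_real_def)
    ultimately show ?thesis
      using V_spaceE(2)[OF _ _ indep] \<kappa> by (metis less_imp_le)
  qed
  show ?thesis
    by (rule PiE_ext[of u ?I "\<lambda>_. V_real \<omega> \<kappa>" v])
      (use u v eq in \<open>auto simp: classical_solution_def C_space_def\<close>)
qed

theorem locally_well_posed:
  assumes u0: "u\<^sub>0 \<in> V_real \<omega> k"
  shows "\<exists>r>0. \<exists>T>0. u\<^sub>0 \<in> V_ball \<omega> k u\<^sub>0 r \<and>
     (\<forall>v \<in> V_ball \<omega> k u\<^sub>0 r. \<exists>!u. classical_solution \<omega> m p \<kappa> T u \<and> u 0 = v) \<and>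
     (\<exists>K\<ge>0. \<forall>v \<in> V_ball \<omega> k u\<^sub>0 r. \<forall>w \<in> V_ball \<omega> k u\<^sub>0 r.
        C_norm \<omega> \<kappa> T (\<lambda>t x. data_to_solution \<omega> m p \<kappa> T v t x - data_to_solution \<omega> m p \<kappa> T w t x)
          \<le> K * V_norm \<omega> k (\<lambda>x. v x - w x))"
proof -
  have k0: "0 \<le> k" using \<kappa> by simp
  have V0: "u\<^sub>0 \<in> V_space \<omega> k"
    using u0 by (simp add: V_real_def)
  \<comment> \<open>Bounds the norm on the whole unit ball around \<open>u\<^sub>0\<close>. As
    \<gamma> and \<open>T\<close> depend on the data through \<open>S\<close> only, they serve all
    data in the ball.\<close>
  define S where "S = V_norm \<omega> k u\<^sub>0 + 1"
  have S: "0 \<le> S"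
    unfolding S_def V_norm_def by (intro add_nonneg_nonneg infsum_nonneg) auto
  define X where "X = real (Suc p) * (2 * S) ^ p"
  have X: "0 \<le> X"
    using S by (simp add: X_def)
  define \<gamma> where "\<gamma> = 2 * norm \<omega> * X + 1"
  have \<gamma>: "0 < \<gamma>"
    using X by (simp add: \<gamma>_def add_nonneg_pos)
  have small: "norm \<omega> / \<gamma> * (real (Suc p) * (2 * S) ^ p) \<le> 1 / 2"
    using contraction_rate[OF \<Lambda>_pos X] by (simp add: \<gamma>_def X_def)
  \<comment> \<open>At speed \<gamma> the weight, starting at \<open>k\<close>, must fall neither
    below \<kappa> nor below \<open>k - \<epsilon> / 2\<close>; both are required by
    \<open>solution_of_coefficients\<close>.\<close>
  define T where "T = min (k - \<kappa>) (\<epsilon> / 2) / \<gamma>"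
  have T: "0 < T"
    using \<gamma> \<kappa> \<epsilon> by (simp add: T_def)
  let ?I = "{-T..T}" and ?W = "\<lambda>t. k - \<gamma> * \<bar>t - 0\<bar>"
  have W: "\<kappa> \<le> ?W t" "k - \<epsilon> / 2 \<le> ?W t" if "t \<in> ?I" for t
  proof -
    have "\<bar>t\<bar> \<le> T"
      using that by auto
    then have "\<gamma> * \<bar>t\<bar> \<le> \<gamma> * T"
      using \<gamma> by simp
    moreover have "\<gamma> * T = min (k - \<kappa>) (\<epsilon> / 2)"
      using \<gamma> by (simp add: T_def)
    ultimately show "\<kappa> \<le> ?W t" "k - \<epsilon> / 2 \<le> ?W t"
      by auto
  qed
  have W0: "0 \<le> ?W t" if "t \<in> ?I" for t
    using W(1)[OF that] \<kappa> by linarith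
  have I0: "0 \<in> ?I"
    using T by simp
  have ball: "v \<in> V_real \<omega> k" "v \<in> V_space \<omega> k" "V_norm \<omega> k v \<le> S" if "v \<in> V_ball \<omega> k u\<^sub>0 1" for v
  proof -
    show "v \<in> V_real \<omega> k" and V: "v \<in> V_space \<omega> k"
      using that by (auto simp: V_ball_def V_real_def)
    show "V_norm \<omega> k v \<le> S"
      using V_norm_triangle[OF V V0 k0 indep] that by (auto simp: V_ball_def S_def)
  qed
  have ex: "\<exists>u. classical_solution \<omega> m p \<kappa> T u \<and> u 0 = v \<and>
      solves ?I (\<lambda>t. fourier_coeff \<omega> (u t)) \<and> majorized ?I ?W (\<lambda>t. fourier_coeff \<omega> (u t)) (2 * S)"
    if v: "v \<in> V_ball \<omega> k u\<^sub>0 1" for v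
  proof -
    define \<alpha> where "\<alpha> = fourier_coeff \<omega> v"
    have data: "(\<lambda>n. norm (\<alpha> n) * exp (k * lnorm n)) summable_on UNIV"
      "(\<Sum>\<^sub>\<infinity>n. norm (\<alpha> n) * exp (k * lnorm n)) \<le> S"
      unfolding \<alpha>_def using V_spaceE(1)[OF ball(2)[OF v] k0 indep] ball(3)[OF v] by (auto simp: V_norm_def)
    have sym\<alpha>: "\<alpha> (- n) = cnj (\<alpha> n)" for n
      unfolding \<alpha>_def by (rule fourier_coeff_real[OF ball(1)[OF v] k0 indep])
    obtain c where c: "solves ?I c" "c 0 = \<alpha>" "majorized ?I ?W c (2 * S)"
      "\<And>t n. t \<in> ?I \<Longrightarrow> c t (- n) = cnj (c t n)"
      using existence[OF \<gamma> I0 W0 small data] \<mu>_uminus \<rho>_uminus sym\<alpha> by auto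
    define u where "u = (\<lambda>t. if t \<in> ?I then synth \<omega> (c t) else undefined)"
    have sol: "classical_solution \<omega> m p \<kappa> T u"
      by (rule solution_of_coefficients(1)[OF T W c(1,3,4) u_def])
    have fc: "fourier_coeff \<omega> (u t) = c t" if "t \<in> ?I" for t
      by (rule solution_of_coefficients(2)[OF T W c(1,3,4) u_def that])
    have "u 0 = v"
      using V_spaceE(2)[OF ball(2)[OF v] k0 indep] I0 c(2) by (simp add: u_def \<alpha>_def)
    moreover have "solves ?I (\<lambda>t. fourier_coeff \<omega> (u t))"
      unfolding solves_def
    proof (intro ballI allI, rule has_vector_derivative_transform)
      fix t n assume t: "t \<in> ?I"
      show "((\<lambda>s. c s n) has_vector_derivative \<mu> n * fourier_coeff \<omega> (u t) n +
          \<rho> n * cpow (fourier_coeff \<omega> (u t)) (Suc p) n) (at t within ?I)"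
        using c(1) t unfolding solves_def fc[OF t] by blast
    qed (simp_all add: fc)
    moreover have "majorized ?I ?W (\<lambda>t. fourier_coeff \<omega> (u t)) (2 * S)"
      by (rule majorized_cong[OF c(3)]) (simp add: fc)
    ultimately show ?thesis
      using sol by blast
  qed
  have unique: "\<exists>!u. classical_solution \<omega> m p \<kappa> T u \<and> u 0 = v" if "v \<in> V_ball \<omega> k u\<^sub>0 1" for v
    using ex[OF that] solution_unique[OF _ _ _ T] by metis
  \<comment> \<open>Uniqueness identifies the solution chosen by \<open>THE\<close> with the
    constructed one, which transfers the bound \<open>2 * S\<close> in the weight \<open>?W\<close>.
    \<open>coefficients_of_solution\<close> alone would start at \<open>\<kappa> / 2\<close>, too
    little to compare with data measured in weight \<open>k\<close>.\<close>
  have dts: "classical_solution \<omega> m p \<kappa> T (data_to_solution \<omega> m p \<kappa> T v) \<and> data_to_solution \<omega> m p \<kappa> T v 0 = v \<and>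
      solves ?I (\<lambda>t. fourier_coeff \<omega> (data_to_solution \<omega> m p \<kappa> T v t)) \<and>
      majorized ?I ?W (\<lambda>t. fourier_coeff \<omega> (data_to_solution \<omega> m p \<kappa> T v t)) (2 * S)"
    if v: "v \<in> V_ball \<omega> k u\<^sub>0 1" for v
  proof -
    obtain u where u: "classical_solution \<omega> m p \<kappa> T u \<and> u 0 = v"
      "solves ?I (\<lambda>t. fourier_coeff \<omega> (u t)) \<and> majorized ?I ?W (\<lambda>t. fourier_coeff \<omega> (u t)) (2 * S)"
      using ex[OF v] by blast
    have "data_to_solution \<omega> m p \<kappa> T v = u"
      unfolding data_to_solution_def
    proof (rule the_equality)
      show "u' = u" if "classical_solution \<omega> m p \<kappa> T u' \<and> u' 0 = v" for u'
        using solution_unique[OF _ _ _ T] that u(1) by metis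
    qed (rule u(1))
    with u show ?thesis by simp
  qed
  have "C_norm \<omega> \<kappa> T (\<lambda>t x. data_to_solution \<omega> m p \<kappa> T v t x - data_to_solution \<omega> m p \<kappa> T w t x)
      \<le> 2 * V_norm \<omega> k (\<lambda>x. v x - w x)"
    if v: "v \<in> V_ball \<omega> k u\<^sub>0 1" and w: "w \<in> V_ball \<omega> k u\<^sub>0 1" for v w
    unfolding C_norm_def
  proof (rule cSUP_least)
    show "?I \<noteq> {}" using I0 by blast
    fix t assume t: "t \<in> ?I"
    define u\<^sub>1 where "u\<^sub>1 = data_to_solution \<omega> m p \<kappa> T v"
    define u\<^sub>2 where "u\<^sub>2 = data_to_solution \<omega> m p \<kappa> T w"
    let ?c = "\<lambda>t. fourier_coeff \<omega> (u\<^sub>1 t)" and ?d = "\<lambda>t. fourier_coeff \<omega> (u\<^sub>2 t)"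
    have 1: "classical_solution \<omega> m p \<kappa> T u\<^sub>1" "u\<^sub>1 0 = v" "solves ?I ?c" "majorized ?I ?W ?c (2 * S)"
      using dts[OF v] by (simp_all add: u\<^sub>1_def)
    have 2: "classical_solution \<omega> m p \<kappa> T u\<^sub>2" "u\<^sub>2 0 = w" "solves ?I ?d" "majorized ?I ?W ?d (2 * S)"
      using dts[OF w] by (simp_all add: u\<^sub>2_def)
    have V: "u\<^sub>1 t \<in> V_space \<omega> \<kappa>" "u\<^sub>2 t \<in> V_space \<omega> \<kappa>"
      using 1(1) 2(1) t by (auto simp: classical_solution_def C_space_def V_real_def)
    have \<kappa>0: "0 \<le> \<kappa>" using \<kappa> by simp
    have sum: "(\<lambda>n. norm (?c t n - ?d t n) * exp (?W t * lnorm n)) summable_on UNIV"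
      by (rule majorized_weighted_summable(1)[OF majorized_diff[OF 1(4) 2(4)] t])
    have sum\<kappa>: "(\<lambda>n. norm (?c t n - ?d t n) * exp (\<kappa> * lnorm n)) summable_on UNIV"
      by (rule weighted_diff_summable[OF V_spaceE(1)[OF V(1) \<kappa>0 indep] V_spaceE(1)[OF V(2) \<kappa>0 indep]])
    have "V_norm \<omega> \<kappa> (\<lambda>x. u\<^sub>1 t x - u\<^sub>2 t x) \<le> (\<Sum>\<^sub>\<infinity>n. norm (?c t n - ?d t n) * exp (?W t * lnorm n))"
      unfolding V_norm_diff[OF V \<kappa>0 indep]
      by (rule infsum_mono[OF sum\<kappa> sum]) (use W(1)[OF t] in \<open>auto intro!: mult_left_mono mult_right_mono\<close>)
    \<comment> \<open>The Lipschitz constant 2 is the factor from \<open>stability\<close>, summing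
      the halvings of its iteration.\<close>
    also have "\<dots> \<le> 2 * V_norm \<omega> k (\<lambda>x. v x - w x)"
    proof (rule stability[OF \<gamma> I0 1(3,4) 2(3,4) W0 small _ _ t])
      show "(\<lambda>n. norm (?c 0 n - ?d 0 n) * exp (k * lnorm n)) summable_on UNIV"
        unfolding 1(2) 2(2)
        by (rule weighted_diff_summable[OF V_spaceE(1)[OF ball(2)[OF v] k0 indep] V_spaceE(1)[OF ball(2)[OF w] k0 indep]])
      show "(\<Sum>\<^sub>\<infinity>n. norm (?c 0 n - ?d 0 n) * exp (k * lnorm n)) \<le> V_norm \<omega> k (\<lambda>x. v x - w x)"
        unfolding 1(2) 2(2) V_norm_diff[OF ball(2)[OF v] ball(2)[OF w] k0 indep] ..
    qed
    finally show "V_norm \<omega> \<kappa> (\<lambda>x. data_to_solution \<omega> m p \<kappa> T v t x - data_to_solution \<omega> m p \<kappa> T w t x)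
        \<le> 2 * V_norm \<omega> k (\<lambda>x. v x - w x)"
      unfolding u\<^sub>1_def u\<^sub>2_def .
  qed
  moreover have "u\<^sub>0 \<in> V_ball \<omega> k u\<^sub>0 1"
    using u0 V_norm_diff[OF V0 V0 k0 indep] by (simp add: V_ball_def)
  ultimately show ?thesis
    using unique T by (intro exI[of _ 1] exI[of _ T] conjI exI[of _ 2]) auto
qed

end

section \<open>From the growth bound in the frequency to a growth bound on the lattice\<close>

theorem theorem1p1:
  fixes \<omega> :: "real ^ 'n::finite" and p :: nat and k \<kappa> :: real and m :: "real \<Rightarrow> complex"
  assumes p: "p \<ge> 1"
    and indep: "\<And>n :: int ^ 'n. (\<Sum>i\<in>UNIV. real_of_int (n $ i) * \<omega> $ i) = 0 \<Longrightarrow> n = 0"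
    and \<kappa>: "0 < \<kappa>" "\<kappa> < k"
    and imaginary: "\<And>\<xi>. Re (m \<xi>) = 0"
    and growth: "\<exists>\<epsilon>>0. bdd_above (range (\<lambda>\<xi>. norm (m \<xi>) * exp (- ((k - \<epsilon>) / norm \<omega>) * \<bar>\<xi>\<bar>)))"
    and symmetry: "\<And>\<xi>. m (- \<xi>) = cnj (m \<xi>)"
  shows "\<forall>u\<^sub>0 \<in> V_real \<omega> k. \<exists>c \<in> V_real \<omega> k. \<exists>r>0. \<exists>T>0.
           u\<^sub>0 \<in> V_ball \<omega> k c r \<and>
           (\<forall>v \<in> V_ball \<omega> k c r. \<exists>!u. classical_solution \<omega> m p \<kappa> T u \<and> u 0 = v) \<and>
           (\<exists>K\<ge>0. \<forall>v \<in> V_ball \<omega> k c r. \<forall>w \<in> V_ball \<omega> k c r.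
              C_norm \<omega> \<kappa> T (\<lambda>t x. data_to_solution \<omega> m p \<kappa> T v t x - data_to_solution \<omega> m p \<kappa> T w t x)
                \<le> K * V_norm \<omega> k (\<lambda>x. v x - w x))"
proof -
  have indep': "\<forall>n. freq \<omega> n = 0 \<longrightarrow> n = 0"
    using indep by (simp add: inner_vec_def lattice_vec_def mult.commute)
  have \<omega>: "\<omega> \<noteq> 0"
  proof
    assume "\<omega> = 0"
    then have "(vec 1 :: int ^ 'n) = 0"
      by (intro indep) simp
    then show False
      by (simp add: vec_eq_iff)
  qed
  obtain \<epsilon>\<^sub>0 C where \<epsilon>0: "0 < \<epsilon>\<^sub>0" and C: "\<And>\<xi>. norm (m \<xi>) * exp (- ((k - \<epsilon>\<^sub>0) / norm \<omega>) * \<bar>\<xi>\<bar>) \<le> C"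
    using growth by (auto simp: bdd_above_def)
  have C0: "0 \<le> C"
    using order_trans[OF _ C[of 0]] by simp
  \<comment> \<open>Lowering \<epsilon> weakens the growth bound and makes
    \<open>k - \<epsilon>\<close> nonnegative, so that the Cauchy-Schwarz bound
    \<open>?x \<le> lnorm n\<close> can be inserted into the exponent.\<close>
  define \<epsilon> where "\<epsilon> = min \<epsilon>\<^sub>0 k"
  have \<epsilon>: "0 < \<epsilon>" "\<epsilon> \<le> k" "\<epsilon> \<le> \<epsilon>\<^sub>0"
    using \<epsilon>0 \<kappa> by (auto simp: \<epsilon>_def)
  have "norm (m (freq \<omega> n)) \<le> C * exp ((k - \<epsilon>) * lnorm n)" for n
  proof -
    let ?x = "\<bar>freq \<omega> n\<bar> / norm \<omega>"
    have x: "?x \<le> lnorm n"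
      using Cauchy_Schwarz_ineq2[of \<omega> "lattice_vec n"] \<omega> by (simp add: divide_simps mult.commute)
    have "norm (m (freq \<omega> n)) * exp (- ((k - \<epsilon>\<^sub>0) * ?x)) \<le> C"
      using C[of "freq \<omega> n"] by simp
    then have "norm (m (freq \<omega> n)) \<le> C * exp ((k - \<epsilon>\<^sub>0) * ?x)"
      by (simp add: exp_minus field_simps)
    also have "\<dots> \<le> C * exp ((k - \<epsilon>) * lnorm n)"
    proof -
      have "(k - \<epsilon>\<^sub>0) * ?x \<le> (k - \<epsilon>) * ?x"
        using \<epsilon> by (intro mult_right_mono) auto
      also have "\<dots> \<le> (k - \<epsilon>) * lnorm n"
        using \<epsilon> by (intro mult_left_mono x) auto
      finally show ?thesis
        using C0 by (simp add: mult_left_mono)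
    qed
    finally show ?thesis .
  qed
  then interpret quasiperiodic_cauchy \<omega> m p k \<kappa> \<epsilon> C
    using indep' \<kappa> imaginary \<epsilon>(1,2) symmetry by unfold_locales auto
  show ?thesis
    using locally_well_posed by blast
qed

end
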